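(* The Lie algebra $\tilde{\mathfrak g}$ leaves invariant the $\tilde{\mathfrak g}_-$-submodule of $\tilde V(\lambda)$ generated by the primitive subspace $\tilde V(\lambda)^{\mathrm{prim}}$, and acts on that submodule through its quotient $\mathfrak g$. In particular, the subrepresentation $V(\lambda)$ generated by $1_\lambda$ is a highest weight representation of $\mathfrak g$. If $\lambda$ is an integral weight, then this representation is integrable in the sense that each of the $e_k$ and $f_k$ ($k=1,\dots,r$) acts on it in a locally nilpotent fashion. In case the given Cartan matrix is that of a finite dimensional Lie algebra, then $V(\lambda)$ is finite dimensional and irreducible.
   Context: $(c_{k,l})_{k,l=1}^r$ is a generalized Cartan matrix ($c_{k,k}=2$; for $k\ne l$, $c_{k,l}\in\mathbb Z_{\le0}$ with $c_{k,l}=0\iff c_{l,k}=0$). $\tilde{\mathfrak g}$ is the complex Lie algebra with generators $\tilde e_k,\tilde f_k$ ($1\le k\le r$) and relations, with $\check\alpha_k:=[\tilde e_k,\tilde f_k]$: $[\tilde e_k,\tilde f_l]=0$ ($k\neq l$), $[\check\alpha_k,\tilde e_l]=c_{k,l}\tilde e_l$, $[\check\alpha_k,\tilde f_l]=-c_{k,l}\tilde f_l$, $[\check\alpha_k,\check\alpha_l]=0$, and $\mathrm{ad}(\tilde f_k)^{1-c_{k,l}}\tilde f_l=0$ for $k\neq l$. $\mathfrak g$ is the quotient of $\tilde{\mathfrak g}$ by the additional relations $\mathrm{ad}(\tilde e_k)^{1-c_{k,l}}\tilde e_l=0$ ($k\neq l$); the images of $\tilde e_k,\tilde f_k$ in $\mathfrak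 g$ are denoted $e_k,f_k$. $\mathfrak h$ is the span of the $\check\alpha_k$; $\tilde{\mathfrak g}_+$ (resp. $\tilde{\mathfrak g}_-$) is the subalgebra of $\tilde{\mathfrak g}$ generated by the $\tilde e_k$ (resp. $\tilde f_k$). For a $\tilde{\mathfrak g}$-module, its primitive part is the subspace of vectors killed by $\tilde{\mathfrak g}_+$. $\mathcal I$ is a countable set with a surjection $\pi:\mathcal I\to\{1,\dots,r\}$ each of whose fibers $\mathcal I_k$ is countably infinite; write $\bar I$ for the image under $\pi$ of a sequence $I$ in $\mathcal I$. Polydifferentials in variables $t_i$ ($i\in\mathcal I$) are like differential forms except that the $dt_i$ commute, with $dt_i^2=0$. For a finite sequence $I=(i_N,\dots,i_1)$ in $\mathcal I$ without repetition let $\zeta_I(z)=\frac{dt_{i_N}\cdots dt_{i_1}}{(t_{i_N}-t_{i_{N-1}})\cdots(t_{i_2}-t_{i_1})(t_{i_1}-z)}$, a polydifferential depending on the parameter $z\in\mathbb C$; $\zeta_\emptyset=1$ and $\zeta_I=0$ if $I$ has a repetition. $\hat{\mathcal B}=\bigoplus_{m\ge0}\hat{\mathcal B}^m$, where $\hat{\mathcal B}^m$ is the space of possibly infinite linear combinations of the $\zeta_I$ with $I$ of length $m$. For a finite sequence $S$ in $\{1,\dots,r\}$ put $\zeta(S)=\sum_{\bar I=S}\zeta_I$; these elements form a basis of the space $\hat{\mathcal B}^{\mathfrak S_\bullet}$ of invariants of $\mathfrak S_\bullet=\prod_k\mathfrak S(\mathcal I_k)$, where $\mathfrak S(\mathcal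 I_k)$ is the permutation group of $\mathcal I_k$. $\lambda\in\mathfrak h^*$ is a dominant weight: each $\lambda(\check\alpha_k)$ is a nonnegative real number; it is integral if each $\lambda(\check\alpha_k)\in\mathbb Z$. $\tilde V(\lambda)$ is $\hat{\mathcal B}^{\mathfrak S_\bullet}$ with the $\tilde{\mathfrak g}$-module structure $\tilde f_k\zeta(S)=\sum_{S=S''S'}\bigl(\lambda(\check\alpha_k)-\sum_{s\in S'}c_{k,s}\bigr)\zeta(S''kS')$ (sum over all decompositions of $S$ as a juxtaposition; $s$ runs over the terms of $S'$ with multiplicity), $\tilde e_k\zeta(S)=\zeta(S')$ if $S=kS'$ and $0$ otherwise. $1_\lambda:=\zeta(\emptyset)=1$, and $V(\lambda)$ is the $\tilde{\mathfrak g}_-$-submodule of $\tilde V(\lambda)$ generated by $1_\lambda$.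
   Formalization: Finite dimensionality of V(λ) in the last sentence is stated only for integral λ: for non-integral dominant λ it fails (sl_2 with λ(α̌)=1/2 gives an infinite dimensional V(λ)); irreducibility is kept for every dominant λ. *)

theory Defs
  imports Complex_Main "HOL-Library.Function_Algebras" "HOL-Library.Groups_Big_Fun"
    "HOL-Library.Nonpos_Ints" "HOL-Library.Countable_Set"
begin

section \<open>Complex Lie algebras given by generators and relations\<close>

text \<open>The presentations depend on a Cartan matrix that is a variable of the theorem, so the
  presented Lie algebras are sets of congruence classes of Lie terms with explicit carrier.\<close>

record 'a lie_algebra =
  lcarrier :: "'a set"
  lzero :: 'a
  ladd :: "'a \<Rightarrow> 'a \<Rightarrow> 'a"
  lscale :: "complex \<Rightarrow> 'a \<Rightarrow> 'a"
  lbracket :: "'a \<Rightarrow> 'a \<Rightarrow> 'a"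

definition lie_subspace :: "'a lie_algebra \<Rightarrow> 'a set \<Rightarrow> bool" where
  "lie_subspace L U \<longleftrightarrow> U \<subseteq> lcarrier L \<and> lzero L \<in> U \<and>
     (\<forall>x\<in>U. \<forall>y\<in>U. ladd L x y \<in> U) \<and> (\<forall>a. \<forall>x\<in>U. lscale L a x \<in> U)"

definition lie_subalgebra :: "'a lie_algebra \<Rightarrow> 'a set \<Rightarrow> bool" where
  "lie_subalgebra L U \<longleftrightarrow> lie_subspace L U \<and> (\<forall>x\<in>U. \<forall>y\<in>U. lbracket L x y \<in> U)"

definition lie_finite_dim :: "'a lie_algebra \<Rightarrow> bool" where
  "lie_finite_dim L \<longleftrightarrow>
     (\<exists>B. finite B \<and> B \<subseteq> lcarrier L \<and> lie_subspace L hull B = lcarrier L)"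

definition linear_functional_on :: "'a lie_algebra \<Rightarrow> 'a set \<Rightarrow> ('a \<Rightarrow> complex) \<Rightarrow> bool" where
  "linear_functional_on L U \<phi> \<longleftrightarrow>
     (\<forall>x\<in>U. \<forall>y\<in>U. \<phi> (ladd L x y) = \<phi> x + \<phi> y) \<and>
     (\<forall>a. \<forall>x\<in>U. \<phi> (lscale L a x) = a * \<phi> x)"

datatype 'g lie_term =
    Gen 'g
  | Zero
  | Add "'g lie_term" "'g lie_term"
  | Scale complex "'g lie_term"
  | Br "'g lie_term" "'g lie_term"

text \<open>The least congruence on Lie terms that contains the given relations and satisfies the
  axioms of a complex Lie algebra.\<close>

inductive lie_cong :: "('g lie_term \<Rightarrow> 'g lie_term \<Rightarrow> bool) \<Rightarrow> 'g lie_term \<Rightarrow> 'g lie_term \<Rightarrow> bool"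
  for R where
  rel: "R s t \<Longrightarrow> lie_cong R s t"
| refl: "lie_cong R s s"
| sym: "lie_cong R s t \<Longrightarrow> lie_cong R t s"
| trans: "lie_cong R s t \<Longrightarrow> lie_cong R t u \<Longrightarrow> lie_cong R s u"
| cong_Add: "lie_cong R s s' \<Longrightarrow> lie_cong R t t' \<Longrightarrow> lie_cong R (Add s t) (Add s' t')"
| cong_Scale: "lie_cong R s s' \<Longrightarrow> lie_cong R (Scale a s) (Scale a s')"
| cong_Br: "lie_cong R s s' \<Longrightarrow> lie_cong R t t' \<Longrightarrow> lie_cong R (Br s t) (Br s' t')"
| add_assoc: "lie_cong R (Add (Add s t) u) (Add s (Add t u))"
| add_commute: "lie_cong R (Add s t) (Add t s)"
| add_zero: "lie_cong R (Add Zero s) s"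
| add_minus: "lie_cong R (Add s (Scale (-1) s)) Zero"
| scale_add_right: "lie_cong R (Scale a (Add s t)) (Add (Scale a s) (Scale a t))"
| scale_add_left: "lie_cong R (Scale (a + b) s) (Add (Scale a s) (Scale b s))"
| scale_scale: "lie_cong R (Scale a (Scale b s)) (Scale (a * b) s)"
| scale_one: "lie_cong R (Scale 1 s) s"
| br_add_left: "lie_cong R (Br (Add s t) u) (Add (Br s u) (Br t u))"
| br_add_right: "lie_cong R (Br s (Add t u)) (Add (Br s t) (Br s u))"
| br_scale_left: "lie_cong R (Br (Scale a s) t) (Scale a (Br s t))"
| br_scale_right: "lie_cong R (Br s (Scale a t)) (Scale a (Br s t))"
| br_self: "lie_cong R (Br s s) Zero"
| jacobi: "lie_cong R (Add (Br s (Br t u)) (Add (Br t (Br u s)) (Br u (Br s t)))) Zero"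

definition lie_class ::
  "('g lie_term \<Rightarrow> 'g lie_term \<Rightarrow> bool) \<Rightarrow> 'g lie_term \<Rightarrow> 'g lie_term set" where
  "lie_class R t = {u. lie_cong R t u}"

definition presented_lie ::
  "('g lie_term \<Rightarrow> 'g lie_term \<Rightarrow> bool) \<Rightarrow> 'g lie_term set lie_algebra" where
  "presented_lie R =
     \<lparr> lcarrier = range (lie_class R),
       lzero = lie_class R Zero,
       ladd = (\<lambda>X Y. \<Union>s\<in>X. \<Union>t\<in>Y. lie_class R (Add s t)),
       lscale = (\<lambda>a X. \<Union>s\<in>X. lie_class R (Scale a s)),
       lbracket = (\<lambda>X Y. \<Union>s\<in>X. \<Union>t\<in>Y. lie_class R (Br s t)) \<rparr>"

lemma lie_class_eq_iff: "lie_class R s = lie_class R t \<longleftrightarrow> lie_cong R s t"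
  unfolding lie_class_def
  by (auto intro: lie_cong.refl lie_cong.sym lie_cong.trans)

lemma lie_class_self: "t \<in> lie_class R t"
  by (simp add: lie_class_def lie_cong.refl)

lemma presented_lie_simps:
  "lcarrier (presented_lie R) = range (lie_class R)"
  "lzero (presented_lie R) = lie_class R Zero"
  "ladd (presented_lie R) (lie_class R s) (lie_class R t) = lie_class R (Add s t)"
  "lscale (presented_lie R) a (lie_class R s) = lie_class R (Scale a s)"
  "lbracket (presented_lie R) (lie_class R s) (lie_class R t) = lie_class R (Br s t)"
proof -
  have Un: "(\<Union>x\<in>A. f x) = C" if "a \<in> A" "\<And>x. x \<in> A \<Longrightarrow> f x = C"
    for a A C and f :: "'a lie_term \<Rightarrow> 'a lie_term set"
    using that by blast
  have Add: "lie_class R (Add s' t') = lie_class R (Add s t)"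
    if "s' \<in> lie_class R s" "t' \<in> lie_class R t" for s' t'
    using that unfolding lie_class_eq_iff
    by (auto simp: lie_class_def intro: lie_cong.cong_Add lie_cong.sym)
  have Scale: "lie_class R (Scale a s') = lie_class R (Scale a s)"
    if "s' \<in> lie_class R s" for s'
    using that unfolding lie_class_eq_iff
    by (auto simp: lie_class_def intro: lie_cong.cong_Scale lie_cong.sym)
  have Br: "lie_class R (Br s' t') = lie_class R (Br s t)"
    if "s' \<in> lie_class R s" "t' \<in> lie_class R t" for s' t'
    using that unfolding lie_class_eq_iff
    by (auto simp: lie_class_def intro: lie_cong.cong_Br lie_cong.sym)
  show "ladd (presented_lie R) (lie_class R s) (lie_class R t) = lie_class R (Add s t)"
    unfolding presented_lie_def lie_algebra.simps
    by (rule Un[OF lie_class_self], rule Un[OF lie_class_self], rule Add)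
  show "lscale (presented_lie R) a (lie_class R s) = lie_class R (Scale a s)"
    unfolding presented_lie_def lie_algebra.simps
    by (rule Un[OF lie_class_self], rule Scale)
  show "lbracket (presented_lie R) (lie_class R s) (lie_class R t) = lie_class R (Br s t)"
    unfolding presented_lie_def lie_algebra.simps
    by (rule Un[OF lie_class_self], rule Un[OF lie_class_self], rule Br)
qed (simp_all add: presented_lie_def)


section \<open>The Lie algebras attached to a generalized Cartan matrix\<close>

definition generalized_cartan :: "('n \<Rightarrow> 'n \<Rightarrow> int) \<Rightarrow> bool" where
  "generalized_cartan c \<longleftrightarrow>
     (\<forall>k. c k k = 2) \<and>
     (\<forall>k l. k \<noteq> l \<longrightarrow> c k l \<le> 0 \<and> (c k l = 0 \<longleftrightarrow> c l k = 0))"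

datatype 'n chevalley = E_gen 'n | F_gen 'n

type_synonym 'n chev_term = "'n chevalley lie_term"

abbreviation eT :: "'n \<Rightarrow> 'n chev_term" where "eT k \<equiv> Gen (E_gen k)"
abbreviation fT :: "'n \<Rightarrow> 'n chev_term" where "fT k \<equiv> Gen (F_gen k)"
abbreviation aT :: "'n \<Rightarrow> 'n chev_term" where "aT k \<equiv> Br (eT k) (fT k)"

inductive tilde_rel :: "('n \<Rightarrow> 'n \<Rightarrow> int) \<Rightarrow> 'n chev_term \<Rightarrow> 'n chev_term \<Rightarrow> bool" for c where
  "k \<noteq> l \<Longrightarrow> tilde_rel c (Br (eT k) (fT l)) Zero"
| "tilde_rel c (Br (aT k) (eT l)) (Scale (of_int (c k l)) (eT l))"
| "tilde_rel c (Br (aT k) (fT l)) (Scale (- of_int (c k l)) (fT l))"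
| "tilde_rel c (Br (aT k) (aT l)) Zero"
| "k \<noteq> l \<Longrightarrow> tilde_rel c ((Br (fT k) ^^ nat (1 - c k l)) (fT l)) Zero"

inductive full_rel :: "('n \<Rightarrow> 'n \<Rightarrow> int) \<Rightarrow> 'n chev_term \<Rightarrow> 'n chev_term \<Rightarrow> bool" for c where
  "tilde_rel c s t \<Longrightarrow> full_rel c s t"
| "k \<noteq> l \<Longrightarrow> full_rel c ((Br (eT k) ^^ nat (1 - c k l)) (eT l)) Zero"

type_synonym 'n lie_elt = "'n chev_term set"

definition g_tilde :: "('n \<Rightarrow> 'n \<Rightarrow> int) \<Rightarrow> 'n lie_elt lie_algebra" where
  "g_tilde c = presented_lie (tilde_rel c)"

definition g_quot :: "('n \<Rightarrow> 'n \<Rightarrow> int) \<Rightarrow> 'n lie_elt lie_algebra" where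
  "g_quot c = presented_lie (full_rel c)"

text \<open>The quotient homomorphism from \<open>g_tilde c\<close> to \<open>g_quot c\<close>.\<close>

definition to_quot :: "('n \<Rightarrow> 'n \<Rightarrow> int) \<Rightarrow> 'n lie_elt \<Rightarrow> 'n lie_elt" where
  "to_quot c X = (\<Union>s\<in>X. lie_class (full_rel c) s)"

lemma to_quot_class: "to_quot c (lie_class (tilde_rel c) t) = lie_class (full_rel c) t"
proof -
  have "lie_cong (full_rel c) s t" if "lie_cong (tilde_rel c) s t" for s t
    using that
  proof induction
    case (rel s t)
    then show ?case by (blast intro: lie_cong.rel full_rel.intros)
  next
    case (sym s t)
    then show ?case by (blast intro: lie_cong.sym)
  next
    case (trans s t u)
    then show ?case by (blast intro: lie_cong.trans)
  qed (rule lie_cong.intros; assumption)+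
  then have "lie_class (full_rel c) s = lie_class (full_rel c) t"
    if "s \<in> lie_class (tilde_rel c) t" for s
    using that unfolding lie_class_eq_iff by (auto simp: lie_class_def intro: lie_cong.sym)
  then show ?thesis
    using lie_class_self[of t "tilde_rel c"] unfolding to_quot_def by blast
qed

definition e_tilde :: "('n \<Rightarrow> 'n \<Rightarrow> int) \<Rightarrow> 'n \<Rightarrow> 'n lie_elt" where
  "e_tilde c k = lie_class (tilde_rel c) (eT k)"

definition f_tilde :: "('n \<Rightarrow> 'n \<Rightarrow> int) \<Rightarrow> 'n \<Rightarrow> 'n lie_elt" where
  "f_tilde c k = lie_class (tilde_rel c) (fT k)"

definition coroot :: "('n \<Rightarrow> 'n \<Rightarrow> int) \<Rightarrow> 'n \<Rightarrow> 'n lie_elt" where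
  "coroot c k = lbracket (g_tilde c) (e_tilde c k) (f_tilde c k)"

definition e_quot :: "('n \<Rightarrow> 'n \<Rightarrow> int) \<Rightarrow> 'n \<Rightarrow> 'n lie_elt" where
  "e_quot c k = to_quot c (e_tilde c k)"

definition f_quot :: "('n \<Rightarrow> 'n \<Rightarrow> int) \<Rightarrow> 'n \<Rightarrow> 'n lie_elt" where
  "f_quot c k = to_quot c (f_tilde c k)"

definition cartan_h :: "('n \<Rightarrow> 'n \<Rightarrow> int) \<Rightarrow> 'n lie_elt set" where
  "cartan_h c = lie_subspace (g_tilde c) hull range (coroot c)"

definition g_tilde_plus :: "('n \<Rightarrow> 'n \<Rightarrow> int) \<Rightarrow> 'n lie_elt set" where
  "g_tilde_plus c = lie_subalgebra (g_tilde c) hull range (e_tilde c)"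

definition g_tilde_minus :: "('n \<Rightarrow> 'n \<Rightarrow> int) \<Rightarrow> 'n lie_elt set" where
  "g_tilde_minus c = lie_subalgebra (g_tilde c) hull range (f_tilde c)"

definition dominant_weight :: "('n \<Rightarrow> 'n \<Rightarrow> int) \<Rightarrow> ('n lie_elt \<Rightarrow> complex) \<Rightarrow> bool" where
  "dominant_weight c \<Lambda> \<longleftrightarrow> linear_functional_on (g_tilde c) (cartan_h c) \<Lambda> \<and>
     (\<forall>k. \<Lambda> (coroot c k) \<in> \<real>\<^sub>\<ge>\<^sub>0)"

definition integral_weight :: "('n \<Rightarrow> 'n \<Rightarrow> int) \<Rightarrow> ('n lie_elt \<Rightarrow> complex) \<Rightarrow> bool" where
  "integral_weight c \<Lambda> \<longleftrightarrow> (\<forall>k. \<Lambda> (coroot c k) \<in> \<int>)"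


section \<open>Representations\<close>

text \<open>In the following, \<open>scale\<close> is the scalar multiplication of an ambient complex vector space
  and the representation space is a subspace \<open>W\<close> of it; values of \<open>\<rho>\<close> outside
  \<open>lcarrier L\<close> and \<open>W\<close> are irrelevant.\<close>

definition lie_rep :: "'a lie_algebra \<Rightarrow> (complex \<Rightarrow> 'v \<Rightarrow> 'v::ab_group_add) \<Rightarrow> 'v set \<Rightarrow>
    ('a \<Rightarrow> 'v \<Rightarrow> 'v) \<Rightarrow> bool" where
  "lie_rep L scale W \<rho> \<longleftrightarrow> module.subspace scale W \<and>
     (\<forall>x\<in>lcarrier L. \<forall>v\<in>W. \<rho> x v \<in> W \<and>
        (\<forall>w\<in>W. \<rho> x (v + w) = \<rho> x v + \<rho> x w) \<and>
        (\<forall>a. \<rho> x (scale a v) = scale a (\<rho> x v)) \<and>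
        (\<forall>a. \<rho> (lscale L a x) v = scale a (\<rho> x v)) \<and>
        (\<forall>y\<in>lcarrier L. \<rho> (ladd L x y) v = \<rho> x v + \<rho> y v \<and>
           \<rho> (lbracket L x y) v = \<rho> x (\<rho> y v) - \<rho> y (\<rho> x v)))"

definition invariant_under :: "('a \<Rightarrow> 'v \<Rightarrow> 'v) \<Rightarrow> 'a set \<Rightarrow> 'v set \<Rightarrow> bool" where
  "invariant_under \<rho> X U \<longleftrightarrow> (\<forall>x\<in>X. \<forall>u\<in>U. \<rho> x u \<in> U)"

text \<open>The smallest subspace of \<open>W\<close> that contains \<open>A\<close> and is stable under all \<open>x \<in> X\<close>.\<close>

definition generated_submodule :: "(complex \<Rightarrow> 'v \<Rightarrow> 'v::ab_group_add) \<Rightarrow> 'v set \<Rightarrow>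
    ('a \<Rightarrow> 'v \<Rightarrow> 'v) \<Rightarrow> 'a set \<Rightarrow> 'v set \<Rightarrow> 'v set" where
  "generated_submodule scale W \<rho> X A =
     (\<lambda>U. module.subspace scale U \<and> U \<subseteq> W \<and> invariant_under \<rho> X U) hull A"

definition locally_nilpotent_on :: "'v set \<Rightarrow> ('v \<Rightarrow> 'v::zero) \<Rightarrow> bool" where
  "locally_nilpotent_on W T \<longleftrightarrow> (\<forall>v\<in>W. \<exists>n. (T ^^ n) v = 0)"

definition irreducible_rep :: "'a lie_algebra \<Rightarrow> (complex \<Rightarrow> 'v \<Rightarrow> 'v::ab_group_add) \<Rightarrow> 'v set \<Rightarrow>
    ('a \<Rightarrow> 'v \<Rightarrow> 'v) \<Rightarrow> bool" where
  "irreducible_rep L scale W \<rho> \<longleftrightarrow> lie_rep L scale W \<rho> \<and> W \<noteq> {0} \<and>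
     (\<forall>U. module.subspace scale U \<and> U \<subseteq> W \<and> invariant_under \<rho> (lcarrier L) U \<longrightarrow>
        U = {0} \<or> U = W)"

definition finite_dim_space :: "(complex \<Rightarrow> 'v \<Rightarrow> 'v::ab_group_add) \<Rightarrow> 'v set \<Rightarrow> bool" where
  "finite_dim_space scale W \<longleftrightarrow> (\<exists>B. finite B \<and> W = module.span scale B)"

text \<open>\<open>v\<close> is a highest weight vector of weight \<open>\<Lambda>\<close> generating the representation
  \<open>W\<close> of \<open>g_quot c\<close>.\<close>

definition highest_weight_rep :: "('n \<Rightarrow> 'n \<Rightarrow> int) \<Rightarrow> (complex \<Rightarrow> 'v \<Rightarrow> 'v::ab_group_add) \<Rightarrow>
    'v set \<Rightarrow> ('n lie_elt \<Rightarrow> 'v \<Rightarrow> 'v) \<Rightarrow> ('n lie_elt \<Rightarrow> complex) \<Rightarrow> 'v \<Rightarrow> bool" where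
  "highest_weight_rep c scale W \<rho> \<Lambda> v \<longleftrightarrow> lie_rep (g_quot c) scale W \<rho> \<and> v \<in> W \<and> v \<noteq> 0 \<and>
     (\<forall>k. \<rho> (e_quot c k) v = 0) \<and>
     (\<forall>x\<in>cartan_h c. \<rho> (to_quot c x) v = scale (\<Lambda> x) v) \<and>
     generated_submodule scale W \<rho> (lcarrier (g_quot c)) {v} = W"


section \<open>Polydifferentials\<close>

text \<open>Since the \<open>dt\<^sub>i\<close> commute and have square zero, the monomials in them are indexed by
  finite sets. A (possibly infinite) polydifferential \<open>\<omega>\<close> is given by its coefficients:
  \<open>\<omega> J t z\<close> is the coefficient of the product of the \<open>dt\<^sub>j\<close> with \<open>j \<in> J\<close>, at the point
  with coordinates \<open>t\<close> and for the value \<open>z\<close> of the parameter.\<close>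

type_synonym 'i polydiff = "'i set \<Rightarrow> ('i \<Rightarrow> complex) \<Rightarrow> complex \<Rightarrow> complex"

definition pscale :: "complex \<Rightarrow> 'i polydiff \<Rightarrow> 'i polydiff" where
  "pscale a \<omega> = (\<lambda>J t z. a * \<omega> J t z)"

interpretation pd: vector_space "pscale :: complex \<Rightarrow> 'i polydiff \<Rightarrow> 'i polydiff"
  by unfold_locales (auto simp: pscale_def fun_eq_iff algebra_simps)

text \<open>A sequence \<open>(i\<^sub>N, \<dots>, i\<^sub>1)\<close> is the list \<open>[i\<^sub>N, \<dots>, i\<^sub>1]\<close>.\<close>

fun zeta_denom :: "'i list \<Rightarrow> ('i \<Rightarrow> complex) \<Rightarrow> complex \<Rightarrow> complex" where
  "zeta_denom [] t z = 1"
| "zeta_denom [i] t z = t i - z"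
| "zeta_denom (i # j # I) t z = (t i - t j) * zeta_denom (j # I) t z"

text \<open>Coefficients are rational functions, regular where the variables are pairwise distinct and
  different from \<open>z\<close>; they are extended by zero, so that equality of coefficients is equality of
  rational functions.\<close>

definition zeta :: "'i list \<Rightarrow> 'i polydiff" where
  "zeta I = (\<lambda>J t z. if distinct I \<and> J = set I \<and> inj_on t J \<and> z \<notin> t ` J
                     then 1 / zeta_denom I t z else 0)"

text \<open>For each \<open>J\<close> only the finitely many sequences enumerating \<open>J\<close> contribute to the
  coefficient, so the following sum is always finite.\<close>

definition zeta_comb :: "('i list \<Rightarrow> complex) \<Rightarrow> 'i polydiff" where
  "zeta_comb a = (\<lambda>J t z. \<Sum>I. a I * zeta I J t z)"

definition B_hat_deg :: "nat \<Rightarrow> 'i polydiff set" where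
  "B_hat_deg m = {zeta_comb a | a. \<forall>I. length I \<noteq> m \<longrightarrow> a I = 0}"

text \<open>Elements of distinct \<open>B_hat_deg m\<close> involve monomials of distinct degrees, so the sum is
  direct.\<close>

definition B_hat :: "'i polydiff set" where
  "B_hat = pd.span (\<Union>m. B_hat_deg m)"

text \<open>The substitution of \<open>t\<^bsub>\<sigma> i\<^esub>\<close> for \<open>t\<^sub>i\<close>; it sends \<open>zeta I\<close> to
  \<open>zeta (map \<sigma> I)\<close>.\<close>

definition perm_act :: "('i \<Rightarrow> 'i) \<Rightarrow> 'i polydiff \<Rightarrow> 'i polydiff" where
  "perm_act \<sigma> \<omega> = (\<lambda>J t z. \<omega> (\<sigma> -` J) (t \<circ> \<sigma>) z)"

text \<open>A family of permutations of the fibres of \<open>\<pi>\<close> is the same as a permutation \<open>\<sigma>\<close> with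
  \<open>\<pi> \<circ> \<sigma> = \<pi>\<close>.\<close>

definition B_hat_inv :: "('i \<Rightarrow> 'n) \<Rightarrow> 'i polydiff set" where
  "B_hat_inv \<pi> = {\<omega> \<in> B_hat. \<forall>\<sigma>. bij \<sigma> \<and> \<pi> \<circ> \<sigma> = \<pi> \<longrightarrow> perm_act \<sigma> \<omega> = \<omega>}"

definition zeta_sym :: "('i \<Rightarrow> 'n) \<Rightarrow> 'n list \<Rightarrow> 'i polydiff" where
  "zeta_sym \<pi> S = zeta_comb (\<lambda>I. if map \<pi> I = S then 1 else 0)"


section \<open>The module of invariant polydifferentials\<close>

definition is_V_tilde_action :: "('n \<Rightarrow> 'n \<Rightarrow> int) \<Rightarrow> ('i \<Rightarrow> 'n) \<Rightarrow> ('n lie_elt \<Rightarrow> complex) \<Rightarrow>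
    ('n lie_elt \<Rightarrow> 'i polydiff \<Rightarrow> 'i polydiff) \<Rightarrow> bool" where
  "is_V_tilde_action c \<pi> \<Lambda> \<rho> \<longleftrightarrow>
     lie_rep (g_tilde c) pscale (B_hat_inv \<pi>) \<rho> \<and>
     (\<forall>k S. \<rho> (f_tilde c k) (zeta_sym \<pi> S) =
        (\<Sum>(S'', S') \<in> {(S'', S'). S'' @ S' = S}.
           pscale (\<Lambda> (coroot c k) - (\<Sum>s\<leftarrow>S'. of_int (c k s))) (zeta_sym \<pi> (S'' @ k # S')))) \<and>
     (\<forall>k. \<rho> (e_tilde c k) (zeta_sym \<pi> []) = 0) \<and>
     (\<forall>k l S. \<rho> (e_tilde c k) (zeta_sym \<pi> (l # S)) = (if l = k then zeta_sym \<pi> S else 0)) \<and>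
     (\<forall>x v. x \<notin> lcarrier (g_tilde c) \<or> v \<notin> B_hat_inv \<pi> \<longrightarrow> \<rho> x v = 0)"

text \<open>The \<open>zeta_sym \<pi> S\<close> form a basis of \<open>B_hat_inv \<pi>\<close> and the \<open>e_tilde c k\<close>,
  \<open>f_tilde c k\<close> generate \<open>g_tilde c\<close>, so the action is unique; the last condition above
  fixes the irrelevant values.\<close>

definition V_tilde_act :: "('n \<Rightarrow> 'n \<Rightarrow> int) \<Rightarrow> ('i \<Rightarrow> 'n) \<Rightarrow> ('n lie_elt \<Rightarrow> complex) \<Rightarrow>
    'n lie_elt \<Rightarrow> 'i polydiff \<Rightarrow> 'i polydiff" where
  "V_tilde_act c \<pi> \<Lambda> = (THE \<rho>. is_V_tilde_action c \<pi> \<Lambda> \<rho>)"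

definition V_tilde_prim :: "('n \<Rightarrow> 'n \<Rightarrow> int) \<Rightarrow> ('i \<Rightarrow> 'n) \<Rightarrow> ('n lie_elt \<Rightarrow> complex) \<Rightarrow>
    'i polydiff set" where
  "V_tilde_prim c \<pi> \<Lambda> =
     {v \<in> B_hat_inv \<pi>. \<forall>x\<in>g_tilde_plus c. V_tilde_act c \<pi> \<Lambda> x v = 0}"

definition minus_submodule :: "('n \<Rightarrow> 'n \<Rightarrow> int) \<Rightarrow> ('i \<Rightarrow> 'n) \<Rightarrow> ('n lie_elt \<Rightarrow> complex) \<Rightarrow>
    'i polydiff set \<Rightarrow> 'i polydiff set" where
  "minus_submodule c \<pi> \<Lambda> A =
     generated_submodule pscale (B_hat_inv \<pi>) (V_tilde_act c \<pi> \<Lambda>) (g_tilde_minus c) A"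

definition one_lam :: "('i \<Rightarrow> 'n) \<Rightarrow> 'i polydiff" where
  "one_lam \<pi> = zeta_sym \<pi> []"

definition V_lam :: "('n \<Rightarrow> 'n \<Rightarrow> int) \<Rightarrow> ('i \<Rightarrow> 'n) \<Rightarrow> ('n lie_elt \<Rightarrow> complex) \<Rightarrow>
    'i polydiff set" where
  "V_lam c \<pi> \<Lambda> = minus_submodule c \<pi> \<Lambda> {one_lam \<pi>}"

text \<open>\<open>\<sigma>\<close> is a representation of \<open>g_quot c\<close> on \<open>W\<close> through which the action of
  \<open>g_tilde c\<close> on \<open>W\<close> factors.\<close>

definition factors_through_quot :: "('n \<Rightarrow> 'n \<Rightarrow> int) \<Rightarrow> ('i \<Rightarrow> 'n) \<Rightarrow> ('n lie_elt \<Rightarrow> complex) \<Rightarrow>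
    'i polydiff set \<Rightarrow> ('n lie_elt \<Rightarrow> 'i polydiff \<Rightarrow> 'i polydiff) \<Rightarrow> bool" where
  "factors_through_quot c \<pi> \<Lambda> W \<sigma> \<longleftrightarrow> lie_rep (g_quot c) pscale W \<sigma> \<and>
     (\<forall>x\<in>lcarrier (g_tilde c). \<forall>w\<in>W. \<sigma> (to_quot c x) w = V_tilde_act c \<pi> \<Lambda> x w)"

end

theory Submission
  imports Defs
begin

text \<open>
  The invariant polydifferentials \<open>zeta_sym \<pi> S\<close> are linearly independent, so \<open>B_hat_inv \<pi>\<close> is
  the space of finitely supported functions on words over the index set of the Cartan matrix. In this
  model \<open>e\<^sub>k\<close> strips a first letter \<open>k\<close> and \<open>f\<^sub>k\<close> inserts a letter \<open>k\<close> in all possible places, with a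
  coefficient that depends on the letters behind it. The operators \<open>e\<^sub>k\<close> alone make the module cofree:
  a function on words is zero as soon as stripping letters from it never leaves a nonzero value at
  the empty word. Nearly all claims follow from this.

  \<^item> An operator that commutes with all \<open>e\<^sub>k\<close> and only has values vanishing at the empty word is zero
    (\<open>zero_by_stripping\<close>). The Serre elements in the \<open>f\<^sub>k\<close> commute with all \<open>e\<^sub>j\<close> by a
    computation in \<open>sl\<^sub>2\<close> (\<open>serre_commutes\<close>), hence they act as zero. This gives the action of \<open>g_tilde c\<close>.
  \<^item> A primitive vector is killed by all \<open>e\<^sub>k\<close>, hence is a multiple of the empty word \<open>1\<^sub>\<lambda>\<close>
    (\<open>stripped_const\<close>). So the submodule generated by the primitive part is \<open>V(\<lambda>)\<close>, which is
    spanned by the vectors \<open>f\<dots>f 1\<^sub>\<lambda>\<close>. The Serre elements in the \<open>e\<^sub>k\<close> commute with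
    all \<open>f\<^sub>j\<close> and kill \<open>1\<^sub>\<lambda>\<close>; therefore they kill \<open>V(\<lambda>)\<close>, and \<open>g_tilde c\<close> acts on it through \<open>g_quot c\<close>.
  \<^item> If \<open>\<lambda>\<close> takes the value \<open>n\<close> on the coroot of \<open>k\<close>, then \<open>f\<^sub>k\<^sup>n\<^sup>+\<^sup>1 1\<^sub>\<lambda>\<close> is killed by all \<open>e\<^sub>j\<close> and
    vanishes at the empty word, so it is zero. As \<open>ad(f\<^sub>k)\<close> is nilpotent at each
    \<open>f\<^sub>l\<close> by the Serre relations, \<open>f\<^sub>k\<close> is locally nilpotent on \<open>V(\<lambda>)\<close>; \<open>e\<^sub>k\<close> is so because it shortens words.
  \<^item> Stripping a longest word from a nonzero vector of a submodule yields \<open>1\<^sub>\<lambda>\<close>, so \<open>V(\<lambda>)\<close> is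
    irreducible.

  Finite dimension of \<open>V(\<lambda>)\<close>, for a finite dimensional \<open>g_quot c\<close> and an integral \<open>\<lambda>\<close>, is a
  matter of Lie algebras of operators. Let \<open>G\<close> be the Lie algebra of operators generated by the \<open>f\<^sub>k\<close>. If \<open>x\<close> and \<open>y\<close> are locally
  nilpotent and \<open>ad x\<close> is nilpotent at \<open>y\<close>, then \<open>exp(t ad x) y = exp(tx) y exp(-tx)\<close> is locally
  nilpotent for every \<open>t\<close>, and the coefficients of this polynomial in \<open>t\<close>, among them \<open>[x, y]\<close>, lie in
  the span of its values. Hence \<open>G\<close> is spanned by locally nilpotent operators
  (\<open>lie_gen_spanned_by_nilpotents\<close>), and finitely many of these suffice on \<open>V(\<lambda>)\<close>. By the easy half of
  the theorem of Poincare, Birkhoff and Witt, \<open>V(\<lambda>)\<close> is spanned by ordered monomials in them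
  applied to \<open>1\<^sub>\<lambda>\<close>, of which only finitely many are nonzero (\<open>finite_dim_by_ordered_monomials\<close>).

  That \<open>B_hat_inv \<pi>\<close> is the space of finitely supported functions on words rests on the independence
  of the \<open>zeta I\<close>, by taking residues along \<open>t\<^sub>i = z\<close> (\<open>zeta_independent\<close>), and on the fibres of \<open>\<pi>\<close>
  being infinite, so that any two repetition-free sequences with the same image are related by a
  permutation preserving the fibres (\<open>swap_lists\<close>, \<open>fresh_list\<close>).
\<close>

section \<open>The ring of linear operators on functions\<close>

definition fscale :: "complex \<Rightarrow> ('x \<Rightarrow> complex) \<Rightarrow> 'x \<Rightarrow> complex" where
  "fscale a v = (\<lambda>x. a * v x)"

interpretation fv: vector_space "fscale :: complex \<Rightarrow> ('x \<Rightarrow> complex) \<Rightarrow> 'x \<Rightarrow> complex"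
  by unfold_locales (auto simp: fscale_def fun_eq_iff algebra_simps)

text \<open>Linear operators as a type of their own, so that they form a ring with composition as
  multiplication and identities between commutators are ring identities.\<close>

typedef 'x endo =
  "{T :: ('x \<Rightarrow> complex) \<Rightarrow> 'x \<Rightarrow> complex.
      (\<forall>u v. T (u + v) = T u + T v) \<and> (\<forall>a v. T (fscale a v) = fscale a (T v))}"
  morphisms app Endo
  by (rule exI[of _ "\<lambda>v. v"]) simp

setup_lifting type_definition_endo

instantiation endo :: (type) ring_1
begin

lift_definition zero_endo :: "'a endo" is "\<lambda>v. 0" by simp
lift_definition one_endo :: "'a endo" is "\<lambda>v. v" by simp
lift_definition plus_endo :: "'a endo \<Rightarrow> 'a endo \<Rightarrow> 'a endo" is "\<lambda>S T v. S v + T v"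
  by (simp add: algebra_simps fv.scale_right_distrib)
lift_definition minus_endo :: "'a endo \<Rightarrow> 'a endo \<Rightarrow> 'a endo" is "\<lambda>S T v. S v - T v"
  by (simp add: algebra_simps fv.scale_right_diff_distrib)
lift_definition uminus_endo :: "'a endo \<Rightarrow> 'a endo" is "\<lambda>T v. - T v"
  by (simp add: algebra_simps)
lift_definition times_endo :: "'a endo \<Rightarrow> 'a endo \<Rightarrow> 'a endo" is "\<lambda>S T v. S (T v)"
  by simp

instance
proof
  show "(0 :: 'a endo) \<noteq> 1"
    by transfer (auto simp: fun_eq_iff intro: exI[of _ "\<lambda>_. 1"])
qed (transfer; auto simp: algebra_simps fun_eq_iff)+

end

text \<open>The scalar operators; multiplication by \<open>sc a\<close> is the complex vector space structure on
  operators.\<close>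

lift_definition sc :: "complex \<Rightarrow> 'x endo" is "\<lambda>a v. fscale a v"
  by (simp add: fv.scale_right_distrib mult.commute)

lemma endo_eqI: "(\<And>v. app S v = app T v) \<Longrightarrow> S = T"
  by transfer (simp add: fun_eq_iff)

lemma app_add: "app T (u + v) = app T u + app T v" by transfer simp
lemma app_scale: "app T (fscale a v) = fscale a (app T v)" by transfer simp
lemma app_zero: "app T 0 = 0" using app_scale[of T 0 0] by simp
lemma app_diff: "app T (u - v) = app T u - app T v"
  using app_add[of T "u - v" v] by simp
lemma app_sum: "app T (sum f A) = (\<Sum>x\<in>A. app T (f x))"
  by (induction A rule: infinite_finite_induct)
    (simp_all only: sum.infinite sum.empty sum.insert app_zero app_add not_False_eq_True)

lemma app_zero_left: "app 0 v = 0" by transfer simp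
lemma app_one: "app 1 v = v" by transfer simp
lemma app_plus: "app (S + T) v = app S v + app T v" by transfer simp
lemma app_minus: "app (S - T) v = app S v - app T v" by transfer simp
lemma app_uminus: "app (- T) v = - app T v" by transfer simp
lemma app_mult: "app (S * T) v = app S (app T v)" by transfer simp
lemma app_sc: "app (sc a) v = fscale a v" by transfer simp
lemma app_sum_left: "app (sum f A) v = (\<Sum>x\<in>A. app (f x) v)"
  by (induction A rule: infinite_finite_induct) (auto simp: app_zero_left app_plus)
lemma app_power: "app (T ^ n) v = (app T ^^ n) v"
  by (induction n arbitrary: v) (auto simp: app_one app_mult)

lemmas app_simps = app_add app_scale app_zero app_diff app_sum app_zero_left app_one app_plus
  app_minus app_uminus app_mult app_sc app_sum_left

lemma sc_commute: "T * sc a = sc a * T"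
  by (rule endo_eqI) (simp add: app_simps)
lemma sc_add: "sc (a + b) = sc a + sc b"
  by (rule endo_eqI) (simp add: app_simps fv.scale_left_distrib)
lemma sc_mult: "sc (a * b) = sc a * sc b"
  by (rule endo_eqI) (simp add: app_simps)
lemma sc_one: "sc 1 = 1"
  by (rule endo_eqI) (simp add: app_simps)
lemma sc_zero: "sc 0 = 0"
  by (rule endo_eqI) (simp add: app_simps)
lemma sc_minus: "sc (- a) = - sc a"
  by (rule endo_eqI) (simp add: app_simps)
lemma sc_nat: "sc (of_nat n) = of_nat n"
  by (induction n) (auto simp: sc_zero sc_one sc_add)
lemma sc_int: "sc (of_int n) = of_int n"
  by (cases n) (auto simp: sc_nat sc_minus sc_add sc_one simp del: of_nat_Suc)

definition lbr :: "'a::ring \<Rightarrow> 'a \<Rightarrow> 'a" where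
  "lbr x y = x * y - y * x"

lemma lbr_add_left: "lbr (x + y) z = lbr x z + lbr y z"
  and lbr_add_right: "lbr x (y + z) = lbr x y + lbr x z"
  and lbr_zero_left: "lbr 0 y = 0"
  and lbr_zero_right: "lbr x 0 = 0"
  and lbr_minus_left: "lbr (- x) y = - lbr x y"
  and lbr_self: "lbr x x = 0"
  and lbr_swap: "lbr x y = - lbr y x"
  and lbr_jacobi: "lbr x (lbr y z) = lbr (lbr x y) z + lbr y (lbr x z)"
  by (simp_all add: lbr_def algebra_simps)

lemma lbr_sc_left: "lbr (sc a * x) y = sc a * lbr x y"
  and lbr_sc_right: "lbr x (sc a * y) = sc a * lbr x y"
proof -
  show "lbr (sc a * x) y = sc a * lbr x y"
    by (rule endo_eqI) (simp add: lbr_def app_simps fv.scale_right_diff_distrib)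
  show "lbr x (sc a * y) = sc a * lbr x y"
    by (rule endo_eqI) (simp add: lbr_def app_simps fv.scale_right_diff_distrib)
qed

lemma lbr_of_int_right: "lbr x (of_int a * y) = of_int a * lbr x (y :: 'a :: ring_1)"
  by (simp add: lbr_def right_diff_distrib mult.assoc mult_of_int_commute[symmetric])
    (simp add: mult_of_int_commute mult.assoc)

lemma lbr_pow_commute:
  assumes "lbr y x = 0"
  shows "lbr y ((lbr x ^^ n) z) = (lbr x ^^ n) (lbr y z)"
  by (induction n) (simp_all add: lbr_jacobi[of y x] assms lbr_zero_left)

lemma lbr_pow_zero: "(lbr x ^^ n) 0 = 0"
  by (induction n) (simp_all add: lbr_zero_right)

text \<open>For the \<open>sl\<^sub>2\<close> spanned by \<open>y\<close>, \<open>h\<close>, \<open>x\<close> under the adjoint action, \<open>z\<close> is an extremal vector of weight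
  \<open>m\<close>, and the formula is the usual one for its string. The factor vanishes at \<open>n = m\<close>, so that \<open>y\<close>
  commutes with \<open>(lbr x ^^ Suc m) z\<close>.\<close>

lemma sl2_raising:
  fixes x :: "'a::ring_1"
  assumes yx: "lbr y x = h" and hx: "lbr h x = - 2 * x"
    and hz: "lbr h z = of_int m * z" and yz: "lbr y z = 0"
  shows "lbr y ((lbr x ^^ Suc n) z) =
           of_int (int (Suc n) * (m - int n)) * (lbr x ^^ n) z"
proof -
  have wt: "lbr h ((lbr x ^^ n) z) = of_int (m - 2 * int n) * (lbr x ^^ n) z" for n
  proof (induction n)
    case (Suc n)
    have "lbr h ((lbr x ^^ Suc n) z) = lbr (of_int (-2) * x) ((lbr x ^^ n) z)
        + lbr x (of_int (m - 2 * int n) * (lbr x ^^ n) z)"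
      using Suc by (simp add: lbr_jacobi[of h x] hx)
    also have "lbr (of_int (-2) * x) ((lbr x ^^ n) z) = of_int (-2) * lbr x ((lbr x ^^ n) z)"
      using lbr_of_int_right[of "(lbr x ^^ n) z" "-2" x]
      by (subst (1 2) lbr_swap) simp
    also have "of_int (-2) * lbr x ((lbr x ^^ n) z) +
        lbr x (of_int (m - 2 * int n) * (lbr x ^^ n) z) =
        of_int (-2 + (m - 2 * int n)) * (lbr x ^^ Suc n) z"
      unfolding lbr_of_int_right of_int_add distrib_right by simp
    finally show ?case by (simp add: algebra_simps)
  qed (simp add: hz)
  show ?thesis
  proof (induction n)
    case 0
    show ?case by (simp add: lbr_jacobi[of y x] yx yz hz lbr_zero_right)
  next
    case (Suc n)
    have "lbr y ((lbr x ^^ Suc (Suc n)) z) =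
        lbr h ((lbr x ^^ Suc n) z) + lbr x (lbr y ((lbr x ^^ Suc n) z))"
      by (simp add: lbr_jacobi[of y x "lbr x _"] yx)
    also have "\<dots> = of_int (m - 2 * int (Suc n)) * (lbr x ^^ Suc n) z
        + of_int (int (Suc n) * (m - int n)) * (lbr x ^^ Suc n) z"
      unfolding wt Suc.IH lbr_of_int_right by simp
    also have "\<dots> = of_int (int (Suc (Suc n)) * (m - int (Suc n))) * (lbr x ^^ Suc n) z"
      unfolding distrib_right[symmetric] of_int_add[symmetric]
      by (rule arg_cong[of _ _ "\<lambda>i. of_int i * (lbr x ^^ Suc n) z"]) (simp add: algebra_simps)
    finally show ?case .
  qed
qed

text \<open>For \<open>j = k\<close> the Serre element is the singular vector in the string of \<open>X l\<close> under \<open>ad (X k)\<close>. For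
  \<open>j = l\<close> the bracket is \<open>ad (X k)\<close> to some power applied to a multiple of \<open>X k\<close>; the multiple is
  \<open>c l k\<close>, and it vanishes together with \<open>c k l\<close> when the power is too low to kill \<open>X k\<close>. The roles of
  \<open>X\<close> and \<open>Y\<close> are open, to serve for both the \<open>f\<^sub>k\<close> and the \<open>e\<^sub>k\<close>.\<close>

lemma serre_commutes:
  fixes X Y H :: "'n \<Rightarrow> 'a::ring_1"
  assumes cartan: "generalized_cartan c"
    and YX: "\<And>k l. lbr (Y k) (X l) = (if k = l then H k else 0)"
    and HX: "\<And>k l. lbr (H k) (X l) = - of_int (c k l) * X l"
    and kl: "k \<noteq> l"
  shows "lbr (Y j) ((lbr (X k) ^^ nat (1 - c k l)) (X l)) = 0"
proof -
  have c: "c k l \<le> 0" "c k l = 0 \<Longrightarrow> c l k = 0" "c k k = 2"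
    using cartan kl by (auto simp: generalized_cartan_def)
  obtain n where n: "nat (1 - c k l) = Suc n" "c k l = - int n"
    using c(1) by (intro that[of "nat (- c k l)"]) auto
  consider "j = k" | "j \<noteq> k" "j \<noteq> l" | "j = l" by blast
  then show ?thesis
  proof cases
    case 1
    have "lbr (Y k) ((lbr (X k) ^^ Suc n) (X l)) =
        of_int (int (Suc n) * (int n - int n)) * (lbr (X k) ^^ n) (X l)"
      by (rule sl2_raising[of _ _ "H k"]) (use kl n c in \<open>simp_all add: YX HX\<close>)
    then show ?thesis using 1 n by simp
  next
    case 2
    then show ?thesis by (simp add: lbr_pow_commute YX lbr_pow_zero)
  next
    case 3
    have HXl: "lbr (X k) (H l) = of_int (c l k) * X k"
      by (subst lbr_swap) (simp add: HX)
    have "lbr (Y l) ((lbr (X k) ^^ Suc n) (X l)) = (lbr (X k) ^^ n) (lbr (X k) (H l))"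
      using kl by (simp add: lbr_pow_commute YX lbr_jacobi[of "Y l"] lbr_zero_left funpow_swap1)
    also have "\<dots> = 0"
    proof (cases n)
      case 0
      then show ?thesis using c n HXl by simp
    next
      case (Suc n')
      have "lbr (X k) (lbr (X k) (H l)) = 0"
        by (simp add: HXl lbr_of_int_right lbr_self)
      then show ?thesis unfolding Suc funpow_Suc_right comp_def by (simp add: lbr_pow_zero)
    qed
    finally show ?thesis using 3 n by simp
  qed
qed

text \<open>By the Leibniz rule a power of \<open>D3\<close> at \<open>B a b\<close> is a sum of terms \<open>B ((D1 ^^ p) a) ((D2 ^^ q) b)\<close>, in
  which one of the two arguments vanishes once \<open>p + q\<close> is large. It is used for a Lie algebra element
  acting on a module (\<open>B = app\<close>) and on itself (\<open>B = lbr\<close>).\<close>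

lemma leibniz_nilpotent:
  fixes B :: "'a::zero \<Rightarrow> 'b::zero \<Rightarrow> 'c::ab_group_add"
  assumes add: "\<And>x y. D3 (x + y) = D3 x + D3 y"
    and B0: "\<And>b. B 0 b = 0" "\<And>a. B a 0 = 0"
    and leib: "\<And>a b. D3 (B a b) = B (D1 a) b + B a (D2 b)"
    and "(D1 ^^ i) a = 0" "(D2 ^^ j) b = 0"
  shows "(D3 ^^ (i + j)) (B a b) = 0"
proof -
  have D0: "D3 0 = 0" using add[of 0 0] by simp
  have pow0: "(D3 ^^ n) 0 = 0" for n by (induction n) (auto simp: D0)
  have powadd: "(D3 ^^ n) (x + y) = (D3 ^^ n) x + (D3 ^^ n) y" for n x y
    by (induction n) (auto simp: add)
  show ?thesis using assms(5,6)
  proof (induction "i + j" arbitrary: i j a b)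
    case 0
    then show ?case by (simp add: B0)
  next
    case (Suc n)
    show ?case
    proof (cases "i = 0 \<or> j = 0")
      case True
      then show ?thesis using Suc.prems by (auto simp: B0 pow0)
    next
      case False
      then obtain i' j' where ij: "i = Suc i'" "j = Suc j'" by (meson not0_implies_Suc)
      have "(D3 ^^ (i + j)) (B a b) = (D3 ^^ n) (B (D1 a) b) + (D3 ^^ n) (B a (D2 b))"
        unfolding Suc.hyps(2)[symmetric] funpow_Suc_right comp_def leib powadd ..
      also have "(D3 ^^ n) (B (D1 a) b) = 0"
        using Suc.hyps(1)[of i' j "D1 a" b] Suc.hyps(2) Suc.prems ij by (simp add: funpow_swap1)
      also have "(D3 ^^ n) (B a (D2 b)) = 0"
        using Suc.hyps(1)[of i j' a "D2 b"] Suc.hyps(2) Suc.prems ij by (simp add: funpow_swap1)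
      finally show ?thesis by simp
    qed
  qed
qed

fun lie_eval :: "('g \<Rightarrow> 'x endo) \<Rightarrow> 'g lie_term \<Rightarrow> 'x endo" where
  "lie_eval \<phi> (Gen g) = \<phi> g"
| "lie_eval \<phi> Zero = 0"
| "lie_eval \<phi> (Add s t) = lie_eval \<phi> s + lie_eval \<phi> t"
| "lie_eval \<phi> (Scale a s) = sc a * lie_eval \<phi> s"
| "lie_eval \<phi> (Br s t) = lbr (lie_eval \<phi> s) (lie_eval \<phi> t)"

lemma lie_eval_invariant:
  assumes "fv.subspace L" "\<And>g v. v \<in> L \<Longrightarrow> app (\<phi> g) v \<in> L"
  shows "v \<in> L \<Longrightarrow> app (lie_eval \<phi> t) v \<in> L"
  by (induction t arbitrary: v)
    (auto simp: app_simps lbr_def assms fv.subspace_0 fv.subspace_add fv.subspace_scale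
      fv.subspace_diff)

text \<open>A representation of the generators by operators that preserve \<open>L\<close> and satisfy the relations on
  \<open>L\<close> respects every consequence of the relations on \<open>L\<close>. With \<open>L = UNIV\<close> this treats the action of
  \<open>g_tilde c\<close>, with a submodule as \<open>L\<close> that of \<open>g_quot c\<close>.\<close>

lemma lie_eval_cong:
  assumes L: "fv.subspace L" "\<And>g v. v \<in> L \<Longrightarrow> app (\<phi> g) v \<in> L"
    and R: "\<And>s t v. R s t \<Longrightarrow> v \<in> L \<Longrightarrow> app (lie_eval \<phi> s) v = app (lie_eval \<phi> t) v"
    and st: "lie_cong R s t" and v: "v \<in> L"
  shows "app (lie_eval \<phi> s) v = app (lie_eval \<phi> t) v"
  using st v
proof (induction arbitrary: v)
  case (cong_Br s s' t t')
  then show ?case by (simp add: lbr_def app_simps lie_eval_invariant[OF L])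
next
  case (jacobi s t u)
  then show ?case by (simp add: lbr_def app_simps)
qed (simp_all add: R lbr_def app_simps fv.scale_right_distrib fv.scale_left_distrib
      fv.scale_right_diff_distrib algebra_simps)

section \<open>Functions on words as a module\<close>

definition pairing :: "('n \<Rightarrow> 'n \<Rightarrow> int) \<Rightarrow> 'n \<Rightarrow> 'n list \<Rightarrow> complex" where
  "pairing c k w = (\<Sum>s\<leftarrow>w. of_int (c k s))"

lemma pairing_simps [simp]: "pairing c k [] = 0" "pairing c k (l # w) = of_int (c k l) + pairing c k w"
  by (simp_all add: pairing_def)

text \<open>The coefficient at a word \<open>w\<close> of \<open>f\<^sub>k v\<close>, where \<open>a\<close> is the value of the weight on the coroot: for each
  occurrence of \<open>k\<close> in \<open>w\<close>, the letter is removed and the remaining word weighted by the letters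
  behind it. The recursion is arranged so that \<open>[e\<^sub>k, f\<^sub>l] = \<delta>\<^sub>k\<^sub>l h\<^sub>k\<close> holds by definition.\<close>

primrec insertions ::
  "('n \<Rightarrow> 'n \<Rightarrow> int) \<Rightarrow> 'n \<Rightarrow> complex \<Rightarrow> 'n list \<Rightarrow> ('n list \<Rightarrow> complex) \<Rightarrow> complex" where
  "insertions c k a [] v = 0"
| "insertions c k a (l # w) v =
     (if l = k then (a - pairing c k w) * v w else 0) + insertions c k a w (\<lambda>u. v (l # u))"

lemma insertions_add: "insertions c k a w (u + v) = insertions c k a w u + insertions c k a w v"
  by (induction w arbitrary: u v) (simp_all add: algebra_simps plus_fun_def)

lemma insertions_scale: "insertions c k a w (fscale b v) = b * insertions c k a w v"
  by (induction w arbitrary: v) (simp_all add: algebra_simps fscale_def)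

lift_definition strip_op :: "'n \<Rightarrow> 'n list endo" is "\<lambda>k v w. v (k # w)"
  by (auto simp: fscale_def)

lift_definition insert_op ::
    "('n \<Rightarrow> 'n \<Rightarrow> int) \<Rightarrow> ('n \<Rightarrow> complex) \<Rightarrow> 'n \<Rightarrow> 'n list endo" is
  "\<lambda>c m k v w. insertions c k (m k) w v"
  by (auto simp: fun_eq_iff insertions_add insertions_scale) (auto simp: fscale_def)

lift_definition weight_op ::
    "('n \<Rightarrow> 'n \<Rightarrow> int) \<Rightarrow> ('n \<Rightarrow> complex) \<Rightarrow> 'n \<Rightarrow> 'n list endo" is
  "\<lambda>c m k v w. (m k - pairing c k w) * v w"
  by (auto simp: fscale_def fun_eq_iff algebra_simps)

lemma app_strip: "app (strip_op k) v w = v (k # w)"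
  and app_insert: "app (insert_op c m k) v w = insertions c k (m k) w v"
  and app_weight: "app (weight_op c m k) v w = (m k - pairing c k w) * v w"
  by (transfer, simp)+

text \<open>Each \<open>u\<close> whose value enters is \<open>w\<close> with one letter \<open>l\<close> removed, so its weight differs from that of
  \<open>w\<close> by \<open>c k l\<close>. This is the relation between \<open>h\<^sub>k\<close> and \<open>f\<^sub>l\<close>; \<open>a\<close> is arbitrary for the induction.\<close>

lemma insertions_weighted:
  "insertions c l b w (\<lambda>u. (a - pairing c k u) * v u) =
     (a - pairing c k w + of_int (c k l)) * insertions c l b w v"
proof (induction w arbitrary: a v)
  case (Cons l' w)
  have "insertions c l b w (\<lambda>u. (a - pairing c k (l' # u)) * v (l' # u)) =
      (a - of_int (c k l') - pairing c k w + of_int (c k l)) * insertions c l b w (\<lambda>u. v (l' # u))"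
    using Cons[of "a - of_int (c k l')" "\<lambda>u. v (l' # u)"] by (simp add: algebra_simps)
  then show ?case by (auto simp: algebra_simps)
qed simp

definition vac :: "'n list \<Rightarrow> complex" where
  "vac w = (if w = [] then 1 else 0)"

text \<open>For a finite alphabet these are the functions of finite support; bounding the length of the words
  makes invariance under insertion and stripping evident.\<close>

definition fin_supp :: "('n list \<Rightarrow> complex) set" where
  "fin_supp = {v. \<exists>d. \<forall>w. d \<le> length w \<longrightarrow> v w = 0}"

lemma fin_suppI: "(\<And>w. d \<le> length w \<Longrightarrow> v w = 0) \<Longrightarrow> v \<in> fin_supp"
  by (auto simp: fin_supp_def)

lemma subspace_fin_supp: "fv.subspace (fin_supp :: ('n list \<Rightarrow> complex) set)"
proof (rule fv.subspaceI)
  show "0 \<in> (fin_supp :: ('n list \<Rightarrow> complex) set)" by (rule fin_suppI) simp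
next
  fix u v :: "'n list \<Rightarrow> complex"
  assume "u \<in> fin_supp" "v \<in> fin_supp"
  then obtain d d' where "\<forall>w. d \<le> length w \<longrightarrow> u w = 0" "\<forall>w. d' \<le> length w \<longrightarrow> v w = 0"
    by (auto simp: fin_supp_def)
  then show "u + v \<in> fin_supp" by (intro fin_suppI[of "max d d'"]) auto
next
  fix a and v :: "'n list \<Rightarrow> complex"
  assume "v \<in> fin_supp"
  then show "fscale a v \<in> fin_supp" by (auto simp: fin_supp_def fscale_def)
qed

lemma insertions_beyond_support:
  "(\<And>u. d \<le> length u \<Longrightarrow> v u = 0) \<Longrightarrow> d < length w \<Longrightarrow> insertions c k a w v = 0"
proof (induction w arbitrary: d v)
  case (Cons l w)
  have "insertions c k a w (\<lambda>u. v (l # u)) = 0"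
  proof (cases w)
    case (Cons l' w')
    show ?thesis
      by (rule Cons.IH[of "d - 1"]) (use Cons Cons.prems in \<open>auto\<close>)
  qed simp
  with Cons.prems show ?case by simp
qed simp

lemma insert_fin_supp: "v \<in> fin_supp \<Longrightarrow> app (insert_op c m k) v \<in> fin_supp"
proof -
  assume "v \<in> fin_supp"
  then obtain d where "\<And>w. d \<le> length w \<Longrightarrow> v w = 0" by (auto simp: fin_supp_def)
  then show ?thesis
    by (intro fin_suppI[of "Suc d"])
      (simp add: app_insert insertions_beyond_support[where d = d] Suc_le_eq)
qed

lemma strip_fin_supp: "v \<in> fin_supp \<Longrightarrow> app (strip_op k) v \<in> fin_supp"
proof -
  assume "v \<in> fin_supp"
  then obtain d where "\<And>w. d \<le> length w \<Longrightarrow> v w = 0" by (auto simp: fin_supp_def)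
  then show ?thesis by (intro fin_suppI[of d]) (simp add: app_strip)
qed

lemma app_strip_power:
  "(app (strip_op k) ^^ n) v w = v (replicate n k @ w)"
proof (induction n arbitrary: w)
  case (Suc n)
  then show ?case by (simp add: app_strip replicate_app_Cons_same)
qed simp

lemma strip_locally_nilpotent: "v \<in> fin_supp \<Longrightarrow> \<exists>n. (app (strip_op k) ^^ n) v = 0"
proof -
  assume "v \<in> fin_supp"
  then obtain d where "\<And>w. d \<le> length w \<Longrightarrow> v w = 0" by (auto simp: fin_supp_def)
  then have "(app (strip_op k) ^^ d) v = 0" by (simp add: fun_eq_iff app_strip_power)
  then show ?thesis ..
qed

text \<open>The value of \<open>T v\<close> at a word is the value at the empty word of a stripped \<open>T v\<close>, and stripping
  commutes with \<open>T\<close>.\<close>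

lemma zero_by_stripping:
  assumes comm: "\<And>k. lbr (strip_op k) T = 0" and nil: "\<And>v. app T v [] = 0"
  shows "T = 0"
proof (rule endo_eqI)
  fix v
  have "app T v w = 0" for w
  proof (induction w arbitrary: v)
    case (Cons k w)
    have "app T v (k # w) = app (strip_op k * T) v w" by (simp add: app_mult app_strip)
    also have "strip_op k * T = T * strip_op k" using comm[of k] by (simp add: lbr_def)
    finally show ?case using Cons by (simp add: app_mult)
  qed (simp add: nil)
  then show "app T v = app 0 v" by (simp add: fun_eq_iff app_zero_left)
qed

text \<open>A nonempty word has a first letter, and its coefficient is still visible after stripping that letter.
  So the primitive vectors form a line.\<close>

lemma stripped_const:
  assumes "\<And>k. app (strip_op k) v = 0"
  shows "v = fscale (v []) vac"
proof
  fix w show "v w = fscale (v []) vac w"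
  proof (cases w)
    case (Cons k u)
    then show ?thesis using fun_cong[OF assms[of k], of u] by (simp add: app_strip fscale_def vac_def)
  qed (simp add: fscale_def vac_def)
qed

primrec gens :: "('n \<Rightarrow> 'n \<Rightarrow> int) \<Rightarrow> ('n \<Rightarrow> complex) \<Rightarrow> 'n chevalley \<Rightarrow> 'n list endo" where
  "gens c m (E_gen k) = strip_op k"
| "gens c m (F_gen k) = insert_op c m k"

lemma lie_eval_ad_power: "lie_eval \<phi> ((Br s ^^ n) t) = (lbr (lie_eval \<phi> s) ^^ n) (lie_eval \<phi> t)"
  by (induction n) simp_all

text \<open>The parameter \<open>m\<close> collects the values of the weight on the coroots.\<close>

locale word_module =
  fixes c :: "'n::finite \<Rightarrow> 'n \<Rightarrow> int" and m :: "'n \<Rightarrow> complex"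
  assumes cartan: "generalized_cartan c"
begin

abbreviation "E \<equiv> strip_op :: 'n \<Rightarrow> 'n list endo"
abbreviation "F \<equiv> insert_op c m"
abbreviation "H \<equiv> weight_op c m"
abbreviation "op \<equiv> lie_eval (gens c m)"

lemma lbr_EF: "lbr (E k) (F l) = (if k = l then H k else 0)"
proof (rule endo_eqI)
  fix v
  have "app (E k) v = (\<lambda>u. v (k # u))" by (simp add: fun_eq_iff app_strip)
  then have "insertions c l (m l) w (app (E k) v) = insertions c l (m l) w (\<lambda>u. v (k # u))" for w
    by (rule arg_cong)
  then show "app (lbr (E k) (F l)) v = app (if k = l then H k else 0) v"
    by (auto simp: lbr_def app_simps fun_eq_iff app_strip app_insert app_weight)
qed

lemma lbr_HE: "lbr (H k) (E l) = of_int (c k l) * E l"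
  unfolding sc_int[symmetric]
  by (rule endo_eqI)
    (auto simp: lbr_def app_simps fun_eq_iff app_strip app_weight fscale_def algebra_simps)

lemma lbr_HF: "lbr (H k) (F l) = - of_int (c k l) * F l"
  unfolding sc_int[symmetric] sc_minus[symmetric]
proof (rule endo_eqI)
  fix v
  have H: "app (H k) v = (\<lambda>u. (m k - pairing c k u) * v u)" by (simp add: fun_eq_iff app_weight)
  show "app (lbr (H k) (F l)) v = app (sc (- of_int (c k l)) * F l) v"
    by (rule ext, simp add: lbr_def app_simps app_insert app_weight fscale_def H
        insertions_weighted) (simp add: algebra_simps)
qed

lemma lbr_HH: "lbr (H k) (H l) = 0"
  by (rule endo_eqI) (auto simp: lbr_def app_simps fun_eq_iff app_weight)

text \<open>It commutes with all stripping operators, and no \<open>f\<close> produces a component at the empty word.\<close>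

lemma F_serre:
  assumes "k \<noteq> l"
  shows "(lbr (F k) ^^ nat (1 - c k l)) (F l) = 0"
proof (rule zero_by_stripping)
  show "lbr (E j) ((lbr (F k) ^^ nat (1 - c k l)) (F l)) = 0" for j
    by (rule serre_commutes[OF cartan lbr_EF lbr_HF assms])
  show "app ((lbr (F k) ^^ n) (F l)) v [] = 0" for n v
    by (induction n arbitrary: v) (simp_all add: lbr_def app_simps app_insert)
qed

lemma E_serre_commutes:
  assumes "k \<noteq> l"
  shows "lbr (F j) ((lbr (E k) ^^ nat (1 - c k l)) (E l)) = 0"
proof (rule serre_commutes[OF cartan _ _ assms, where H = "\<lambda>k. - H k"])
  show "lbr (F k) (E l) = (if k = l then - H k else 0)" for k l
    by (subst lbr_swap) (simp add: lbr_EF)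
  show "lbr (- H k) (E l) = - of_int (c k l) * E l" for k l
    using lbr_HE[of k l] by (simp add: lbr_minus_left)
qed

lemma tilde_rel_op: "tilde_rel c s t \<Longrightarrow> op s = op t"
  by (induction rule: tilde_rel.induct)
    (simp_all add: lbr_EF lbr_HE lbr_HF lbr_HH lie_eval_ad_power F_serre sc_int sc_minus)

lemma op_cong: "lie_cong (tilde_rel c) s t \<Longrightarrow> op s = op t"
  by (rule endo_eqI, rule lie_eval_cong[where L = UNIV]) (auto simp: tilde_rel_op)

lemma fin_supp_op: "v \<in> fin_supp \<Longrightarrow> app (op t) v \<in> fin_supp"
proof (rule lie_eval_invariant[OF subspace_fin_supp])
  show "app (gens c m g) v \<in> fin_supp" if "v \<in> fin_supp" for g v
    using that by (cases g) (auto intro: insert_fin_supp strip_fin_supp)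
qed

definition fword :: "'n list \<Rightarrow> 'n list \<Rightarrow> complex" where
  "fword u = foldr (\<lambda>k. app (F k)) u vac"

lemma fword_simps [simp]: "fword [] = vac" "fword (k # u) = app (F k) (fword u)"
  by (simp_all add: fword_def)

text \<open>The highest weight module generated by the empty word.\<close>

definition L :: "('n list \<Rightarrow> complex) set" where
  "L = fv.span (range fword)"

lemma subspace_L: "fv.subspace L" by (simp add: L_def)

lemma fword_L: "fword u \<in> L" unfolding L_def by (rule fv.span_base) simp

lemma vac_L: "vac \<in> L" using fword_L[of "[]"] by simp

lemma L_minimal: "fv.subspace U \<Longrightarrow> (\<And>u. fword u \<in> U) \<Longrightarrow> L \<subseteq> U"
  unfolding L_def by (rule fv.span_minimal) auto

lemma subspace_vimage: "fv.subspace U \<Longrightarrow> fv.subspace {v. app T v \<in> U}"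
  by (auto simp: fv.subspace_def app_simps)

lemma L_invariantI: "(\<And>u. app T (fword u) \<in> L) \<Longrightarrow> v \<in> L \<Longrightarrow> app T v \<in> L"
  using L_minimal[OF subspace_vimage[OF subspace_L, of T]] by auto

lemma F_L: "v \<in> L \<Longrightarrow> app (F k) v \<in> L"
  by (rule L_invariantI) (metis fword_simps(2) fword_L)

lemma vac_fin_supp: "vac \<in> fin_supp"
  by (rule fin_suppI[of 1]) (auto simp: vac_def)

lemma L_fin_supp: "L \<subseteq> fin_supp"
proof (rule L_minimal[OF subspace_fin_supp])
  show "fword u \<in> fin_supp" for u
    by (induction u) (auto intro: insert_fin_supp vac_fin_supp)
qed

lemma L_minimal':
  assumes "fv.subspace U" "vac \<in> U" "\<And>k v. v \<in> U \<Longrightarrow> app (F k) v \<in> U"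
  shows "L \<subseteq> U"
proof (rule L_minimal[OF assms(1)])
  show "fword u \<in> U" for u by (induction u) (auto simp: assms)
qed

lemma E_vac: "app (E k) vac = 0"
  by (auto simp: fun_eq_iff app_strip vac_def)

lemma app_H_eigen: "app (H k) v = fscale a v \<Longrightarrow>
    app (H k) (app (F l) v) = fscale (a - of_int (c k l)) (app (F l) v)"
proof -
  assume a: "app (H k) v = fscale a v"
  have "app (H k) (app (F l) v) = app (lbr (H k) (F l)) v + app (F l) (app (H k) v)"
    by (simp add: lbr_def app_simps)
  then show ?thesis unfolding a lbr_HF sc_int[symmetric] sc_minus[symmetric]
    by (simp add: app_simps fv.scale_left_diff_distrib)
qed

lemma H_vac: "app (H k) vac = fscale (m k) vac"
  by (auto simp: fun_eq_iff app_weight vac_def fscale_def)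

lemma H_fword: "app (H k) (fword u) = fscale (m k - pairing c k u) (fword u)"
proof (induction u)
  case (Cons l u)
  have "m k - pairing c k (l # u) = m k - pairing c k u - of_int (c k l)" by simp
  then show ?case using app_H_eigen[OF Cons, of l] by (simp only: fword_simps)
qed (simp add: H_vac)

lemma E_fword: "app (E k) (fword u) \<in> L"
proof (induction u)
  case Nil
  show ?case unfolding fword_simps E_vac by (rule fv.subspace_0[OF subspace_L])
next
  case (Cons l u)
  have "app (E k) (app (F l) (fword u)) =
      app (lbr (E k) (F l)) (fword u) + app (F l) (app (E k) (fword u))"
    by (simp add: lbr_def app_simps)
  also have "\<dots> \<in> L"
    using F_L[OF Cons, of l] subspace_L fword_L[of u]
    by (auto simp: lbr_EF H_fword app_zero_left intro: fv.subspace_add fv.subspace_scale)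
  finally show ?case by simp
qed

lemma gens_L: "v \<in> L \<Longrightarrow> app (gens c m g) v \<in> L"
  by (cases g) (auto intro: F_L L_invariantI[OF E_fword])

lemma op_L: "v \<in> L \<Longrightarrow> app (op t) v \<in> L"
  by (rule lie_eval_invariant[OF subspace_L gens_L])

text \<open>It commutes with the \<open>f\<^sub>j\<close>, which generate \<open>L\<close> from the vacuum, and it kills the vacuum. On the
  whole space of functions this fails in general.\<close>

lemma E_serre_L:
  assumes "k \<noteq> l" "v \<in> L"
  shows "app ((lbr (E k) ^^ nat (1 - c k l)) (E l)) v = 0" (is "app ?T v = 0")
proof -
  have "L \<subseteq> {v. app ?T v = 0}"
  proof (rule L_minimal')
    show "fv.subspace {v. app ?T v = 0}" by (auto simp: fv.subspace_def app_simps)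
    have "app ((lbr (E k) ^^ n) (E l)) vac = 0" for n
    proof (induction n)
      case (Suc n)
      have "app (lbr (E k) T) vac = 0" if "app T vac = 0" for T
        using that by (simp add: lbr_def app_simps E_vac)
      from this[OF Suc] show ?case by simp
    qed (simp add: E_vac)
    then show "vac \<in> {v. app ?T v = 0}" by simp
    fix j v assume "v \<in> {v. app ?T v = 0}"
    moreover have "app ?T (app (F j) v) = app (F j) (app ?T v) - app (lbr (F j) ?T) v"
      by (simp add: lbr_def app_simps)
    ultimately show "app (F j) v \<in> {v. app ?T v = 0}"
      by (simp add: E_serre_commutes[OF assms(1)] app_zero app_zero_left)
  qed
  with assms(2) show ?thesis by auto
qed

lemma full_rel_op: "full_rel c s t \<Longrightarrow> v \<in> L \<Longrightarrow> app (op s) v = app (op t) v"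
  by (induction rule: full_rel.induct)
    (simp_all add: tilde_rel_op lie_eval_ad_power E_serre_L app_zero_left)

lemma op_full_cong: "lie_cong (full_rel c) s t \<Longrightarrow> v \<in> L \<Longrightarrow> app (op s) v = app (op t) v"
  by (rule lie_eval_cong[OF subspace_L gens_L full_rel_op])

text \<open>Stripping off a word of maximal length in the support of a vector leaves a nonzero multiple of the
  empty word.\<close>

lemma vac_in_submodule:
  assumes U: "fv.subspace U" "U \<subseteq> fin_supp" "U \<noteq> {0}"
    and E: "\<And>k v. v \<in> U \<Longrightarrow> app (E k) v \<in> U"
  shows "vac \<in> U"
proof -
  obtain v where v: "v \<in> U" "v \<noteq> 0" using U fv.subspace_0[OF U(1)] by blast
  obtain d where d: "\<And>w. d \<le> length w \<Longrightarrow> v w = 0" using v U by (auto simp: fin_supp_def)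
  obtain w0 where "v w0 \<noteq> 0" using v by (auto simp: fun_eq_iff)
  then obtain w where w: "v w \<noteq> 0" "\<And>u. v u \<noteq> 0 \<Longrightarrow> length u \<le> length w"
    using ex_has_greatest_nat[of "\<lambda>w. v w \<noteq> 0" w0 length d] d by (metis not_less nat_le_linear)
  have "(\<lambda>u. v (w' @ u)) \<in> U" for w'
  proof (induction w' rule: rev_induct)
    case (snoc k w')
    then show ?case using E[of "\<lambda>u. v (w' @ u)" k] by (simp add: app_strip[abs_def])
  qed (simp add: v)
  moreover have "v (w @ u) = fscale (v w) vac u" for u
    using w(2)[of "w @ u"] by (auto simp: fscale_def vac_def)
  then have "(\<lambda>u. v (w @ u)) = fscale (v w) vac" by (rule ext)
  ultimately have "fscale (v w) vac \<in> U" by metis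
  then have "fscale (1 / v w) (fscale (v w) vac) \<in> U" by (rule fv.subspace_scale[OF U(1)])
  then show ?thesis using w(1) by simp
qed

lemma E_F_power_vac:
  "app (E k) ((app (F k) ^^ Suc n) vac) =
     fscale (of_nat (Suc n) * (m k - of_nat n)) ((app (F k) ^^ n) vac)"
proof -
  have wt: "app (H k) ((app (F k) ^^ n) vac) = fscale (m k - 2 * of_nat n) ((app (F k) ^^ n) vac)" for n
  proof (induction n)
    case (Suc n)
    have "m k - 2 * of_nat (Suc n) = m k - 2 * of_nat n - of_int (c k k)"
      using cartan by (simp add: generalized_cartan_def)
    then show ?case using app_H_eigen[OF Suc, of k] by (simp only: funpow.simps comp_def)
  qed (simp add: H_vac)
  have step: "app (E k) (app (F k) v) = app (H k) v + app (F k) (app (E k) v)" for v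
    using lbr_EF[of k k] by (simp add: lbr_def flip: app_mult app_plus) (metis diff_add_cancel)
  show ?thesis
  proof (induction n)
    case 0
    then show ?case by (simp add: step H_vac E_vac app_zero)
  next
    case (Suc n)
    have "app (E k) ((app (F k) ^^ Suc (Suc n)) vac) =
      app (H k) ((app (F k) ^^ Suc n) vac) + app (F k) (app (E k) ((app (F k) ^^ Suc n) vac))"
      by (simp add: step)
    also have "\<dots> = fscale (m k - 2 * of_nat (Suc n)) ((app (F k) ^^ Suc n) vac)
        + fscale (of_nat (Suc n) * (m k - of_nat n)) ((app (F k) ^^ Suc n) vac)"
      unfolding wt Suc.IH app_scale by simp
    also have "\<dots> = fscale (of_nat (Suc (Suc n)) * (m k - of_nat (Suc n))) ((app (F k) ^^ Suc n) vac)"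
      unfolding fv.scale_left_distrib[symmetric] by (simp add: algebra_simps)
    finally show ?case .
  qed
qed

text \<open>The vector is killed by all \<open>e\<^sub>j\<close> and has no component at the empty word, so it is zero.\<close>

lemma F_power_vac:
  assumes "m k = of_nat n"
  shows "(app (F k) ^^ Suc n) vac = 0"
proof -
  let ?v = "(app (F k) ^^ Suc n) vac"
  have "app (E j) ?v = 0" for j
  proof (cases "j = k")
    case True
    then show ?thesis using E_F_power_vac[of k n] assms by simp
  next
    case False
    then have "app (E j) (app (F k) v) = app (F k) (app (E j) v)" for v
      using lbr_EF[of j k] by (simp add: lbr_def flip: app_mult)
    then have "app (E j) ((app (F k) ^^ i) vac) = 0" for i
      by (induction i) (simp_all add: E_vac app_zero)
    then show ?thesis .
  qed
  moreover have "?v [] = 0" by (simp add: app_insert)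
  ultimately show ?thesis using stripped_const[of ?v] by simp
qed

lemma ad_F_nilpotent: "\<exists>n. (lbr (F k) ^^ n) (F l) = 0"
  using F_serre[of k l] by (cases "k = l") (auto intro: exI[of _ 1] simp: lbr_self)

lemma funpow_app_zero: "(app T ^^ n) 0 = 0"
  by (simp only: app_power[symmetric] app_zero)

lemma F_locally_nilpotent:
  assumes int: "m k = of_nat N" and v: "v \<in> L"
  shows "\<exists>n. (app (F k) ^^ n) v = 0"
proof -
  let ?U = "{v. \<exists>n. (app (F k) ^^ n) v = 0}"
  have more: "(app (F k) ^^ n') v = 0" if "(app (F k) ^^ n) v = 0" "n \<le> n'" for n n' v
    using that funpow_add[of "n' - n" n "app (F k)"] by (simp add: funpow_app_zero)
  have "L \<subseteq> ?U"
  proof (rule L_minimal')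
    show "fv.subspace ?U"
    proof (rule fv.subspaceI)
      fix u v assume "u \<in> ?U" "v \<in> ?U"
      then obtain i j where "(app (F k) ^^ i) u = 0" "(app (F k) ^^ j) v = 0" by auto
      then have "(app (F k) ^^ max i j) u = 0" "(app (F k) ^^ max i j) v = 0"
        by (auto intro: more)
      then show "u + v \<in> ?U" by (auto simp: app_add simp flip: app_power intro!: exI[of _ "max i j"])
    qed (auto simp: app_simps simp flip: app_power)
    show "vac \<in> ?U" using F_power_vac[OF int] by blast
    fix l v assume "v \<in> ?U"
    then obtain j where j: "(app (F k) ^^ j) v = 0" by auto
    obtain i where i: "(lbr (F k) ^^ i) (F l) = 0" using ad_F_nilpotent by blast
    have "(app (F k) ^^ (i + j)) (app (F l) v) = 0"
      by (rule leibniz_nilpotent[where B = app, OF _ _ _ _ i j])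
        (simp_all add: app_simps lbr_def)
    then show "app (F l) v \<in> ?U" by blast
  qed
  with v show ?thesis by auto
qed

end

section \<open>Spanning by locally nilpotent operators and ordered monomials\<close>

interpretation en: vector_space "\<lambda>a T :: 'x endo. sc a * T"
  by unfold_locales (simp_all add: distrib_left sc_add distrib_right sc_mult mult.assoc sc_one)

lemma sc_left_commute: "T * (sc a * S) = sc a * (T * S)"
  by (simp add: sc_commute flip: mult.assoc)

definition loc_nilpotent :: "('x \<Rightarrow> complex) set \<Rightarrow> 'x endo \<Rightarrow> bool" where
  "loc_nilpotent L T \<longleftrightarrow> (\<forall>v\<in>L. \<exists>n. app (T ^ n) v = 0)"

lemma app_power_beyond: "app (T ^ n) v = 0 \<Longrightarrow> n \<le> n' \<Longrightarrow> app (T ^ n') v = 0"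
  using power_add[of T "n' - n" n] by (simp add: app_simps)

lemma loc_nilpotent_scale:
  assumes "loc_nilpotent L T"
  shows "loc_nilpotent L (sc a * T)"
proof -
  have "(sc a * T) ^ n = sc (a ^ n) * T ^ n" for n
    by (induction n) (simp_all only: power.simps sc_one mult_1 sc_mult mult.assoc sc_left_commute[of T])
  then have "app ((sc a * T) ^ n) v = 0" if "app (T ^ n) v = 0" for n v
    by (simp only: app_mult that app_zero)
  with assms show ?thesis unfolding loc_nilpotent_def by blast
qed

text \<open>With divided powers \<open>d\<^sub>n = x\<^sup>n/n!\<close> and \<open>a\<^sub>i = ad(x)\<^sup>i(y)/i!\<close> this is \<open>exp(x) y = exp(ad x)(y) exp(x)\<close>, degree by
  degree. It follows by induction from \<open>x d\<^sub>n = (n+1) d\<^sub>n\<^sub>+\<^sub>1\<close> and \<open>[x, a\<^sub>i] = (i+1) a\<^sub>i\<^sub>+\<^sub>1\<close>.\<close>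

lemma divided_power_commute:
  fixes x y :: "'x endo"
  defines "d \<equiv> \<lambda>n. sc (1 / fact n) * x ^ n"
  defines "a \<equiv> \<lambda>i. sc (1 / fact i) * (lbr x ^^ i) y"
  shows "d n * y = (\<Sum>i\<le>n. a i * d (n - i))"
proof (induction n)
  case 0
  then show ?case by (simp add: d_def a_def sc_one)
next
  case (Suc n)
  have fact: "of_nat (Suc n) * (1 / fact (Suc n)) = (1 / fact n :: complex)" for n
    by (simp del: of_nat_Suc)
  have nat_sc: "of_nat n * (sc b * T) = sc (of_nat n * b) * T" for n b and T :: "'x endo"
    by (simp add: sc_mult sc_nat mult.assoc)
  have d: "x * d n = of_nat (Suc n) * d (Suc n)" for n
    unfolding d_def nat_sc fact by (simp only: mult.assoc[symmetric] sc_commute power_Suc)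
  have a: "lbr x (a i) = of_nat (Suc i) * a (Suc i)" for i
    unfolding a_def nat_sc fact lbr_sc_right by simp
  have nat_left_commute: "S * (of_nat j * T) = of_nat j * (S * T)" for j and S T :: "'x endo"
    by (metis mult.assoc mult_of_nat_commute)
  have step: "x * (a i * d (n - i)) =
      of_nat (Suc i) * (a (Suc i) * d (n - i)) + of_nat (Suc n - i) * (a i * d (Suc n - i))"
    if "i \<le> n" for i
  proof -
    have "x * (a i * d (n - i)) = lbr x (a i) * d (n - i) + a i * (x * d (n - i))"
      by (simp add: lbr_def algebra_simps)
    then show ?thesis using that
      by (simp only: a d Suc_diff_le) (simp only: mult.assoc nat_left_commute)
  qed
  have "of_nat (Suc n) * (d (Suc n) * y) = x * (d n * y)"
    by (simp only: d mult.assoc[symmetric])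
  also have "\<dots> = (\<Sum>i\<le>n. x * (a i * d (n - i)))"
    by (simp add: Suc sum_distrib_left)
  also have "\<dots> = (\<Sum>i\<le>n. of_nat (Suc i) * (a (Suc i) * d (n - i)))
      + (\<Sum>i\<le>n. of_nat (Suc n - i) * (a i * d (Suc n - i)))"
    unfolding sum.distrib[symmetric] by (rule sum.cong) (simp_all only: step atMost_iff)
  also have "(\<Sum>i\<le>n. of_nat (Suc i) * (a (Suc i) * d (n - i))) =
      (\<Sum>i\<le>Suc n. of_nat i * (a i * d (Suc n - i)))"
    by (simp only: sum.atMost_Suc_shift) simp
  also have "(\<Sum>i\<le>n. of_nat (Suc n - i) * (a i * d (Suc n - i))) =
      (\<Sum>i\<le>Suc n. of_nat (Suc n - i) * (a i * d (Suc n - i)))"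
    by simp
  also have "(\<Sum>i\<le>Suc n. of_nat i * (a i * d (Suc n - i))) + \<dots> =
      of_nat (Suc n) * (\<Sum>i\<le>Suc n. a i * d (Suc n - i))"
    unfolding sum.distrib[symmetric] sum_distrib_left distrib_right[symmetric]
    by (rule sum.cong) (simp_all add: of_nat_diff flip: of_nat_add)
  finally have eq: "sc (1 / of_nat (Suc n)) * (of_nat (Suc n) * (d (Suc n) * y)) =
      sc (1 / of_nat (Suc n)) * (of_nat (Suc n) * (\<Sum>i\<le>Suc n. a i * d (Suc n - i)))"
    by simp
  have cancel: "sc (1 / of_nat (Suc n)) * (of_nat (Suc n) * T) = T" for T :: "'x endo"
    unfolding sc_nat[symmetric] mult.assoc[symmetric] sc_mult[symmetric]
    by (simp add: sc_one del: of_nat_Suc)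
  show ?case using eq unfolding cancel .
qed

text \<open>The operator is \<open>exp(x) y exp(-x)\<close>. The exponential of \<open>x\<close> is a finite sum on each vector of \<open>L\<close>. It
  intertwines \<open>y\<close> with the operator in question and is onto, being the identity up to a nilpotent
  part; so local nilpotence carries over from \<open>y\<close>.\<close>

lemma loc_nilpotent_exp_ad:
  assumes L: "fv.subspace L"
    and xL: "\<And>v. v \<in> L \<Longrightarrow> app x v \<in> L" and yL: "\<And>v. v \<in> L \<Longrightarrow> app y v \<in> L"
    and nil: "loc_nilpotent L x" "loc_nilpotent L y" and M: "(lbr x ^^ M) y = 0"
  shows "loc_nilpotent L (\<Sum>i<M. sc (1 / fact i) * (lbr x ^^ i) y)" (is "loc_nilpotent L ?z")
proof -
  have xnil: "\<exists>n. app (x ^ n) v = 0" if "v \<in> L" for v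
    using nil(1) that unfolding loc_nilpotent_def by (rule bspec)
  define d where "d n = sc (1 / fact n) * x ^ n" for n
  define a where "a i = sc (1 / fact i) * (lbr x ^^ i) y" for i
  \<comment> \<open>The exponential of \<open>x\<close>, truncated where the powers of \<open>x\<close> at \<open>v\<close> have become zero.\<close>
  define ex where "ex v = (\<Sum>n<(SOME n. app (x ^ n) v = 0). app (d n) v)" for v
  have ex: "ex v = (\<Sum>n<K. app (d n) v)" if "app (x ^ K) v = 0" for v K
  proof -
    define K' where "K' = (SOME n. app (x ^ n) v = 0)"
    have K': "app (x ^ K') v = 0" unfolding K'_def using that by (rule someI)
    have d0: "app (d n) v = 0" if "app (x ^ j) v = 0" "j \<le> n" for n j
      unfolding d_def app_mult app_power_beyond[OF that] app_zero ..
    have "ex v = (\<Sum>n<max K K'. app (d n) v)"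
      unfolding ex_def K'_def[symmetric]
      by (rule sum.mono_neutral_left) (use K' d0 in auto)
    also have "\<dots> = (\<Sum>n<K. app (d n) v)"
      by (rule sum.mono_neutral_right) (use that d0 in auto)
    finally show ?thesis .
  qed
  have powL: "app (x ^ n) v \<in> L" if "v \<in> L" for n v
    using that by (induction n) (auto simp: app_simps xL)
  have a0: "a i = 0" if "M \<le> i" for i
  proof -
    have "(lbr x ^^ i) y = (lbr x ^^ (i - M)) ((lbr x ^^ M) y)"
      using that funpow_add[of "i - M" M "lbr x"] by simp
    then show ?thesis by (simp add: M a_def lbr_pow_zero)
  qed
  have inter: "app ?z (ex v) = ex (app y v)" if v: "v \<in> L" for v
  proof -
    obtain J where J: "app (x ^ J) v = 0" using xnil[OF v] ..
    obtain K where K: "app (x ^ K) (app y v) = 0" using xnil[OF yL[OF v]] ..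
    define N where "N = max K (M + J)"
    have dJ: "app (d j) v = 0" if "J \<le> j" for j
      unfolding d_def app_mult app_power_beyond[OF J that] app_zero ..
    have "ex (app y v) = (\<Sum>n<N. app (d n * y) v)"
      unfolding app_mult using K by (intro ex app_power_beyond[OF K]) (simp add: N_def)
    also have "\<dots> = (\<Sum>n<N. \<Sum>i\<le>n. app (a i) (app (d (n - i)) v))"
      unfolding d_def a_def divided_power_commute app_sum_left app_mult ..
    also have "\<dots> = (\<Sum>(i, j) \<in> {(i, j). i + j < N}. app (a i) (app (d j) v))"
      by (rule sum.triangle_reindex[symmetric])
    also have "\<dots> = (\<Sum>(i, j) \<in> {..<M} \<times> {..<J}. app (a i) (app (d j) v))"
    proof (rule sum.mono_neutral_right)
      show "finite {(i, j). i + j < N}"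
        by (rule finite_subset[of _ "{..<N} \<times> {..<N}"]) auto
      show "\<forall>p\<in>{(i, j). i + j < N} - {..<M} \<times> {..<J}. (case p of (i, j) \<Rightarrow> app (a i) (app (d j) v)) = 0"
        by (auto simp: not_less a0 dJ app_zero app_zero_left simp del: zero_fun_apply)
    qed (auto simp: N_def)
    also have "\<dots> = (\<Sum>i<M. \<Sum>j<J. app (a i) (app (d j) v))"
      by (rule sum.cartesian_product[symmetric])
    also have "\<dots> = app ?z (ex v)"
      unfolding ex[OF J] app_sum_left app_sum a_def by (rule sum.swap)
    finally show ?thesis by simp
  qed
  have exdiff: "ex (u - v) = ex u - ex v" if uL: "u \<in> L" and vL: "v \<in> L" for u v
  proof -
    obtain i where i: "app (x ^ i) u = 0" using xnil[OF uL] ..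
    obtain j where j: "app (x ^ j) v = 0" using xnil[OF vL] ..
    have u: "app (x ^ max i j) u = 0" and v: "app (x ^ max i j) v = 0"
      by (rule app_power_beyond[OF i], simp, rule app_power_beyond[OF j], simp)
    have uv: "app (x ^ max i j) (u - v) = 0" unfolding app_diff u v by (rule diff_self)
    show ?thesis unfolding ex[OF u] ex[OF v] ex[OF uv] app_diff sum_subtractf ..
  qed
  have dL: "app (d n) v \<in> L" if "v \<in> L" for n v
    using that by (simp add: d_def app_simps powL fv.subspace_scale[OF L])
  have surj: "\<exists>u\<in>L. ex u = v" if "v \<in> L" "app (x ^ n) v = 0" for n v
    using that
  proof (induction n arbitrary: v)
    case 0
    then have "v = 0" by (simp only: power_0 app_one)
    moreover have "ex 0 = 0" using ex[of 0 0] by (simp only: power_0 app_one lessThan_0 sum.empty)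
    ultimately show ?case using 0 by blast
  next
    case (Suc n)
    \<comment> \<open>Surjectivity: \<open>exp(x) v\<close> and \<open>v\<close> differ by \<open>r\<close>, on which fewer powers of \<open>x\<close> act nontrivially.\<close>
    define r where "r = (\<Sum>i<n. app (d (Suc i)) v)"
    have "r \<in> L" unfolding r_def by (rule fv.subspace_sum[OF L]) (rule dL[OF Suc.prems(1)])
    moreover have "app (x ^ n) r = 0"
    proof -
      have "app (x ^ n) (app (d (Suc i)) v) = 0" for i
      proof -
        have "x ^ n * d (Suc i) = sc (1 / fact (Suc i)) * (x ^ i * x ^ Suc n)"
          unfolding d_def mult.assoc[symmetric] sc_commute 
            by (simp add: mult.assoc add.commute flip: power_add power_Suc)
        then show ?thesis unfolding app_mult[symmetric] by (simp only: app_mult Suc.prems(2) app_zero)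
      qed
      then show ?thesis unfolding r_def app_sum by (rule sum.neutral[OF ballI])
    qed
    ultimately obtain u where u: "u \<in> L" "ex u = r" using Suc.IH by blast
    have "ex v = v + r"
      unfolding ex[OF Suc.prems(2)] r_def sum.lessThan_Suc_shift by (simp add: d_def sc_one app_one)
    then have "ex (v - u) = v" unfolding exdiff[OF Suc.prems(1) u(1)] u(2) by simp
    then show ?case using fv.subspace_diff[OF L Suc.prems(1) u(1)] by blast
  qed
  show ?thesis unfolding loc_nilpotent_def
  proof
    fix v assume v: "v \<in> L"
    then obtain u where u: "u \<in> L" "ex u = v" using surj nil unfolding loc_nilpotent_def by metis
    have yp: "app (y ^ n) u \<in> L" for n by (induction n) (auto simp: app_simps yL u)
    have "app (?z ^ n) (ex u) = ex (app (y ^ n) u)" for n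
      by (induction n) (simp_all only: power_0 app_one power_Suc app_mult inter[OF yp])
    moreover obtain n where n: "app (y ^ n) u = 0" using nil u by (auto simp: loc_nilpotent_def)
    moreover have "ex 0 = 0" using ex[of 0 0] by (simp only: power_0 app_one lessThan_0 sum.empty)
    ultimately show "\<exists>n. app (?z ^ n) v = 0" using u by metis
  qed
qed

text \<open>In \<open>p(2t) - 2\<^sup>M p(t)\<close> the top coefficient of a polynomial \<open>p\<close> of degree \<open>M\<close> cancels, while the
  others are multiplied by nonzero numbers.\<close>

lemma polynomial_coeffs_in_subspace:
  fixes a :: "nat \<Rightarrow> 'x endo"
  assumes N: "en.subspace N" and "\<And>t. (\<Sum>i<M. sc (t ^ i) * a i) \<in> N" and "i < M"
  shows "a i \<in> N"
  using assms(2,3)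
proof (induction M arbitrary: a i)
  case (Suc M)
  let ?p = "\<lambda>t. \<Sum>i<Suc M. sc (t ^ i) * a i"
  have eq: "(\<Sum>i<M. sc (t ^ i) * (sc (2 ^ i - 2 ^ M) * a i)) = ?p (2 * t) - sc (2 ^ M) * ?p t" for t
  proof -
    have "?p (2 * t) - sc (2 ^ M) * ?p t =
        (\<Sum>i<Suc M. sc ((2 * t) ^ i) * a i - sc (2 ^ M) * (sc (t ^ i) * a i))"
      by (simp only: sum_subtractf sum_distrib_left)
    also have "\<dots> = (\<Sum>i<Suc M. sc (t ^ i) * (sc (2 ^ i - 2 ^ M) * a i))"
      by (rule sum.cong) (simp_all add: en.scale_left_diff_distrib power_mult_distrib algebra_simps
          flip: mult.assoc sc_mult)
    also have "\<dots> = (\<Sum>i<M. sc (t ^ i) * (sc (2 ^ i - 2 ^ M) * a i))" by (simp add: sc_zero)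
    finally show ?thesis ..
  qed
  have sum_N: "(\<Sum>i<M. sc (t ^ i) * (sc (2 ^ i - 2 ^ M) * a i)) \<in> N" for t
    unfolding eq by (intro en.subspace_diff[OF N] en.subspace_scale[OF N] Suc.prems(1))
  have *: "sc (2 ^ i - 2 ^ M) * a i \<in> N" if "i < M" for i
    by (rule Suc.IH[of "\<lambda>i. sc (2 ^ i - 2 ^ M) * a i", OF sum_N that])
  have less: "a i \<in> N" if "i < M" for i
  proof -
    have "(2 :: complex) ^ i \<noteq> 2 ^ M"
    proof
      assume "(2 :: complex) ^ i = 2 ^ M"
      then have "norm ((2 :: complex) ^ i) = norm ((2 :: complex) ^ M)" by simp
      then have "(2 :: real) ^ i = 2 ^ M" by (simp add: norm_power)
      with that show False by simp
    qed
    then have "sc (1 / (2 ^ i - 2 ^ M)) * (sc (2 ^ i - 2 ^ M) * a i) = a i"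
      by (simp add: sc_one flip: mult.assoc sc_mult)
    then show ?thesis using en.subspace_scale[OF N *[OF that]] by metis
  qed
  show ?case
  proof (cases "i < M")
    case False
    have "?p 1 - (\<Sum>i<M. a i) = a M" by (simp add: sc_one)
    moreover have "(\<Sum>i<M. a i) \<in> N" by (rule en.subspace_sum[OF N]) (simp add: less)
    ultimately have "a M \<in> N" using en.subspace_diff[OF N] Suc.prems(1) by metis
    then show ?thesis using False Suc.prems(2) less_antisym by blast
  qed (rule less)
qed simp

inductive_set lie_gen :: "('k \<Rightarrow> 'x endo) \<Rightarrow> 'x endo set" for X where
  gen: "X k \<in> lie_gen X"
| add: "S \<in> lie_gen X \<Longrightarrow> T \<in> lie_gen X \<Longrightarrow> S + T \<in> lie_gen X"
| scale: "T \<in> lie_gen X \<Longrightarrow> sc a * T \<in> lie_gen X"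
| br: "S \<in> lie_gen X \<Longrightarrow> T \<in> lie_gen X \<Longrightarrow> lbr S T \<in> lie_gen X"

lemma lie_gen_0: "0 \<in> lie_gen X"
  using lie_gen.scale[OF lie_gen.gen, of 0] by (simp add: sc_zero)

lemma lie_gen_sum: "finite A \<Longrightarrow> (\<And>i. i \<in> A \<Longrightarrow> f i \<in> lie_gen X) \<Longrightarrow> sum f A \<in> lie_gen X"
  by (induction A rule: finite_induct) (auto intro: lie_gen_0 lie_gen.add)

lemma lie_gen_invariant:
  assumes "fv.subspace L" "\<And>k v. v \<in> L \<Longrightarrow> app (X k) v \<in> L"
  shows "T \<in> lie_gen X \<Longrightarrow> v \<in> L \<Longrightarrow> app T v \<in> L"
  by (induction arbitrary: v rule: lie_gen.induct)
    (auto simp: app_simps lbr_def assms fv.subspace_add fv.subspace_scale fv.subspace_diff)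

lemma lie_gen_ad_nilpotent:
  assumes "\<And>k l. \<exists>n. (lbr (X k) ^^ n) (X l) = 0" and "T \<in> lie_gen X"
  shows "\<exists>n. (lbr (X k) ^^ n) T = 0"
  using assms(2)
proof induction
  case (gen l)
  then show ?case by (rule assms(1))
next
  case (add S T)
  then obtain i j where ij: "(lbr (X k) ^^ i) S = 0" "(lbr (X k) ^^ j) T = 0" by blast
  have "(lbr (X k) ^^ (j + i)) S = 0" "(lbr (X k) ^^ (i + j)) T = 0"
    unfolding funpow_add comp_def ij by (rule lbr_pow_zero)+
  moreover have "(lbr (X k) ^^ n) (S + T) = (lbr (X k) ^^ n) S + (lbr (X k) ^^ n) T" for n
    by (induction n) (simp_all add: lbr_add_right)
  ultimately show ?case by (metis add.commute add_0)
next
  case (scale T a)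
  then obtain i where i: "(lbr (X k) ^^ i) T = 0" by blast
  have "(lbr (X k) ^^ n) (sc a * T) = sc a * (lbr (X k) ^^ n) T" for n
    by (induction n) (simp_all add: lbr_sc_right)
  then show ?case using i by (metis mult_zero_right)
next
  case (br S T)
  then obtain i j where ij: "(lbr (X k) ^^ i) S = 0" "(lbr (X k) ^^ j) T = 0" by blast
  have "(lbr (X k) ^^ (i + j)) (lbr S T) = 0"
    by (rule leibniz_nilpotent[where B = lbr, OF _ _ _ _ ij])
      (simp_all add: lbr_add_right lbr_zero_left lbr_zero_right lbr_jacobi[of "X k"])
  then show ?case ..
qed

text \<open>The span of the locally nilpotent elements is stable under each \<open>ad (X k)\<close>: for a locally nilpotent
  \<open>T\<close> all \<open>exp(t ad (X k)) T\<close> are locally nilpotent, and \<open>[X k, T]\<close> is the linear coefficient of this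
  polynomial in \<open>t\<close>. By the Jacobi identity it is then stable under the whole Lie algebra, and it
  contains the generators.\<close>

lemma lie_gen_spanned_by_nilpotents:
  assumes L: "fv.subspace L" and XL: "\<And>k v. v \<in> L \<Longrightarrow> app (X k) v \<in> L"
    and nil: "\<And>k. loc_nilpotent L (X k)" and ad: "\<And>k l. \<exists>n. (lbr (X k) ^^ n) (X l) = 0"
  shows "lie_gen X \<subseteq> en.span {T \<in> lie_gen X. loc_nilpotent L T}" (is "_ \<subseteq> en.span ?N")
proof
  have sub: "en.subspace {T. lbr S T \<in> en.span ?N}" for S
    by (auto simp: en.subspace_def lbr_add_right lbr_sc_right lbr_zero_right
        en.span_zero en.span_add en.span_scale)
  have adX: "lbr (X k) T \<in> en.span ?N" if T: "T \<in> en.span ?N" for k T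
  proof -
    have "?N \<subseteq> {T. lbr (X k) T \<in> en.span ?N}"
    proof
      fix T assume "T \<in> ?N"
      then have T: "T \<in> lie_gen X" "loc_nilpotent L T" by auto
      obtain M where M: "(lbr (X k) ^^ M) T = 0" using lie_gen_ad_nilpotent[OF ad T(1)] by blast
      have adT: "(lbr (X k) ^^ i) T \<in> lie_gen X" for i
        by (induction i) (auto intro: T lie_gen.intros)
      let ?a = "\<lambda>i. sc (1 / fact i) * (lbr (X k) ^^ i) T"
      have *: "(\<Sum>i<M. sc (t ^ i) * ?a i) \<in> en.span ?N" for t
      proof -
        have pow: "(lbr (sc t * X k) ^^ i) T = sc (t ^ i) * (lbr (X k) ^^ i) T" for i
        proof (induction i)
          case (Suc i)
          have "(lbr (sc t * X k) ^^ Suc i) T = lbr (sc t * X k) (sc (t ^ i) * (lbr (X k) ^^ i) T)"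
            by (simp add: Suc)
          also have "\<dots> = sc t * (sc (t ^ i) * lbr (X k) ((lbr (X k) ^^ i) T))"
            by (subst lbr_sc_left) (simp only: lbr_sc_right)
          also have "\<dots> = sc (t ^ Suc i) * (lbr (X k) ^^ Suc i) T"
            by (simp only: power_Suc sc_mult mult.assoc funpow.simps comp_def)
          finally show ?case .
        qed (simp add: sc_one)
        have "loc_nilpotent L (\<Sum>i<M. sc (1 / fact i) * (lbr (sc t * X k) ^^ i) T)"
          by (rule loc_nilpotent_exp_ad[OF L])
            (simp_all add: app_mult app_sc XL fv.subspace_scale[OF L] loc_nilpotent_scale nil T
              lie_gen_invariant[where X = X, OF L XL T(1)] pow M)
        also have "(\<Sum>i<M. sc (1 / fact i) * (lbr (sc t * X k) ^^ i) T) = (\<Sum>i<M. sc (t ^ i) * ?a i)"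
          unfolding pow mult.assoc[symmetric] sc_mult[symmetric] by (simp add: mult.commute)
        finally show ?thesis
          by (intro en.span_base) (auto intro!: lie_gen_sum lie_gen.scale adT)
      qed
      show "T \<in> {T. lbr (X k) T \<in> en.span ?N}"
      proof (cases "1 < M")
        case True
        have "?a 1 \<in> en.span ?N"
          by (rule polynomial_coeffs_in_subspace[OF en.subspace_span _ True]) (rule *)
        then show ?thesis by (simp add: sc_one)
      next
        case False
        then have "lbr (X k) T = 0" using M
          by (cases M) (auto simp: less_Suc_eq_0_disj lbr_zero_right not_less)
        then show ?thesis by (simp add: en.span_zero)
      qed
    qed
    then have "en.span ?N \<subseteq> {T. lbr (X k) T \<in> en.span ?N}"
      by (rule en.span_minimal) (rule sub)
    with T show ?thesis by auto
  qed
  have adS: "lbr S T \<in> en.span ?N" if "S \<in> lie_gen X" "T \<in> en.span ?N" for S T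
    using that
  proof (induction arbitrary: T rule: lie_gen.induct)
    case (br S S')
    have "lbr (lbr S S') T = lbr S (lbr S' T) - lbr S' (lbr S T)"
      by (simp add: lbr_jacobi[of S S'])
    then show ?case using br by (simp add: en.span_diff)
  qed (auto simp: adX lbr_add_left lbr_sc_left en.span_add en.span_scale)
  fix T assume "T \<in> lie_gen X"
  then show "T \<in> en.span ?N"
    by induction (auto intro: adS en.span_add en.span_scale en.span_base lie_gen.gen nil)
qed

lemma sorted_split:
  fixes u :: "nat list"
  assumes "sorted u" "set u \<subseteq> {j..<d}"
  shows "\<exists>a u'. u = replicate a j @ u' \<and> sorted u' \<and> set u' \<subseteq> {Suc j..<d}"
  using assms
proof (induction u)
  case (Cons x u)
  show ?case
  proof (cases "x = j")
    case True
    obtain a u' where "u = replicate a j @ u'" "sorted u'" "set u' \<subseteq> {Suc j..<d}"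
      using Cons by auto
    then show ?thesis using True by (intro exI[of _ "Suc a"] exI[of _ u']) simp
  next
    case False
    then show ?thesis using Cons.prems by (intro exI[of _ 0] exI[of _ "x # u"]) force
  qed
qed auto

text \<open>Sorting a product of operators from \<open>ys\<close> changes its value at \<open>v0\<close> only by products with fewer
  factors, because brackets of the factors are, vector by vector, combinations of the factors.
  So the sorted products applied to \<open>v0\<close> span a space stable under \<open>ys\<close>. There are finitely many of them,
  as each factor is nilpotent at the finitely many vectors that it meets.\<close>

lemma finite_dim_by_ordered_monomials:
  fixes ys :: "'x endo list"
  assumes L: "fv.subspace L" and yL: "\<And>y v. y \<in> set ys \<Longrightarrow> v \<in> L \<Longrightarrow> app y v \<in> L"
    and nil: "\<And>y. y \<in> set ys \<Longrightarrow> loc_nilpotent L y"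
    and br: "\<And>y y' v. y \<in> set ys \<Longrightarrow> y' \<in> set ys \<Longrightarrow> v \<in> L \<Longrightarrow>
      app (lbr y y') v \<in> fv.span ((\<lambda>z. app z v) ` set ys)"
    and v0: "v0 \<in> L"
  shows "\<exists>B. finite B \<and> B \<subseteq> L \<and> v0 \<in> fv.span B \<and>
    (\<forall>y\<in>set ys. \<forall>v\<in>fv.span B. app y v \<in> fv.span B)"
proof -
  define d where "d = length ys"
  define P where "P u = foldr (\<lambda>i. app (ys ! i)) u v0" for u
  have P: "P [] = v0" "P (i # u) = app (ys ! i) (P u)" for i u by (simp_all add: P_def)
  define W where "W n = {u. set u \<subseteq> {..<d} \<and> length u \<le> n}" for n
  \<comment> \<open>The filtration by the number of factors.\<close>
  define U where "U n = fv.span (P ` W n)" for n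
  have U_mono: "U i \<subseteq> U j" if "i \<le> j" for i j
    unfolding U_def by (rule fv.span_mono) (use that in \<open>auto simp: W_def\<close>)
  have PU: "P u \<in> U n" if "u \<in> W n" for u n
    unfolding U_def by (rule fv.span_base) (use that in auto)
  have yU: "app (ys ! i) v \<in> U (Suc n)" if "i < d" "v \<in> U n" for i v n
  proof -
    have "fv.span (P ` W n) \<subseteq> {v. app (ys ! i) v \<in> U (Suc n)}"
    proof (rule fv.span_minimal)
      show "P ` W n \<subseteq> {v. app (ys ! i) v \<in> U (Suc n)}"
        using that(1) by (auto simp: W_def simp flip: P(2) intro!: PU)
      show "fv.subspace {v. app (ys ! i) v \<in> U (Suc n)}"
        by (auto simp: fv.subspace_def app_simps U_def fv.span_add fv.span_scale fv.span_zero
            simp del: zero_fun_apply)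
    qed
    with that(2) show ?thesis by (auto simp: U_def)
  qed
  have PL: "P u \<in> L" if "set u \<subseteq> {..<d}" for u
    using that by (induction u) (auto simp: P v0 yL d_def)
  have brU: "app (lbr (ys ! i) (ys ! j)) (P u) \<in> U (Suc n)"
    if "i < d" "j < d" "u \<in> W n" for i j u n
  proof -
    have "(\<lambda>z. app z (P u)) ` set ys \<subseteq> U (Suc n)"
    proof clarify
      fix z assume "z \<in> set ys"
      then obtain l where "l < d" "z = ys ! l" by (auto simp: in_set_conv_nth d_def)
      then show "app z (P u) \<in> U (Suc n)" using that by (auto intro: yU PU)
    qed
    then have "fv.span ((\<lambda>z. app z (P u)) ` set ys) \<subseteq> U (Suc n)"
      by (rule fv.span_minimal) (simp add: U_def)
    with br[of "ys ! i" "ys ! j" "P u"] PL[of u] that show ?thesis by (auto simp: d_def W_def)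
  qed
  have U0: "0 \<in> U n" for n by (simp only: U_def fv.span_zero)
  \<comment> \<open>Moving one factor to its place costs a bracket at each exchange of neighbours.\<close>
  have insort: "P (x # u) - P (insort x u) \<in> U n" if "x < d" "u \<in> W n" for x u n
    using that
  proof (induction u arbitrary: n)
    case Nil
    show ?case by (simp only: insort_key.simps diff_self U0)
  next
    case (Cons z u)
    then obtain n' where n: "n = Suc n'" and u: "u \<in> W n'" and z: "z < d"
      by (cases n) (auto simp: W_def)
    show ?case
    proof (cases "x \<le> z")
      case True
      then show ?thesis by (simp only: insort_key.simps if_True diff_self U0)
    next
      case False
      have "P (x # z # u) - P (z # insort x u) =
          app (lbr (ys ! x) (ys ! z)) (P u) + app (ys ! z) (P (x # u) - P (insort x u))"
        by (simp only: P lbr_def app_simps) simp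
      also have "\<dots> \<in> U n"
        using brU[OF Cons.prems(1) z u] yU[OF z Cons.IH[OF Cons.prems(1) u]]
        unfolding n U_def by (rule fv.span_add)
      finally show ?thesis by (simp only: insort_key.simps False if_False)
    qed
  qed
  have sort: "P u - P (sort u) \<in> U (length u - 1)" if "set u \<subseteq> {..<d}" for u
    using that
  proof (induction u)
    case Nil
    show ?case by (simp only: sort_key_simps diff_self U0)
  next
    case (Cons x u)
    have x: "x < d" using Cons.prems by simp
    have 1: "P (x # sort u) - P (insort x (sort u)) \<in> U (length u)"
      by (rule insort) (use Cons.prems in \<open>auto simp: W_def\<close>)
    have 2: "app (ys ! x) (P u - P (sort u)) \<in> U (length u)"
    proof (cases "u = []")
      case True
      then show ?thesis by (simp only: sort_key_simps diff_self app_zero U0)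
    next
      case False
      have "app (ys ! x) (P u - P (sort u)) \<in> U (Suc (length u - 1))"
        by (rule yU[OF x Cons.IH]) (use Cons.prems in auto)
      moreover have "Suc (length u - 1) = length u" using False by simp
      ultimately show ?thesis by (simp only:)
    qed
    have "P (x # u) - P (sort (x # u)) =
        app (ys ! x) (P u - P (sort u)) + (P (x # sort u) - P (insort x (sort u)))"
      by (simp add: P app_diff)
    also have "\<dots> \<in> U (length u)" using 2 1 unfolding U_def by (rule fv.span_add)
    also have "length u = length (x # u) - 1" by simp
    finally show ?case .
  qed
  define B where "B = P ` {u. sorted u \<and> set u \<subseteq> {0..<d}}"
  have UB: "U n \<subseteq> fv.span B" for n
  proof (induction n)
    case 0
    have "P ` W 0 \<subseteq> B" by (auto simp: W_def B_def)
    then show ?case unfolding U_def by (rule fv.span_mono)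
  next
    case (Suc n)
    have "P u \<in> fv.span B" if "u \<in> W (Suc n)" for u
    proof -
      have "P u - P (sort u) \<in> U (length u - 1)" by (rule sort) (use that in \<open>simp add: W_def\<close>)
      moreover have "U (length u - 1) \<subseteq> U n" by (rule U_mono) (use that in \<open>auto simp: W_def\<close>)
      ultimately have "P u - P (sort u) \<in> fv.span B" using Suc.IH by (meson subsetD)
      moreover have "P (sort u) \<in> fv.span B"
        unfolding B_def
        by (intro fv.span_base imageI) (use that in \<open>auto simp: W_def lessThan_atLeast0\<close>)
      ultimately have "(P u - P (sort u)) + P (sort u) \<in> fv.span B" by (rule fv.span_add)
      then show ?thesis by simp
    qed
    then show ?case unfolding U_def by (intro fv.span_minimal) auto
  qed
  have "finite (P ` {u. sorted u \<and> set u \<subseteq> {j..<d}})" if "j \<le> d" for j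
    using that
  proof (induction j rule: inc_induct)
    case base
    have "{u. sorted u \<and> set u \<subseteq> {d..<d}} = {[]}" by auto
    then show ?case by simp
  next
    case (step j)
    let ?A = "\<lambda>j. P ` {u. sorted u \<and> set u \<subseteq> {j..<d}}"
    let ?y = "ys ! j"
    have "?A j \<subseteq> (\<Union>v\<in>?A (Suc j). range (\<lambda>a. app (?y ^ a) v))"
    proof clarify
      fix u :: "nat list" assume "sorted u" "set u \<subseteq> {j..<d}"
      then obtain a u' where u: "u = replicate a j @ u'" "sorted u'" "set u' \<subseteq> {Suc j..<d}"
        using sorted_split by blast
      have "P (replicate a j @ u') = app (?y ^ a) (P u')"
        by (induction a) (simp_all add: P app_one app_mult)
      then show "P u \<in> (\<Union>v\<in>?A (Suc j). range (\<lambda>a. app (?y ^ a) v))" using u by auto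
    qed
    moreover have "finite (\<Union>v\<in>?A (Suc j). range (\<lambda>a. app (?y ^ a) v))"
    proof (rule finite_UN_I[OF step.IH])
      fix v assume "v \<in> ?A (Suc j)"
      then have v: "v \<in> L" by (auto intro!: PL)
      have "loc_nilpotent L ?y" using nil[of ?y] step.hyps by (simp add: d_def)
      then obtain n where n: "app (?y ^ n) v = 0" using v by (auto simp: loc_nilpotent_def)
      have "range (\<lambda>a. app (?y ^ a) v) \<subseteq> insert 0 ((\<lambda>a. app (?y ^ a) v) ` {..<n})"
        using app_power_beyond[OF n] by (metis (no_types, lifting) image_subsetI insert_iff
            imageI lessThan_iff not_less)
      then show "finite (range (\<lambda>a. app (?y ^ a) v))" by (rule finite_subset) simp
    qed
    ultimately show ?case by (rule finite_subset)
  qed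
  from this[of 0] have "finite B" by (simp add: B_def)
  moreover have "B \<subseteq> L" by (auto simp: B_def intro!: PL)
  moreover have "v0 \<in> fv.span B"
    by (rule fv.span_base) (auto simp: B_def P(1)[symmetric] simp del: P intro!: imageI)
  moreover have "app y v \<in> fv.span B" if y: "y \<in> set ys" and v: "v \<in> fv.span B" for y v
  proof -
    obtain i where i: "i < d" "y = ys ! i" using y by (auto simp: in_set_conv_nth d_def)
    have "fv.span B \<subseteq> {v. app y v \<in> fv.span B}"
    proof (rule fv.span_minimal)
      show "B \<subseteq> {v. app y v \<in> fv.span B}"
      proof
        fix v assume "v \<in> B"
        then obtain u where u: "v = P u" "set u \<subseteq> {..<d}" by (auto simp: B_def lessThan_atLeast0)
        then have "app y v \<in> U (Suc (length u))"
          unfolding i(2) u(1) using i by (intro yU PU) (auto simp: W_def)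
        then show "v \<in> {v. app y v \<in> fv.span B}" using UB by blast
      qed
      show "fv.subspace {v. app y v \<in> fv.span B}"
        by (auto simp: fv.subspace_def app_simps fv.span_add fv.span_scale fv.span_zero
            simp del: zero_fun_apply)
    qed
    with v show ?thesis by auto
  qed
  ultimately show ?thesis by blast
qed

context word_module
begin

text \<open>An embedding of the operators on \<open>L\<close> into a function space: it is linear in the operator, and it
  forgets exactly what happens outside \<open>L\<close>. Spans and bases of spaces of operators on \<open>L\<close> can thus be
  taken among functions.\<close>

definition matrix_coeffs :: "'n list endo \<Rightarrow> 'n list \<times> 'n list \<Rightarrow> complex" where
  "matrix_coeffs T = (\<lambda>(u, w). app T (fword u) w)"

lemma module_hom_matrix_coeffs: "module_hom (\<lambda>a T. sc a * T) fscale matrix_coeffs"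
  by (unfold_locales)
    (auto simp: matrix_coeffs_def fun_eq_iff app_simps fscale_def distrib_left sc_add distrib_right
      sc_mult mult.assoc sc_one algebra_simps)

lemma matrix_coeffs_eq:
  assumes "matrix_coeffs S = matrix_coeffs T" "v \<in> L"
  shows "app S v = app T v"
proof -
  have "L \<subseteq> {v. app (S - T) v = 0}"
  proof (rule L_minimal)
    show "fv.subspace {v. app (S - T) v = 0}" by (auto simp: fv.subspace_def app_simps)
    show "fword u \<in> {v. app (S - T) v = 0}" for u
      using assms(1) by (auto simp: app_simps matrix_coeffs_def fun_eq_iff)
  qed
  with assms(2) show ?thesis by (auto simp: app_minus)
qed

lemma lie_gen_op: "T \<in> lie_gen F \<Longrightarrow> \<exists>t. T = op t"
proof (induction rule: lie_gen.induct)
  case (gen k)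
  have "F k = op (fT k)" by simp
  then show ?case ..
next
  case (add S T)
  then show ?case by (metis lie_eval.simps(3))
next
  case (scale T a)
  then show ?case by (metis lie_eval.simps(4))
next
  case (br S T)
  then show ?case by (metis lie_eval.simps(5))
qed

text \<open>The assumption on \<open>T0\<close> says that finitely many operators span the image of the Lie algebra on \<open>L\<close>. The
  operators generated by the \<open>f\<^sub>k\<close> then have a finite spanning set of locally nilpotent ones, to which
  ordered monomials apply.\<close>

lemma L_finite_dim:
  assumes int: "\<And>k. \<exists>n. m k = of_nat n"
    and fin: "finite T0" "\<And>t. matrix_coeffs (op t) \<in> fv.span (matrix_coeffs ` T0)"
  shows "\<exists>B. finite B \<and> B \<subseteq> L \<and> L = fv.span B"
proof -
  interpret r: module_hom "\<lambda>a T. sc a * T" fscale matrix_coeffs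
    by (rule module_hom_matrix_coeffs)
  let ?N = "{T \<in> lie_gen F. loc_nilpotent L T}"
  have nilF: "loc_nilpotent L (F k)" for k
    using F_locally_nilpotent[of k] int[of k] by (auto simp: loc_nilpotent_def app_power)
  have G: "lie_gen F \<subseteq> en.span ?N"
    by (rule lie_gen_spanned_by_nilpotents[OF subspace_L F_L nilF ad_F_nilpotent])
  obtain B where B: "B \<subseteq> matrix_coeffs ` ?N" "fv.independent B" "matrix_coeffs ` ?N \<subseteq> fv.span B"
    using fv.maximal_independent_subset by blast
  have "B \<subseteq> fv.span (matrix_coeffs ` T0)" using B(1) fin(2) lie_gen_op by fastforce
  then have "finite B" using fv.independent_span_bound[OF _ B(2)] fin(1) by blast
  then obtain Y where Y: "Y \<subseteq> ?N" "finite Y" "B = matrix_coeffs ` Y"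
    using B(1) by (meson finite_subset_image)
  have span: "app T v \<in> fv.span ((\<lambda>y. app y v) ` Y)" if T: "T \<in> lie_gen F" and v: "v \<in> L" for T v
  proof -
    have "matrix_coeffs T \<in> fv.span (matrix_coeffs ` ?N)"
      unfolding r.span_image using T G by blast
    also have "\<dots> \<subseteq> fv.span B" by (rule fv.span_minimal[OF B(3)]) simp
    finally have "matrix_coeffs T \<in> matrix_coeffs ` en.span Y" unfolding Y r.span_image .
    then obtain T' where T': "T' \<in> en.span Y" "matrix_coeffs T = matrix_coeffs T'" by auto
    have "en.span Y \<subseteq> {T. app T v \<in> fv.span ((\<lambda>y. app y v) ` Y)}"
    proof (rule en.span_minimal)
      show "Y \<subseteq> {T. app T v \<in> fv.span ((\<lambda>y. app y v) ` Y)}" by (auto intro: fv.span_base)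
      show "en.subspace {T. app T v \<in> fv.span ((\<lambda>y. app y v) ` Y)}"
        by (auto simp: en.subspace_def app_simps fv.span_add fv.span_scale fv.span_zero
            simp del: zero_fun_apply)
    qed
    then show ?thesis using T'(1) matrix_coeffs_eq[OF T'(2) v] by auto
  qed
  obtain ys where ys: "set ys = Y" using finite_list[OF Y(2)] by blast
  have "\<exists>B. finite B \<and> B \<subseteq> L \<and> vac \<in> fv.span B \<and>
    (\<forall>y\<in>set ys. \<forall>v\<in>fv.span B. app y v \<in> fv.span B)"
  proof (rule finite_dim_by_ordered_monomials[OF subspace_L _ _ _ vac_L])
    show "app y v \<in> L" if "y \<in> set ys" "v \<in> L" for y v
      using that Y lie_gen_invariant[where X = F, OF subspace_L F_L] by (auto simp: ys)
    show "loc_nilpotent L y" if "y \<in> set ys" for y using that Y by (auto simp: ys)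
    show "app (lbr y y') v \<in> fv.span ((\<lambda>z. app z v) ` set ys)"
      if "y \<in> set ys" "y' \<in> set ys" "v \<in> L" for y y' v
      unfolding ys by (rule span) (use that Y in \<open>auto simp: ys intro: lie_gen.br\<close>)
  qed
  then obtain S where S: "finite S" "S \<subseteq> L" "vac \<in> fv.span S"
    "\<And>y v. y \<in> Y \<Longrightarrow> v \<in> fv.span S \<Longrightarrow> app y v \<in> fv.span S" using ys by blast
  have SL: "fv.span S \<subseteq> L" by (rule fv.span_minimal[OF S(2) subspace_L])
  have "L \<subseteq> fv.span S"
  proof (rule L_minimal'[OF fv.subspace_span S(3)])
    fix k v assume v: "v \<in> fv.span S"
    have "app (F k) v \<in> fv.span ((\<lambda>y. app y v) ` Y)"
      using SL v by (intro span lie_gen.gen) auto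
    also have "\<dots> \<subseteq> fv.span S" by (rule fv.span_minimal) (use S v in auto)
    finally show "app (F k) v \<in> fv.span S" .
  qed
  with SL S show ?thesis by blast
qed

end

section \<open>Invariant polydifferentials as functions on words\<close>

lemma zeta_denom_nonzero:
  "distinct I \<Longrightarrow> inj_on t (set I) \<Longrightarrow> (I \<noteq> [] \<Longrightarrow> t (last I) \<noteq> z) \<Longrightarrow> zeta_denom I t z \<noteq> 0"
  by (induction I t z rule: zeta_denom.induct) auto

lemma zeta_denom_snoc: "zeta_denom (I @ [i]) t z = zeta_denom I t (t i) * (t i - z)"
  by (induction I t z rule: zeta_denom.induct) auto

lemma zeta_denom_cong: "(\<And>i. i \<in> set I \<Longrightarrow> t i = t' i) \<Longrightarrow> zeta_denom I t z = zeta_denom I t' z"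
  by (induction I t z rule: zeta_denom.induct) auto

lemma zeta_denom_map: "zeta_denom (map \<sigma> I) t z = zeta_denom I (t \<circ> \<sigma>) z"
  by (induction I "t \<circ> \<sigma>" z rule: zeta_denom.induct) auto

lemma tendsto_zeta_denom:
  assumes "\<And>j. ((\<lambda>x. T x j) \<longlongrightarrow> t j) A" "(Z \<longlongrightarrow> z) A"
  shows "((\<lambda>x. zeta_denom I (T x) (Z x)) \<longlongrightarrow> zeta_denom I t z) A"
  by (induction I rule: induct_list012) (auto intro!: tendsto_intros assms)

text \<open>The sequences that contribute to the coefficient of the monomial with index set \<open>J\<close>.\<close>

definition enums :: "'i set \<Rightarrow> 'i list set" where
  "enums J = {I. distinct I \<and> set I = J}"

lemma finite_enums: "finite (enums J)"
proof (cases "finite J")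
  case True
  then show ?thesis
    unfolding enums_def by (rule finite_subset[rotated, OF finite_subset_distinct]) auto
next
  case False
  then have "enums J = {}" by (auto simp: enums_def)
  then show ?thesis by simp
qed

text \<open>Taking the residue at \<open>t\<^sub>i = z\<close>, for the last entry \<open>i\<close> of \<open>I\<close>: only the sequences ending in \<open>i\<close> have a
  pole there, and what they contribute is the same expression for the sequences without that entry.
  The residue is the limit of \<open>h\<close> times the sum at \<open>t\<^sub>i = z + h\<close>.\<close>

lemma zeta_independent:
  assumes "\<And>t z. inj_on t (set I) \<Longrightarrow> z \<notin> t ` set I \<Longrightarrow> (\<Sum>K\<in>enums (set I). a K / zeta_denom K t z) = 0"
    and "distinct I"
  shows "a I = 0"
  using assms
proof (induction I arbitrary: a rule: rev_induct)
  case Nil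
  have "enums (set []) = {[] :: 'a list}" by (auto simp: enums_def)
  then show ?case using Nil(1)[of "\<lambda>_. 0" 0] by (simp only: sum.insert_if) simp
next
  case (snoc i I)
  have i: "i \<notin> set I" using snoc.prems(2) by simp
  have "(\<Sum>K\<in>enums (set I). a (K @ [i]) / zeta_denom K t z) = 0"
    if t: "inj_on t (set I)" "z \<notin> t ` set I" for t z
  proof -
    define J where "J = set (I @ [i])"
    let ?t = "\<lambda>h. t(i := z + h)"
    let ?g = "\<lambda>K h. h * (a K / zeta_denom K (?t h) z)"
    let ?l = "\<lambda>K. if last K = i then a K / zeta_denom (butlast K) t z else 0"
    \<comment> \<open>Only a sequence that ends in \<open>i\<close> has a pole along \<open>t\<^sub>i = z\<close>; the limit is its residue.\<close>
    have lim: "(?g K \<longlongrightarrow> ?l K) (at 0)" if K: "K \<in> enums J" for K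
    proof -
      have ne: "K \<noteq> []" using K by (auto simp: enums_def J_def)
      have tends: "((\<lambda>h. ?t h j) \<longlongrightarrow> ?t 0 j) (at 0)" for j
        by (auto intro!: tendsto_eq_intros)
      show ?thesis
      proof (cases "last K = i")
        case True
        define K' where "K' = butlast K"
        have KK: "K = K' @ [i]" using True ne by (metis K'_def append_butlast_last_id)
        have iK: "i \<notin> set K'" "distinct K'" "set K' = set I"
          using K i unfolding KK by (auto simp: enums_def J_def)
        have eq: "?g K h = a K / zeta_denom K' t (z + h)" if "h \<noteq> 0" for h
        proof -
          have "zeta_denom K' (?t h) (z + h) = zeta_denom K' t (z + h)"
            by (rule zeta_denom_cong) (use iK in auto)
          then show ?thesis using that by (simp add: KK zeta_denom_snoc)
        qed
        have "zeta_denom K' t z \<noteq> 0"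
        proof (rule zeta_denom_nonzero)
          show "inj_on t (set K')" using t iK by simp
          show "t (last K') \<noteq> z" if "K' \<noteq> []" using last_in_set[OF that] t(2) iK(3) by blast
        qed (rule iK)
        then have "((\<lambda>h. a K / zeta_denom K' t (z + h)) \<longlongrightarrow> a K / zeta_denom K' t z) (at 0)"
          by (intro tendsto_intros tendsto_zeta_denom) (auto intro!: tendsto_eq_intros)
        then have "(?g K \<longlongrightarrow> a K / zeta_denom K' t z) (at 0)"
          by (rule Lim_transform_eventually)
            (use eq in \<open>auto simp: eventually_at intro!: exI[of _ 1]\<close>)
        then show ?thesis using True by (simp add: K'_def)
      next
        case False
        have l: "last K \<in> set I" using K ne False last_in_set[OF ne] by (auto simp: enums_def J_def)
        have "zeta_denom K (?t 0) z \<noteq> 0"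
          by (rule zeta_denom_nonzero)
            (use K t l i False in \<open>auto simp: enums_def J_def inj_on_def\<close>)
        then have "((\<lambda>h. h * (a K / zeta_denom K (?t h) z)) \<longlongrightarrow> 0 * (a K / zeta_denom K (?t 0) z)) (at 0)"
          by (intro tendsto_intros tendsto_zeta_denom tends)
        then show ?thesis using False by simp
      qed
    qed
    have sum_lim: "((\<lambda>h. \<Sum>K\<in>enums J. ?g K h) \<longlongrightarrow> (\<Sum>K\<in>enums J. ?l K)) (at 0)"
      by (rule tendsto_sum) (rule lim)
    \<comment> \<open>For small \<open>h \<noteq> 0\<close> the point is admissible: \<open>t\<^sub>i\<close> avoids \<open>z\<close> and the other coordinates.\<close>
    have sum_zero: "\<forall>\<^sub>F h in at 0. (\<Sum>K\<in>enums J. ?g K h) = 0"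
    proof -
      have "\<forall>\<^sub>F h in at 0. \<forall>j\<in>set I. h \<noteq> t j - z"
        by (rule eventually_ball_finite) (auto intro: eventually_neq_at_within)
      moreover have "\<forall>\<^sub>F h in at (0::complex). h \<noteq> 0" by (rule eventually_neq_at_within)
      ultimately show ?thesis
      proof eventually_elim
        case (elim h)
        have "(\<Sum>K\<in>enums J. a K / zeta_denom K (?t h) z) = 0"
          unfolding J_def
        proof (rule snoc.prems(1))
          have "inj_on (?t h) (set I)"
            using t(1) i by (subst inj_on_cong[where g = t]) auto
          moreover have "?t h i \<notin> ?t h ` set I" using elim(1) i by (auto simp: eq_diff_eq add.commute)
          ultimately show "inj_on (?t h) (set (I @ [i]))" using i by simp
          show "z \<notin> ?t h ` set (I @ [i])" using t(2) i elim(2) by auto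
        qed
        then show ?case by (simp only: sum_distrib_left[symmetric] mult_zero_right)
      qed
    qed
    have "(\<Sum>K\<in>enums J. ?l K) = 0"
      by (rule tendsto_unique[OF at_neq_bot sum_lim tendsto_eventually[OF sum_zero]])
    also have "(\<Sum>K\<in>enums J. ?l K) = (\<Sum>K\<in>(\<lambda>K. K @ [i]) ` enums (set I). ?l K)"
    proof (rule sum.mono_neutral_right[OF finite_enums])
      show "(\<lambda>K. K @ [i]) ` enums (set I) \<subseteq> enums J"
      proof
        fix K' assume "K' \<in> (\<lambda>K. K @ [i]) ` enums (set I)"
        then obtain K where "K' = K @ [i]" "distinct K" "set K = set I"
          unfolding enums_def by blast
        then show "K' \<in> enums J" using i by (simp add: enums_def J_def)
      qed
      show "\<forall>K\<in>enums J - (\<lambda>K. K @ [i]) ` enums (set I). ?l K = 0"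
      proof
        fix K assume K: "K \<in> enums J - (\<lambda>K. K @ [i]) ` enums (set I)"
        have "last K \<noteq> i"
        proof
          assume "last K = i"
          moreover have "K \<noteq> []" using K by (auto simp: enums_def J_def)
          ultimately obtain K' where KK: "K = K' @ [i]" by (metis append_butlast_last_id)
          have "distinct K" "set K = set (I @ [i])" using K unfolding enums_def J_def by blast+
          then have "distinct K'" "i \<notin> set K'" "insert i (set K') = insert i (set I)"
            unfolding KK by simp_all
          then have "K' \<in> enums (set I)"
            using insert_ident[of i "set K'" "set I"] i by (simp add: enums_def)
          then show False using K unfolding KK by blast
        qed
        then show "?l K = 0" by simp
      qed
    qed
    also have "\<dots> = (\<Sum>K\<in>enums (set I). a (K @ [i]) / zeta_denom K t z)"
      by (subst sum.reindex) (auto simp: inj_on_def)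
    finally show ?thesis .
  qed
  then show ?case using snoc.IH[of "\<lambda>K. a (K @ [i])"] snoc.prems(2) by simp
qed

lemma zeta_comb_eq: "zeta_comb a J t z = (\<Sum>I\<in>enums J. a I * zeta I J t z)"
  unfolding zeta_comb_def
  by (rule Sum_any.expand_superset[OF finite_enums]) (auto simp: zeta_def enums_def)

lemma zeta_comb_cong: "(\<And>I. distinct I \<Longrightarrow> a I = b I) \<Longrightarrow> zeta_comb a = zeta_comb b"
  by (intro ext) (simp add: zeta_comb_eq enums_def)

lemma zeta_comb_add: "zeta_comb (\<lambda>I. a I + b I) = zeta_comb a + zeta_comb b"
  by (intro ext) (simp add: zeta_comb_eq algebra_simps sum.distrib)

lemma zeta_comb_scale: "zeta_comb (\<lambda>I. x * a I) = pscale x (zeta_comb a)"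
  by (intro ext) (simp add: zeta_comb_eq pscale_def sum_distrib_left mult.assoc)

lemma zeta_comb_zero: "zeta_comb (\<lambda>I. 0) = 0"
  by (intro ext) (simp add: zeta_comb_eq)

lemma zeta_comb_inject:
  assumes "zeta_comb a = zeta_comb b" "distinct I"
  shows "a I = b I"
proof -
  have "a I - b I = 0"
  proof (rule zeta_independent[where a = "\<lambda>I. a I - b I", OF _ assms(2)])
    fix t :: "'a \<Rightarrow> complex" and z assume t: "inj_on t (set I)" "z \<notin> t ` set I"
    have "zeta_comb c (set I) t z = (\<Sum>K\<in>enums (set I). c K / zeta_denom K t z)" for c
      unfolding zeta_comb_eq by (rule sum.cong) (use t in \<open>auto simp: zeta_def enums_def\<close>)
    then show "(\<Sum>K\<in>enums (set I). (a K - b K) / zeta_denom K t z) = 0"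
      using assms(1) by (simp add: diff_divide_distrib sum_subtractf) metis
  qed
  then show ?thesis by simp
qed

lemma zeta_map:
  assumes "bij \<sigma>"
  shows "zeta (map \<sigma> I) J t z = zeta I (\<sigma> -` J) (t \<circ> \<sigma>) z"
proof -
  have J: "\<sigma> ` (\<sigma> -` J) = J" using assms by (simp add: bij_is_surj surj_image_vimage_eq)
  have "set (map \<sigma> I) = J \<longleftrightarrow> set I = \<sigma> -` J"
    using assms J by (metis bij_is_inj inj_vimage_image_eq set_map)
  moreover have "distinct (map \<sigma> I) \<longleftrightarrow> distinct I"
    using assms by (simp add: distinct_map bij_is_inj inj_on_subset[OF bij_is_inj])
  moreover have "inj_on (t \<circ> \<sigma>) (\<sigma> -` J) \<longleftrightarrow> inj_on t J"
    using assms J comp_inj_on_iff[of \<sigma> "\<sigma> -` J" t] inj_on_subset[OF bij_is_inj] by auto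
  moreover have "(t \<circ> \<sigma>) ` (\<sigma> -` J) = t ` J" using J by (metis image_comp)
  ultimately show ?thesis by (auto simp: zeta_def zeta_denom_map)
qed

lemma perm_act_zeta_comb:
  assumes "bij \<sigma>"
  shows "perm_act \<sigma> (zeta_comb a) = zeta_comb (\<lambda>I. a (map (inv \<sigma>) I))"
proof (intro ext)
  fix J t z
  have inv: "map (inv \<sigma>) (map \<sigma> I) = I" "map \<sigma> (map (inv \<sigma>) I) = I" for I
    using assms by (simp_all add: bij_is_inj bij_is_surj surj_f_inv_f map_idI)
  have "zeta_comb (\<lambda>I. a (map (inv \<sigma>) I)) J t z = (\<Sum>I. a (map (inv \<sigma>) I) * zeta I J t z)"
    by (simp add: zeta_comb_def)
  also have "\<dots> = (\<Sum>I. a I * zeta I (\<sigma> -` J) (t \<circ> \<sigma>) z)"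
  proof (rule Sum_any.reindex_cong[where l = "map \<sigma>"])
    show "bij (map \<sigma>)" by (rule o_bij[of "map (inv \<sigma>)"]) (simp_all only: fun_eq_iff comp_def inv id_apply simp_thms)
    show "(\<lambda>I. a (map (inv \<sigma>) I) * zeta I J t z) \<circ> map \<sigma> = (\<lambda>I. a I * zeta I (\<sigma> -` J) (t \<circ> \<sigma>) z)"
      by (intro ext) (simp only: comp_def inv zeta_map[OF assms, unfolded comp_def])
  qed
  finally show "perm_act \<sigma> (zeta_comb a) J t z = zeta_comb (\<lambda>I. a (map (inv \<sigma>) I)) J t z"
    by (simp add: perm_act_def zeta_comb_def)
qed

text \<open>A finite sum of homogeneous combinations is a single combination of sequences of bounded length.\<close>

lemma B_hat_eq: "B_hat = {zeta_comb a | a. \<exists>d. \<forall>I. d \<le> length I \<longrightarrow> a I = 0}" (is "_ = ?S")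
proof
  show "B_hat \<subseteq> ?S" unfolding B_hat_def
  proof (rule pd.span_minimal)
    have "\<omega> \<in> ?S" if \<omega>: "\<omega> \<in> B_hat_deg m" for m and \<omega> :: "'a polydiff"
    proof -
      obtain a where a: "\<omega> = zeta_comb a" "\<forall>I. length I \<noteq> m \<longrightarrow> a I = 0"
        using \<omega> unfolding B_hat_deg_def by blast
      then have "\<forall>I. Suc m \<le> length I \<longrightarrow> a I = 0" by auto
      with a(1) show ?thesis by blast
    qed
    then show "(\<Union>m. B_hat_deg m) \<subseteq> ?S" by blast
    show "pd.subspace ?S"
    proof (rule pd.subspaceI)
      have "0 = zeta_comb (\<lambda>I :: 'a list. 0)" by (rule zeta_comb_zero[symmetric])
      then show "0 \<in> ?S" by blast
    next
      fix x y assume "x \<in> ?S" "y \<in> ?S"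
      then obtain a b d d' where "x = zeta_comb a" "\<forall>I. d \<le> length I \<longrightarrow> a I = 0"
        "y = zeta_comb b" "\<forall>I. d' \<le> length I \<longrightarrow> b I = 0" by blast
      then have "x + y = zeta_comb (\<lambda>I. a I + b I)"
        "\<forall>I. max d d' \<le> length I \<longrightarrow> a I + b I = 0" by (simp_all add: zeta_comb_add)
      then show "x + y \<in> ?S" by blast
    next
      fix c x assume "x \<in> ?S"
      then obtain a d where "x = zeta_comb a" "\<forall>I. d \<le> length I \<longrightarrow> a I = 0" by blast
      then have "pscale c x = zeta_comb (\<lambda>I. c * a I)" "\<forall>I. d \<le> length I \<longrightarrow> c * a I = 0"
        by (simp_all add: zeta_comb_scale)
      then show "pscale c x \<in> ?S" by blast
    qed
  qed
  have "zeta_comb a \<in> B_hat" if "\<And>I. d \<le> length I \<Longrightarrow> a I = 0" for a :: "'a list \<Rightarrow> complex" and d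
    using that
  proof (induction d arbitrary: a)
    case 0
    then have "zeta_comb a = 0" using zeta_comb_zero by (metis (no_types, lifting) ext zero_le)
    then show ?case by (simp only: B_hat_def pd.span_zero)
  next
    case (Suc d)
    let ?b = "\<lambda>I. if length I = d then a I else 0" and ?c = "\<lambda>I. if length I = d then 0 else a I"
    have "zeta_comb ?b \<in> B_hat"
    proof -
      have "\<forall>I. length I \<noteq> d \<longrightarrow> ?b I = 0" by simp
      then have "zeta_comb ?b \<in> B_hat_deg d" unfolding B_hat_deg_def by blast
      then show ?thesis unfolding B_hat_def by (intro pd.span_base) blast
    qed
    moreover have "zeta_comb ?c \<in> B_hat"
    proof (rule Suc.IH)
      show "?c I = 0" if "d \<le> length I" for I using that Suc.prems[of I] by auto
    qed
    moreover have "zeta_comb a = zeta_comb ?b + zeta_comb ?c"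
      unfolding zeta_comb_add[symmetric] by (rule zeta_comb_cong) simp
    ultimately show ?case unfolding B_hat_def by (simp only: pd.span_add)
  qed
  then show "?S \<subseteq> B_hat" by blast
qed

text \<open>The combination of the \<open>zeta_sym \<pi> S\<close> with coefficients \<open>b S\<close>, in a form that also makes sense for
  infinitely many nonzero coefficients.\<close>

definition Phi :: "('i \<Rightarrow> 'n) \<Rightarrow> ('n list \<Rightarrow> complex) \<Rightarrow> 'i polydiff" where
  "Phi \<pi> b = zeta_comb (\<lambda>I. b (map \<pi> I))"

lemma Phi_add: "Phi \<pi> (a + b) = Phi \<pi> a + Phi \<pi> b"
  by (simp add: Phi_def zeta_comb_add)
lemma Phi_scale: "Phi \<pi> (fscale x a) = pscale x (Phi \<pi> a)"
  by (simp add: Phi_def fscale_def zeta_comb_scale)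
lemma Phi_zero: "Phi \<pi> 0 = 0"
  by (simp add: Phi_def zeta_comb_zero)
lemma Phi_diff: "Phi \<pi> (a - b) = Phi \<pi> a - Phi \<pi> b"
  using Phi_add[of \<pi> "a - b" b] by (simp add: eq_diff_eq)

definition delta :: "'n list \<Rightarrow> 'n list \<Rightarrow> complex" where
  "delta S w = (if w = S then 1 else 0)"

lemma zeta_sym_Phi: "zeta_sym \<pi> S = Phi \<pi> (delta S)"
  by (simp add: zeta_sym_def Phi_def delta_def)

lemma fresh_list:
  assumes "\<And>k. infinite (\<pi> -` {k})" "finite A"
  shows "\<exists>I. distinct I \<and> map \<pi> I = w \<and> set I \<inter> A = {}"
proof (induction w)
  case (Cons k w)
  then obtain I where I: "distinct I" "map \<pi> I = w" "set I \<inter> A = {}" by blast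
  have "infinite (\<pi> -` {k} - (A \<union> set I))" using assms by (intro Diff_infinite_finite) auto
  then obtain i where "i \<in> \<pi> -` {k} - (A \<union> set I)" by (metis finite.emptyI ex_in_conv)
  then show ?case using I by (intro exI[of _ "i # I"]) auto
qed auto

text \<open>A product of transpositions of corresponding entries; since these are pairwise disjoint, each
  transposition leaves the other entries alone.\<close>

lemma swap_lists:
  assumes "distinct I" "distinct I'" "set I \<inter> set I' = {}" "map \<pi> I = map \<pi> I'"
  shows "\<exists>\<sigma>. bij \<sigma> \<and> \<pi> \<circ> \<sigma> = \<pi> \<and> map \<sigma> I = I' \<and> (\<forall>x. x \<notin> set I \<union> set I' \<longrightarrow> \<sigma> x = x)"
proof -
  have "length I = length I'" using assms(4) by (metis length_map)
  then show ?thesis using assms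
  proof (induction I I' rule: list_induct2)
    case Nil
    show ?case by (intro exI[of _ id] conjI bij_id) auto
  next
    case (Cons i I j I')
    have "\<exists>\<sigma>. bij \<sigma> \<and> \<pi> \<circ> \<sigma> = \<pi> \<and> map \<sigma> I = I' \<and> (\<forall>x. x \<notin> set I \<union> set I' \<longrightarrow> \<sigma> x = x)"
      by (rule Cons.IH) (use Cons.prems in auto)
    then obtain \<sigma> where \<sigma>: "bij \<sigma>" "\<pi> \<circ> \<sigma> = \<pi>" "map \<sigma> I = I'"
      "\<And>x. x \<notin> set I \<union> set I' \<Longrightarrow> \<sigma> x = x" by blast
    define \<tau> where "\<tau> x = (if x = i then j else if x = j then i else x)" for x
    have "bij \<tau>" by (rule o_bij[of \<tau>]) (auto simp: \<tau>_def fun_eq_iff)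
    then have "bij (\<tau> \<circ> \<sigma>)" using \<sigma>(1) by (rule bij_comp[rotated])
    moreover have "\<pi> \<circ> \<tau> = \<pi>" using Cons.prems(4) by (auto simp: \<tau>_def fun_eq_iff)
    then have "\<pi> \<circ> (\<tau> \<circ> \<sigma>) = \<pi>" using \<sigma>(2) by (simp flip: comp_assoc)
    moreover have "map (\<tau> \<circ> \<sigma>) (i # I) = j # I'"
    proof -
      have "\<sigma> i = i" by (rule \<sigma>(4)) (use Cons.prems in auto)
      moreover have "map \<tau> (map \<sigma> I) = I'"
        unfolding \<sigma>(3) by (rule map_idI) (use Cons.prems in \<open>auto simp: \<tau>_def\<close>)
      ultimately show ?thesis by (simp add: \<tau>_def)
    qed
    moreover have "(\<tau> \<circ> \<sigma>) x = x" if "x \<notin> set (i # I) \<union> set (j # I')" for x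
      using that \<sigma>(4)[of x] by (simp add: \<tau>_def)
    ultimately show ?case by (intro exI[of _ "\<tau> \<circ> \<sigma>"] conjI allI impI)
  qed
qed

lemma Phi_inject:
  assumes inf: "\<And>k. infinite (\<pi> -` {k})" and eq: "Phi \<pi> a = Phi \<pi> b"
  shows "a = b"
proof
  fix w
  obtain I where "distinct I" "map \<pi> I = w" using fresh_list[OF inf, of "{}"] by auto
  then show "a w = b w" using zeta_comb_inject[OF eq[unfolded Phi_def]] by blast
qed

text \<open>By independence, invariance says that the coefficient of \<open>zeta I\<close> does not change under permutations
  preserving the fibres. Two sequences with the same image in the index set are both moved to a third
  one disjoint from them, so the coefficient depends only on the image.\<close>

lemma B_hat_inv_eq:
  assumes inf: "\<And>k. infinite (\<pi> -` {k})"
  shows "B_hat_inv \<pi> = Phi \<pi> ` fin_supp"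
proof (intro equalityI subsetI)
  fix \<omega> assume "\<omega> \<in> B_hat_inv \<pi>"
  then have \<omega>: "\<omega> \<in> B_hat" "\<And>\<sigma>. bij \<sigma> \<Longrightarrow> \<pi> \<circ> \<sigma> = \<pi> \<Longrightarrow> perm_act \<sigma> \<omega> = \<omega>"
    by (auto simp: B_hat_inv_def)
  from \<omega>(1) obtain a d where a: "\<omega> = zeta_comb a" "\<And>I. d \<le> length I \<Longrightarrow> a I = 0"
    unfolding B_hat_eq by blast
  have perm: "a (map (inv \<sigma>) I) = a I" if "bij \<sigma>" "\<pi> \<circ> \<sigma> = \<pi>" "distinct I" for \<sigma> I
    using \<omega>(2)[OF that(1,2)] that(3)
    unfolding a(1) perm_act_zeta_comb[OF that(1)] by (rule zeta_comb_inject)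
  have disj: "a I = a I'" if I: "distinct I" "distinct I'" "set I \<inter> set I' = {}" "map \<pi> I = map \<pi> I'" for I I'
  proof -
    obtain \<sigma> where \<sigma>: "bij \<sigma>" "\<pi> \<circ> \<sigma> = \<pi>" "map \<sigma> I = I'" using swap_lists[OF I] by blast
    have "map (inv \<sigma>) I' = I"
      unfolding \<sigma>(3)[symmetric] using \<sigma>(1) by (simp add: bij_is_inj map_idI)
    then show ?thesis using perm[OF \<sigma>(1,2) I(2)] by simp
  qed
  have dep: "a I = a I'" if "distinct I" "distinct I'" "map \<pi> I = map \<pi> I'" for I I'
  proof -
    obtain K where K: "distinct K" "map \<pi> K = map \<pi> I" "set K \<inter> (set I \<union> set I') = {}"
      using fresh_list[OF inf, of "set I \<union> set I'" "map \<pi> I"] by auto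
    have "a I = a K" "a I' = a K" using K that by (auto intro!: disj)
    then show ?thesis by simp
  qed
  define pick where "pick w = (SOME I. distinct I \<and> map \<pi> I = w)" for w
  have pick: "distinct (pick w)" "map \<pi> (pick w) = w" for w
    using someI_ex[of "\<lambda>I. distinct I \<and> map \<pi> I = w"] fresh_list[OF inf, of "{}" w]
    by (auto simp: pick_def)
  have "\<omega> = Phi \<pi> (\<lambda>w. a (pick w))"
    unfolding Phi_def a(1)
    by (rule zeta_comb_cong, rule dep) (simp_all add: pick)
  moreover have "(\<lambda>w. a (pick w)) \<in> fin_supp"
    by (rule fin_suppI[of d]) (metis a(2) pick(2) length_map)
  ultimately show "\<omega> \<in> Phi \<pi> ` fin_supp" by blast
next
  fix \<omega> assume "\<omega> \<in> Phi \<pi> ` fin_supp"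
  then obtain b d where b: "\<omega> = Phi \<pi> b" "\<And>w. d \<le> length w \<Longrightarrow> b w = 0"
    by (auto simp: fin_supp_def)
  have "\<forall>I. d \<le> length I \<longrightarrow> b (map \<pi> I) = 0" using b(2) by simp
  then have "\<omega> \<in> B_hat" unfolding B_hat_eq b(1) Phi_def by blast
  moreover have "perm_act \<sigma> \<omega> = \<omega>" if "bij \<sigma>" "\<pi> \<circ> \<sigma> = \<pi>" for \<sigma>
  proof -
    have "\<pi> (inv \<sigma> x) = \<pi> x" for x
      using that by (metis bij_is_surj comp_apply surj_f_inv_f)
    then have "\<pi> \<circ> inv \<sigma> = \<pi>" by auto
    then show ?thesis unfolding b(1) Phi_def perm_act_zeta_comb[OF that(1)] by (simp add: comp_def)
  qed
  ultimately show "\<omega> \<in> B_hat_inv \<pi>" by (simp add: B_hat_inv_def)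
qed

section \<open>The module of invariant polydifferentials and its primitive part\<close>

lemma splittings_Cons:
  "{(p, q). p @ q = x # S} = insert ([], x # S) ((\<lambda>(p, q). (x # p, q)) ` {(p, q). p @ q = S})"
  by (auto simp: append_eq_Cons_conv)

lemma finite_splittings: "finite {(p, q). p @ q = S}"
proof (induction S)
  case Nil
  have "{(p, q). p @ q = []} = {([] :: 'a list, [])}" by auto
  then show ?case by (metis finite.emptyI finite.insertI)
qed (simp add: splittings_Cons)

lemma insertions_zero: "insertions c k a w (\<lambda>_. 0) = 0"
  by (induction w) auto

text \<open>This matches the recursive insertion operator with the sum over decompositions by which the action
  of \<open>f\<^sub>k\<close> is prescribed.\<close>

lemma insertions_delta:
  "insertions c k a w (delta S) =
     (\<Sum>(p, q) \<in> {(p, q). p @ q = S}. (a - pairing c k q) * delta (p @ k # q) w)"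
proof (induction S arbitrary: w)
  case Nil
  have D: "{(p, q). p @ q = []} = {([] :: 'a list, [])}" by auto
  show ?case
    unfolding D by (cases w) (auto simp: delta_def insertions_zero)
next
  case (Cons x S)
  have inj: "inj_on (\<lambda>(p, q). (x # p, q)) {(p, q). p @ q = S}" by (auto simp: inj_on_def)
  have notin: "([], x # S) \<notin> (\<lambda>(p, q). (x # p, q)) ` {(p, q). p @ q = S}" by auto
  have RHS: "(\<Sum>(p, q) \<in> {(p, q). p @ q = x # S}. (a - pairing c k q) * delta (p @ k # q) w) =
      (a - pairing c k (x # S)) * delta (k # x # S) w +
      (\<Sum>(p, q) \<in> {(p, q). p @ q = S}. (a - pairing c k q) * delta (x # p @ k # q) w)"
    unfolding splittings_Cons sum.insert[OF finite_imageI[OF finite_splittings] notin]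
      sum.reindex[OF inj] by (simp add: comp_def case_prod_beta)
  show ?case
  proof (cases w)
    case Nil
    then show ?thesis unfolding RHS by (simp add: delta_def case_prod_beta)
  next
    case (Cons l u)
    have "insertions c k a u (\<lambda>u. delta (x # S) (l # u)) =
      (if l = x then insertions c k a u (delta S) else 0)"
      by (auto simp: delta_def[abs_def] insertions_zero)
    also have "\<dots> = (\<Sum>(p, q) \<in> {(p, q). p @ q = S}. (a - pairing c k q) * delta (x # p @ k # q) w)"
      unfolding Cons.IH using Cons by (auto simp: delta_def case_prod_beta intro!: sum.cong)
    finally show ?thesis unfolding RHS using Cons by (auto simp: delta_def)
  qed
qed

lemma fin_supp_span_delta: "fin_supp = fv.span (range (delta :: 'n::finite list \<Rightarrow> _))"
proof
  show "fv.span (range delta) \<subseteq> (fin_supp :: ('n list \<Rightarrow> complex) set)"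
  proof (rule fv.span_minimal[OF _ subspace_fin_supp])
    show "range delta \<subseteq> (fin_supp :: ('n list \<Rightarrow> complex) set)"
    proof clarify
      fix S :: "'n list"
      show "delta S \<in> fin_supp" by (rule fin_suppI[of "Suc (length S)"]) (auto simp: delta_def)
    qed
  qed
  show "(fin_supp :: ('n list \<Rightarrow> complex) set) \<subseteq> fv.span (range delta)"
  proof
    fix b :: "'n list \<Rightarrow> complex" assume "b \<in> fin_supp"
    then obtain d where d: "\<And>w. d \<le> length w \<Longrightarrow> b w = 0" by (auto simp: fin_supp_def)
    let ?A = "{w :: 'n list. length w \<le> d}"
    have fin: "finite ?A" using finite_lists_length_le[of "UNIV :: 'n set" d] by simp
    have sum_apply: "(\<Sum>S\<in>A. f S) w = (\<Sum>S\<in>A. f S w)"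
      if "finite A" for A and f :: "'n list \<Rightarrow> 'n list \<Rightarrow> complex" and w
      using that by (induction A rule: finite_induct) simp_all
    have "b w = (\<Sum>S\<in>?A. fscale (b S) (delta S)) w" for w
    proof -
      have "(\<Sum>S\<in>?A. fscale (b S) (delta S) w) = (\<Sum>S\<in>?A. if w = S then b S else 0)"
        by (rule sum.cong) (simp_all add: fscale_def delta_def)
      also have "\<dots> = b w" using d[of w] fin by (simp add: sum.delta')
      finally show ?thesis unfolding sum_apply[OF fin] ..
    qed
    then have "b = (\<Sum>S\<in>?A. fscale (b S) (delta S))" by (rule ext)
    moreover have "\<dots> \<in> fv.span (range delta)"
      by (intro fv.span_sum fv.span_scale fv.span_base) simp
    ultimately show "b \<in> fv.span (range delta)" by metis
  qed
qed

lemma vac_delta: "vac = delta []"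
  by (auto simp: vac_def delta_def fun_eq_iff)

lemma module_hom_Phi: "module_hom fscale pscale (Phi \<pi>)"
  by unfold_locales (simp_all add: Phi_add Phi_scale)

lemma subspace_Phi: "fv.subspace D \<Longrightarrow> pd.subspace (Phi \<pi> ` D)"
  by (rule module_hom.subspace_image[OF module_hom_Phi])

lemma subspace_Phi_vimage: "pd.subspace U \<Longrightarrow> fv.subspace D \<Longrightarrow> fv.subspace {b \<in> D. Phi \<pi> b \<in> U}"
  by (auto simp: fv.subspace_def pd.subspace_def Phi_add Phi_scale Phi_zero simp del: zero_fun_apply)

lemma lie_class_Add_Zero: "lie_class R (Add Zero Zero) = lie_class R Zero"
  by (simp add: lie_class_eq_iff lie_cong.add_zero)

lemma lie_repD:
  assumes "lie_rep (presented_lie R) scale W \<rho>" "v \<in> W"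
  shows "\<rho> (lie_class R s) v \<in> W"
    and "w \<in> W \<Longrightarrow> \<rho> (lie_class R s) (v + w) = \<rho> (lie_class R s) v + \<rho> (lie_class R s) w"
    and "\<rho> (lie_class R s) (scale a v) = scale a (\<rho> (lie_class R s) v)"
    and "\<rho> (lie_class R (Scale a s)) v = scale a (\<rho> (lie_class R s) v)"
    and "\<rho> (lie_class R (Add s t)) v = \<rho> (lie_class R s) v + \<rho> (lie_class R t) v"
    and "\<rho> (lie_class R (Br s t)) v =
      \<rho> (lie_class R s) (\<rho> (lie_class R t) v) - \<rho> (lie_class R t) (\<rho> (lie_class R s) v)"
    and "\<rho> (lie_class R Zero) v = 0"
proof -
  have rep: "\<forall>s t. \<rho> (lie_class R s) v \<in> W \<and>
        (\<forall>w\<in>W. \<rho> (lie_class R s) (v + w) = \<rho> (lie_class R s) v + \<rho> (lie_class R s) w) \<and>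
        (\<forall>a. \<rho> (lie_class R s) (scale a v) = scale a (\<rho> (lie_class R s) v)) \<and>
        (\<forall>a. \<rho> (lie_class R (Scale a s)) v = scale a (\<rho> (lie_class R s) v)) \<and>
        \<rho> (lie_class R (Add s t)) v = \<rho> (lie_class R s) v + \<rho> (lie_class R t) v \<and>
        \<rho> (lie_class R (Br s t)) v =
          \<rho> (lie_class R s) (\<rho> (lie_class R t) v) - \<rho> (lie_class R t) (\<rho> (lie_class R s) v)"
    using assms unfolding lie_rep_def by (simp add: presented_lie_simps)
  then show "\<rho> (lie_class R s) v \<in> W"
    and "w \<in> W \<Longrightarrow> \<rho> (lie_class R s) (v + w) = \<rho> (lie_class R s) v + \<rho> (lie_class R s) w"
    and "\<rho> (lie_class R s) (scale a v) = scale a (\<rho> (lie_class R s) v)"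
    and "\<rho> (lie_class R (Scale a s)) v = scale a (\<rho> (lie_class R s) v)"
    and "\<rho> (lie_class R (Add s t)) v = \<rho> (lie_class R s) v + \<rho> (lie_class R t) v"
    and "\<rho> (lie_class R (Br s t)) v =
      \<rho> (lie_class R s) (\<rho> (lie_class R t) v) - \<rho> (lie_class R t) (\<rho> (lie_class R s) v)"
    by blast+
  have "\<rho> (lie_class R (Add Zero Zero)) v = \<rho> (lie_class R Zero) v + \<rho> (lie_class R Zero) v"
    using rep by blast
  then show "\<rho> (lie_class R Zero) v = 0" by (simp add: lie_class_Add_Zero)
qed

lemma lie_subspace_hull:
  assumes "lie_subspace L (lcarrier L)" "A \<subseteq> lcarrier L"
  shows "lie_subspace L (lie_subspace L hull A)"
  using assms unfolding hull_def lie_subspace_def by blast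

lemma lie_subspace_carrier: "lie_subspace (presented_lie R) (lcarrier (presented_lie R))"
  by (auto simp: lie_subspace_def presented_lie_simps)

lemma lie_subalgebra_carrier: "lie_subalgebra (presented_lie R) (lcarrier (presented_lie R))"
  unfolding lie_subalgebra_def using lie_subspace_carrier by (auto simp: presented_lie_simps)

lemma lie_subspace_classes:
  assumes "P Zero" "\<And>s t. P s \<Longrightarrow> P t \<Longrightarrow> P (Add s t)" "\<And>s a. P s \<Longrightarrow> P (Scale a s)"
  shows "lie_subspace (presented_lie R) {X. \<exists>t. X = lie_class R t \<and> P t}" (is "lie_subspace _ ?S")
  unfolding lie_subspace_def
proof (intro conjI ballI allI)
  have in_S: "lie_class R t \<in> ?S" if "P t" for t using that by blast
  show "?S \<subseteq> lcarrier (presented_lie R)" by (auto simp: presented_lie_simps)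
  show "lzero (presented_lie R) \<in> ?S"
    unfolding presented_lie_simps by (rule in_S[OF assms(1)])
  fix x assume "x \<in> ?S"
  then obtain s where s: "x = lie_class R s" "P s" by blast
  show "lscale (presented_lie R) a x \<in> ?S" for a
    unfolding s(1) presented_lie_simps by (rule in_S[OF assms(3)[OF s(2)]])
  fix y assume "y \<in> ?S"
  then obtain t where t: "y = lie_class R t" "P t" by blast
  show "ladd (presented_lie R) x y \<in> ?S"
    unfolding s(1) t(1) presented_lie_simps by (rule in_S[OF assms(2)[OF s(2) t(2)]])
qed

lemma lie_subalgebra_classes:
  assumes "P Zero" "\<And>s t. P s \<Longrightarrow> P t \<Longrightarrow> P (Add s t)" "\<And>s a. P s \<Longrightarrow> P (Scale a s)"
    and "\<And>s t. P s \<Longrightarrow> P t \<Longrightarrow> P (Br s t)"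
  shows "lie_subalgebra (presented_lie R) {X. \<exists>t. X = lie_class R t \<and> P t}" (is "lie_subalgebra _ ?S")
  unfolding lie_subalgebra_def
proof (intro conjI ballI)
  show "lie_subspace (presented_lie R) ?S" by (rule lie_subspace_classes) (fact assms(1-3))+
  fix x y assume "x \<in> ?S" "y \<in> ?S"
  then obtain s t where st: "x = lie_class R s" "P s" "y = lie_class R t" "P t" by blast
  have "P (Br s t)" using assms(4) st by blast
  then show "lbracket (presented_lie R) x y \<in> ?S"
    unfolding st presented_lie_simps by blast
qed

locale V_tilde_module = word_module c "\<lambda>k. \<Lambda> (coroot c k)"
  for c :: "'n::finite \<Rightarrow> 'n \<Rightarrow> int" and \<Lambda> :: "'n lie_elt \<Rightarrow> complex" +
  fixes \<pi> :: "'i \<Rightarrow> 'n"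
  assumes infinite_fibres: "\<And>k. infinite (\<pi> -` {k})"
begin

abbreviation "W \<equiv> B_hat_inv \<pi>"
abbreviation "\<Phi> \<equiv> Phi \<pi>"
abbreviation "cl \<equiv> lie_class (tilde_rel c)"
abbreviation "clq \<equiv> lie_class (full_rel c)"

lemma W_eq: "W = \<Phi> ` fin_supp"
  by (rule B_hat_inv_eq[OF infinite_fibres])

lemma Phi_W: "b \<in> fin_supp \<Longrightarrow> \<Phi> b \<in> W"
  by (simp add: W_eq)

lemma \<Phi>_inject: "\<Phi> a = \<Phi> b \<longleftrightarrow> a = b"
  using Phi_inject[OF infinite_fibres] by blast

text \<open>The same transport from words to polydifferentials serves for \<open>g_tilde c\<close> on all of \<open>W\<close> and for
  \<open>g_quot c\<close> on \<open>V_lam\<close>.\<close>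

lemma lie_rep_Phi:
  assumes D: "fv.subspace D" "\<And>t b. b \<in> D \<Longrightarrow> app (op t) b \<in> D"
    and \<rho>: "\<And>t b. b \<in> D \<Longrightarrow> \<rho> (lie_class R t) (\<Phi> b) = \<Phi> (app (op t) b)"
  shows "lie_rep (presented_lie R) pscale (\<Phi> ` D) \<rho>"
  unfolding lie_rep_def
proof (intro conjI ballI allI)
  show "pd.subspace (\<Phi> ` D)" by (rule subspace_Phi[OF D(1)])
  fix x v assume "x \<in> lcarrier (presented_lie R)" "v \<in> \<Phi> ` D"
  then obtain s b where x: "x = lie_class R s" and v: "v = \<Phi> b" and b: "b \<in> D"
    by (auto simp: presented_lie_simps)
  have op: "app (op t) b \<in> D" for t using D(2) b .
  show "\<rho> x v \<in> \<Phi> ` D" using op by (auto simp: x v \<rho> b)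
  show "\<rho> x (pscale a v) = pscale a (\<rho> x v)" for a
    using \<rho>[OF fv.subspace_scale[OF D(1) b], of s a] \<rho>[OF b, of s]
    by (simp add: x v Phi_scale app_scale)
  show "\<rho> (lscale (presented_lie R) a x) v = pscale a (\<rho> x v)" for a
    by (simp add: x v presented_lie_simps \<rho> b app_mult app_sc Phi_scale)
  show "\<rho> x (v + w) = \<rho> x v + \<rho> x w" if "w \<in> \<Phi> ` D" for w
  proof -
    obtain b' where w: "w = \<Phi> b'" and b': "b' \<in> D" using \<open>w \<in> \<Phi> ` D\<close> by auto
    show ?thesis
      using \<rho>[OF fv.subspace_add[OF D(1) b b'], of s] \<rho>[OF b, of s] \<rho>[OF b', of s]
      by (simp add: x v w Phi_add app_add)
  qed
  fix y assume "y \<in> lcarrier (presented_lie R)"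
  then obtain t where y: "y = lie_class R t" by (auto simp: presented_lie_simps)
  show "\<rho> (ladd (presented_lie R) x y) v = \<rho> x v + \<rho> y v"
    by (simp add: x y v presented_lie_simps \<rho> b app_plus Phi_add)
  show "\<rho> (lbracket (presented_lie R) x y) v = \<rho> x (\<rho> y v) - \<rho> y (\<rho> x v)"
    by (simp add: x y v presented_lie_simps \<rho> b op lbr_def app_minus app_mult Phi_diff)
qed

text \<open>The action on polydifferentials transported from words; the choices of representatives are harmless
  by \<open>op_cong\<close> and injectivity of \<open>\<Phi>\<close>.\<close>

definition act :: "'n lie_elt \<Rightarrow> 'i polydiff \<Rightarrow> 'i polydiff" where
  "act x v = (if x \<in> lcarrier (g_tilde c) \<and> v \<in> W
    then \<Phi> (app (op (SOME t. cl t = x)) (inv_into fin_supp \<Phi> v)) else 0)"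

lemma act_class:
  assumes b: "b \<in> fin_supp"
  shows "act (cl t) (\<Phi> b) = \<Phi> (app (op t) b)"
proof -
  have "inv_into fin_supp \<Phi> (\<Phi> b) = b"
    by (rule inv_into_f_f[OF _ b]) (simp add: inj_on_def \<Phi>_inject)
  moreover have "cl (SOME s. cl s = cl t) = cl t" by (rule someI[of "\<lambda>s. cl s = cl t" t]) simp
  then have "op (SOME s. cl s = cl t) = op t" by (intro op_cong) (simp add: lie_class_eq_iff)
  ultimately show ?thesis using Phi_W[OF b] by (simp add: act_def g_tilde_def presented_lie_simps)
qed

lemma F_delta: "app (F k) (delta S) =
  (\<Sum>(p, q) \<in> {(p, q). p @ q = S}. fscale (\<Lambda> (coroot c k) - pairing c k q) (delta (p @ k # q)))"
proof
  fix w
  have sum_apply: "(\<Sum>S\<in>A. f S) w = (\<Sum>S\<in>A. f S w)"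
    if "finite A" for A and f :: "'n list \<times> 'n list \<Rightarrow> 'n list \<Rightarrow> complex"
    using that by (induction A rule: finite_induct) simp_all
  show "app (F k) (delta S) w = (\<Sum>(p, q) \<in> {(p, q). p @ q = S}.
      fscale (\<Lambda> (coroot c k) - pairing c k q) (delta (p @ k # q))) w"
    unfolding sum_apply[OF finite_splittings] app_insert insertions_delta
    by (rule sum.cong) (auto simp: fscale_def)
qed

lemma E_delta: "app (E k) (delta []) = 0" "app (E k) (delta (l # S)) = (if l = k then delta S else 0)"
  by (auto simp: fun_eq_iff app_strip delta_def)

lemma delta_fin_supp: "delta (S :: 'n list) \<in> fin_supp"
  unfolding fin_supp_span_delta by (rule fv.span_base) simp

lemma Phi_sum: "\<Phi> (sum f A) = (\<Sum>x\<in>A. \<Phi> (f x))"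
  by (rule module_hom.sum[OF module_hom_Phi])

lemma is_V_tilde_action_act: "is_V_tilde_action c \<pi> \<Lambda> act"
  unfolding is_V_tilde_action_def
proof (intro conjI allI impI)
  show "lie_rep (g_tilde c) pscale W act"
    unfolding W_eq g_tilde_def by (rule lie_rep_Phi[OF subspace_fin_supp fin_supp_op act_class])
  show "act (f_tilde c k) (zeta_sym \<pi> S) = (\<Sum>(S'', S') \<in> {(S'', S'). S'' @ S' = S}.
      pscale (\<Lambda> (coroot c k) - (\<Sum>s\<leftarrow>S'. of_int (c k s))) (zeta_sym \<pi> (S'' @ k # S')))" for k S
    unfolding f_tilde_def zeta_sym_Phi act_class[OF delta_fin_supp] lie_eval.simps gens.simps F_delta Phi_sum
    by (rule sum.cong) (auto simp: Phi_scale pairing_def)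
  show "act (e_tilde c k) (zeta_sym \<pi> []) = 0" for k
    unfolding e_tilde_def zeta_sym_Phi act_class[OF delta_fin_supp] lie_eval.simps gens.simps E_delta
    by (rule Phi_zero)
  show "act (e_tilde c k) (zeta_sym \<pi> (l # S)) = (if l = k then zeta_sym \<pi> S else 0)" for k l S
    unfolding e_tilde_def zeta_sym_Phi act_class[OF delta_fin_supp] lie_eval.simps gens.simps E_delta
    by (simp only: Phi_zero if_distrib[of \<Phi>])
  show "act x v = 0" if "x \<notin> lcarrier (g_tilde c) \<or> v \<notin> W" for x v
    using that by (auto simp: act_def)
qed

text \<open>Any action with the prescribed values is the model action: on generators by linear extension from
  the basis, on other terms by the laws of a representation.\<close>

lemma action_class:
  assumes "is_V_tilde_action c \<pi> \<Lambda> \<rho>" and "b \<in> fin_supp"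
  shows "\<rho> (cl t) (\<Phi> b) = \<Phi> (app (op t) b)"
  using assms(2)
proof (induction t arbitrary: b)
  have rep: "lie_rep (presented_lie (tilde_rel c)) pscale W \<rho>"
    using assms(1) by (simp add: is_V_tilde_action_def g_tilde_def)
  note \<rho> = lie_repD[OF rep Phi_W]
  {
    case (Gen g)
    let ?U = "{b \<in> fin_supp. \<rho> (cl (Gen g)) (\<Phi> b) = \<Phi> (app (op (Gen g)) b)}"
    have "fv.span (range delta) \<subseteq> ?U"
    proof (rule fv.span_minimal)
      show "range delta \<subseteq> ?U"
      proof clarify
        fix S
        have "\<rho> (cl (Gen g)) (\<Phi> (delta S)) = act (cl (Gen g)) (\<Phi> (delta S))"
        proof (cases g)
          case (E_gen k)
          then show ?thesis using assms(1) is_V_tilde_action_act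
            by (cases S) (simp_all add: is_V_tilde_action_def zeta_sym_Phi flip: e_tilde_def)
        next
          case (F_gen k)
          then show ?thesis using assms(1) is_V_tilde_action_act
            by (simp add: is_V_tilde_action_def zeta_sym_Phi flip: f_tilde_def)
        qed
        then show "delta S \<in> fin_supp \<and> \<rho> (cl (Gen g)) (\<Phi> (delta S)) = \<Phi> (app (op (Gen g)) (delta S))"
          unfolding act_class[OF delta_fin_supp] using delta_fin_supp by blast
      qed
      show "fv.subspace ?U"
      proof (rule fv.subspaceI)
        show "0 \<in> ?U"
          using \<rho>(3)[OF fv.subspace_0[OF subspace_fin_supp], of "Gen g" 0] fv.subspace_0[OF subspace_fin_supp]
          by (simp add: Phi_zero app_zero)
      next
        fix x y assume "x \<in> ?U" "y \<in> ?U"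
        then show "x + y \<in> ?U" using \<rho>(2)[OF _ Phi_W]
          by (simp add: Phi_add app_add fv.subspace_add[OF subspace_fin_supp])
      next
        fix a x assume "x \<in> ?U"
        then show "fscale a x \<in> ?U" using \<rho>(3)
          by (simp add: Phi_scale app_scale fv.subspace_scale[OF subspace_fin_supp])
      qed
    qed
    with Gen show ?case unfolding fin_supp_span_delta[symmetric] by blast
  next
    case Zero
    then show ?case using \<rho>(7) by (simp only: lie_eval.simps app_zero_left Phi_zero)
  next
    case (Add s t)
    show ?case
      unfolding \<rho>(5)[OF Add.prems] Add.IH[OF Add.prems] lie_eval.simps app_plus Phi_add ..
  next
    case (Scale a s)
    show ?case
      unfolding \<rho>(4)[OF Scale.prems] Scale.IH[OF Scale.prems] lie_eval.simps app_mult app_sc Phi_scale ..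
  next
    case (Br s t)
    note IH = Br.IH[OF Br.prems] Br.IH[OF fin_supp_op[OF Br.prems]]
    show ?case
      unfolding \<rho>(6)[OF Br.prems] IH lie_eval.simps lbr_def app_minus app_mult Phi_diff ..
  }
qed

lemma V_tilde_act_eq: "V_tilde_act c \<pi> \<Lambda> = act"
proof -
  have uniq: "\<rho> = act" if \<rho>: "is_V_tilde_action c \<pi> \<Lambda> \<rho>" for \<rho>
  proof (rule ext, rule ext)
    fix x v show "\<rho> x v = act x v"
    proof (cases "x \<in> lcarrier (g_tilde c) \<and> v \<in> W")
      case True
      then obtain t b where "x = cl t" "v = \<Phi> b" "b \<in> fin_supp"
        by (auto simp: g_tilde_def presented_lie_simps W_eq)
      then show ?thesis using action_class[OF \<rho>] act_class by simp
    next
      case False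
      then show ?thesis using \<rho> by (auto simp: is_V_tilde_action_def act_def)
    qed
  qed
  show ?thesis
    unfolding V_tilde_act_def using is_V_tilde_action_act uniq by (rule the_equality)
qed

lemma V_act: "b \<in> fin_supp \<Longrightarrow> V_tilde_act c \<pi> \<Lambda> (cl t) (\<Phi> b) = \<Phi> (app (op t) b)"
  unfolding V_tilde_act_eq by (rule act_class)

lemma one_lam_Phi: "one_lam \<pi> = \<Phi> vac"
  by (simp add: one_lam_def zeta_sym_Phi vac_delta)

lemma PhiL_invariant: "invariant_under (V_tilde_act c \<pi> \<Lambda>) (lcarrier (g_tilde c)) (\<Phi> ` L)"
  unfolding invariant_under_def g_tilde_def presented_lie_simps
  using V_act op_L L_fin_supp by auto

text \<open>Used twice: with \<open>\<rho>\<close> the action of \<open>g_tilde c\<close> and \<open>X\<close> its negative part, and with \<open>\<rho>\<close> the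
  action of \<open>g_quot c\<close> and \<open>X\<close> the whole algebra.\<close>

lemma generated_eq_PhiL:
  assumes \<rho>: "\<And>t b. b \<in> L \<Longrightarrow> \<rho> (C t) (\<Phi> b) = \<Phi> (app (op t) b)"
    and X: "X \<subseteq> range C" "\<And>k. C (fT k) \<in> X"
    and D: "\<Phi> ` L \<subseteq> D" and A: "\<Phi> vac \<in> A" "A \<subseteq> \<Phi> ` L"
  shows "generated_submodule pscale D \<rho> X A = \<Phi> ` L"
  unfolding generated_submodule_def
proof (rule hull_unique[OF A(2)])
  have "invariant_under \<rho> X (\<Phi> ` L)"
    unfolding invariant_under_def using X(1) \<rho> op_L by fastforce
  then show "pd.subspace (\<Phi> ` L) \<and> \<Phi> ` L \<subseteq> D \<and> invariant_under \<rho> X (\<Phi> ` L)"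
    using subspace_Phi[OF subspace_L] D by blast
  fix U assume AU: "A \<subseteq> U" and U: "pd.subspace U \<and> U \<subseteq> D \<and> invariant_under \<rho> X U"
  have "L \<subseteq> {b \<in> L. \<Phi> b \<in> U}"
  proof (rule L_minimal')
    show "fv.subspace {b \<in> L. \<Phi> b \<in> U}" using subspace_Phi_vimage U subspace_L by blast
    show "vac \<in> {b \<in> L. \<Phi> b \<in> U}" using AU A vac_L by blast
    fix k b assume b: "b \<in> {b \<in> L. \<Phi> b \<in> U}"
    then have "\<rho> (C (fT k)) (\<Phi> b) \<in> U" using U X(2) unfolding invariant_under_def by blast
    with b show "app (F k) b \<in> {b \<in> L. \<Phi> b \<in> U}" using \<rho>[of b "fT k"] F_L by simp
  qed
  then show "\<Phi> ` L \<subseteq> U" by blast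
qed

lemma minus_submodule_eq:
  assumes "\<Phi> vac \<in> A" "A \<subseteq> \<Phi> ` L"
  shows "minus_submodule c \<pi> \<Lambda> A = \<Phi> ` L"
  unfolding minus_submodule_def
proof (rule generated_eq_PhiL[where C = cl, OF _ _ _ _ assms])
  show "V_tilde_act c \<pi> \<Lambda> (cl t) (\<Phi> b) = \<Phi> (app (op t) b)" if "b \<in> L" for t b
    using that L_fin_supp by (intro V_act) blast
  have "g_tilde_minus c \<subseteq> lcarrier (g_tilde c)"
    unfolding g_tilde_minus_def g_tilde_def
    by (rule hull_minimal[where S = "lie_subalgebra _", OF _ lie_subalgebra_carrier])
      (auto simp: f_tilde_def presented_lie_simps)
  then show "g_tilde_minus c \<subseteq> range cl" by (simp add: g_tilde_def presented_lie_simps)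
  show "cl (fT k) \<in> g_tilde_minus c" for k
    unfolding g_tilde_minus_def f_tilde_def[abs_def] by (rule hull_inc) simp
  show "\<Phi> ` L \<subseteq> W" unfolding W_eq using L_fin_supp by blast
qed

lemma V_lam_eq: "V_lam c \<pi> \<Lambda> = \<Phi> ` L"
  unfolding V_lam_def one_lam_Phi by (rule minus_submodule_eq) (use vac_L in auto)

text \<open>The primitive part is the line through \<open>1\<^sub>\<lambda>\<close>.\<close>

lemma prim_submodule_eq: "minus_submodule c \<pi> \<Lambda> (V_tilde_prim c \<pi> \<Lambda>) = \<Phi> ` L"
proof (rule minus_submodule_eq)
  let ?N = "{x. \<exists>t. x = cl t \<and> app (op t) vac = 0}"
  have "g_tilde_plus c \<subseteq> ?N"
    unfolding g_tilde_plus_def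
  proof (rule hull_minimal)
    show "range (e_tilde c) \<subseteq> ?N"
    proof clarify
      fix k
      have "e_tilde c k = cl (eT k) \<and> app (op (eT k)) vac = 0"
        by (simp only: e_tilde_def lie_eval.simps gens.simps E_vac)
      then show "\<exists>t. e_tilde c k = cl t \<and> app (op t) vac = 0" ..
    qed
    have zero: "app (op Zero) vac = 0" by (simp only: lie_eval.simps app_zero_left)
    have add: "app (op (Add s t)) vac = 0" if "app (op s) vac = 0" "app (op t) vac = 0" for s t
      using that by (simp only: lie_eval.simps app_plus add_0)
    have scale: "app (op (Scale a s)) vac = 0" if "app (op s) vac = 0" for s a
      using that by (simp only: lie_eval.simps app_mult app_zero)
    have br: "app (op (Br s t)) vac = 0" if "app (op s) vac = 0" "app (op t) vac = 0" for s t
      using that by (simp only: lie_eval.simps lbr_def app_minus app_mult app_zero diff_self)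
    show "lie_subalgebra (g_tilde c) ?N"
      unfolding g_tilde_def by (rule lie_subalgebra_classes) (fact zero add scale br)+
  qed
  then have "V_tilde_act c \<pi> \<Lambda> x (\<Phi> vac) = 0" if x: "x \<in> g_tilde_plus c" for x
  proof -
    obtain t where "x = cl t" "app (op t) vac = 0" using \<open>g_tilde_plus c \<subseteq> ?N\<close> x by blast
    then show ?thesis by (simp only: V_act[OF vac_fin_supp] Phi_zero)
  qed
  then show "\<Phi> vac \<in> V_tilde_prim c \<pi> \<Lambda>"
    by (simp add: V_tilde_prim_def Phi_W vac_fin_supp)
  show "V_tilde_prim c \<pi> \<Lambda> \<subseteq> \<Phi> ` L"
  proof
    fix v assume v: "v \<in> V_tilde_prim c \<pi> \<Lambda>"
    then obtain b where b: "b \<in> fin_supp" "v = \<Phi> b" by (auto simp: V_tilde_prim_def W_eq)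
    have "app (E k) b = 0" for k
    proof -
      have "e_tilde c k \<in> g_tilde_plus c" unfolding g_tilde_plus_def by (rule hull_inc) simp
      then have "V_tilde_act c \<pi> \<Lambda> (cl (eT k)) (\<Phi> b) = 0"
        using v b by (auto simp: V_tilde_prim_def e_tilde_def)
      then have "\<Phi> (app (E k) b) = \<Phi> 0" by (simp add: V_act b Phi_zero)
      then show ?thesis by (simp only: \<Phi>_inject)
    qed
    then have "b = fscale (b []) vac" by (rule stripped_const)
    then have "b \<in> L" using fv.subspace_scale[OF subspace_L vac_L] by metis
    then show "v \<in> \<Phi> ` L" using b by blast
  qed
qed

text \<open>A representative in \<open>g_tilde c\<close> is chosen for each element of \<open>g_quot c\<close>; on \<open>\<Phi> ` L\<close> the choice is
  immaterial by \<open>op_full_cong\<close>.\<close>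

definition quot_act :: "'n lie_elt \<Rightarrow> 'i polydiff \<Rightarrow> 'i polydiff" where
  "quot_act X = V_tilde_act c \<pi> \<Lambda> (cl (SOME t. clq t = X))"

lemma quot_act_class:
  assumes b: "b \<in> L"
  shows "quot_act (clq t) (\<Phi> b) = \<Phi> (app (op t) b)"
proof -
  have "clq (SOME s. clq s = clq t) = clq t" by (rule someI[of "\<lambda>s. clq s = clq t" t]) simp
  then have "app (op (SOME s. clq s = clq t)) b = app (op t) b"
    by (intro op_full_cong[OF _ b]) (simp add: lie_class_eq_iff)
  moreover have "b \<in> fin_supp" using b L_fin_supp by blast
  ultimately show ?thesis by (simp add: quot_act_def V_act)
qed

lemma lie_rep_quot: "lie_rep (g_quot c) pscale (\<Phi> ` L) quot_act"
  unfolding g_quot_def by (rule lie_rep_Phi[OF subspace_L op_L quot_act_class])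

lemma factors: "factors_through_quot c \<pi> \<Lambda> (\<Phi> ` L) quot_act"
  unfolding factors_through_quot_def
proof (intro conjI ballI lie_rep_quot)
  fix x w assume "x \<in> lcarrier (g_tilde c)" "w \<in> \<Phi> ` L"
  then obtain t b where "x = cl t" "w = \<Phi> b" "b \<in> L"
    by (auto simp: g_tilde_def presented_lie_simps)
  moreover have "b \<in> fin_supp" using \<open>b \<in> L\<close> L_fin_supp by blast
  ultimately show "quot_act (to_quot c x) w = V_tilde_act c \<pi> \<Lambda> x w"
    by (simp add: to_quot_class quot_act_class V_act)
qed

lemma e_quot_class: "e_quot c k = clq (eT k)"
  by (simp add: e_quot_def e_tilde_def to_quot_class)

lemma f_quot_class: "f_quot c k = clq (fT k)"
  by (simp add: f_quot_def f_tilde_def to_quot_class)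

lemma coroot_class: "coroot c k = cl (aT k)"
  by (simp add: coroot_def g_tilde_def e_tilde_def f_tilde_def presented_lie_simps)

text \<open>The elements of \<open>cartan_h c\<close> with the stated property form a subspace containing the coroots. The
  functional is known to be linear on \<open>cartan_h c\<close> only, whence membership there is carried along.\<close>

lemma cartan_weight:
  assumes lin: "linear_functional_on (g_tilde c) (cartan_h c) \<Lambda>" and x: "x \<in> cartan_h c"
  shows "\<exists>t. x = cl t \<and> app (op t) vac = fscale (\<Lambda> x) vac"
proof -
  let ?S = "{x \<in> cartan_h c. \<exists>t. x = cl t \<and> app (op t) vac = fscale (\<Lambda> x) vac}"
  have h: "lie_subspace (g_tilde c) (cartan_h c)"
    unfolding cartan_h_def g_tilde_def
    by (rule lie_subspace_hull[OF lie_subspace_carrier]) (auto simp: coroot_class presented_lie_simps)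
  have add_h: "cl (Add s t) \<in> cartan_h c" and add_\<Lambda>: "\<Lambda> (cl (Add s t)) = \<Lambda> (cl s) + \<Lambda> (cl t)"
    if "cl s \<in> cartan_h c" "cl t \<in> cartan_h c" for s t
    using h lin that unfolding lie_subspace_def linear_functional_on_def g_tilde_def
    by (metis presented_lie_simps(3))+
  have scale_h: "cl (Scale a s) \<in> cartan_h c" and scale_\<Lambda>: "\<Lambda> (cl (Scale a s)) = a * \<Lambda> (cl s)"
    if "cl s \<in> cartan_h c" for s a
    using h lin that unfolding lie_subspace_def linear_functional_on_def g_tilde_def
    by (metis presented_lie_simps(4))+
  have zero_h: "cl Zero \<in> cartan_h c"
    using h by (simp add: lie_subspace_def g_tilde_def presented_lie_simps)
  have zero_\<Lambda>: "\<Lambda> (cl Zero) = 0"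
    using add_\<Lambda>[OF zero_h zero_h] by (simp add: lie_class_Add_Zero)
  have "cartan_h c \<subseteq> ?S"
    unfolding cartan_h_def[of c]
  proof (rule hull_minimal)
    show "range (coroot c) \<subseteq> {x \<in> lie_subspace (g_tilde c) hull range (coroot c).
        \<exists>t. x = cl t \<and> app (op t) vac = fscale (\<Lambda> x) vac}"
    proof clarify
      fix k
      have "coroot c k \<in> lie_subspace (g_tilde c) hull range (coroot c)" by (rule hull_inc) simp
      moreover have "app (op (aT k)) vac = fscale (\<Lambda> (coroot c k)) vac"
        by (simp only: lie_eval.simps gens.simps lbr_EF simp_thms if_True H_vac)
      ultimately show "coroot c k \<in> lie_subspace (g_tilde c) hull range (coroot c) \<and>
          (\<exists>t. coroot c k = cl t \<and> app (op t) vac = fscale (\<Lambda> (coroot c k)) vac)"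
        using coroot_class by blast
    qed
    have "app (op Zero) vac = fscale (\<Lambda> (cl Zero)) vac"
      by (simp only: lie_eval.simps app_zero_left zero_\<Lambda> fv.scale_zero_left)
    then have "cl Zero \<in> ?S" using zero_h by blast
    moreover have "ladd (g_tilde c) x y \<in> ?S" if xy: "x \<in> ?S" "y \<in> ?S" for x y
    proof -
      obtain s t where st: "x = cl s" "app (op s) vac = fscale (\<Lambda> x) vac"
        "y = cl t" "app (op t) vac = fscale (\<Lambda> y) vac" using xy by blast
      have h: "cl s \<in> cartan_h c" "cl t \<in> cartan_h c" using xy unfolding st(1,3) by blast+
      have "app (op (Add s t)) vac = fscale (\<Lambda> (cl (Add s t))) vac"
        unfolding lie_eval.simps app_plus st(2,4) add_\<Lambda>[OF h] fv.scale_left_distrib st(1,3) ..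
      then have "cl (Add s t) \<in> ?S" using add_h[OF h] by blast
      then show ?thesis by (simp only: st g_tilde_def presented_lie_simps)
    qed
    moreover have "lscale (g_tilde c) a x \<in> ?S" if x: "x \<in> ?S" for a x
    proof -
      obtain s where s: "x = cl s" "app (op s) vac = fscale (\<Lambda> x) vac" using x by blast
      have h: "cl s \<in> cartan_h c" using x unfolding s(1) by blast
      have "app (op (Scale a s)) vac = fscale (\<Lambda> (cl (Scale a s))) vac"
        unfolding lie_eval.simps app_mult app_sc s(2) scale_\<Lambda>[OF h] fv.scale_scale s(1) ..
      then have "cl (Scale a s) \<in> ?S" using scale_h[OF h] by blast
      then show ?thesis by (simp only: s g_tilde_def presented_lie_simps)
    qed
    moreover have "?S \<subseteq> lcarrier (g_tilde c)" by (auto simp: g_tilde_def presented_lie_simps)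
    ultimately have "lie_subspace (g_tilde c) ?S"
      unfolding lie_subspace_def by (auto simp: g_tilde_def presented_lie_simps)
    then show "lie_subspace (g_tilde c) {x \<in> lie_subspace (g_tilde c) hull range (coroot c).
        \<exists>t. x = cl t \<and> app (op t) vac = fscale (\<Lambda> x) vac}"
      unfolding cartan_h_def[of c] .
  qed
  with x show ?thesis by blast
qed

lemma Phi_vac_nonzero: "\<Phi> vac \<noteq> 0"
proof
  assume "\<Phi> vac = 0"
  then have "\<Phi> vac = \<Phi> 0" by (simp only: Phi_zero)
  then have "(vac :: 'n list \<Rightarrow> complex) = 0" by (simp only: \<Phi>_inject)
  then have "vac ([] :: 'n list) = 0" by (simp only: zero_fun_apply)
  then show False by (simp add: vac_def)
qed

lemma highest_weight:
  assumes lin: "linear_functional_on (g_tilde c) (cartan_h c) \<Lambda>"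
  shows "highest_weight_rep c pscale (\<Phi> ` L) quot_act \<Lambda> (\<Phi> vac)"
  unfolding highest_weight_rep_def
proof (intro conjI allI ballI lie_rep_quot Phi_vac_nonzero)
  show "\<Phi> vac \<in> \<Phi> ` L" using vac_L by blast
  show "quot_act (e_quot c k) (\<Phi> vac) = 0" for k
    unfolding e_quot_class quot_act_class[OF vac_L] lie_eval.simps gens.simps E_vac by (rule Phi_zero)
  show "quot_act (to_quot c x) (\<Phi> vac) = pscale (\<Lambda> x) (\<Phi> vac)" if "x \<in> cartan_h c" for x
    using cartan_weight[OF lin that] by (auto simp: to_quot_class quot_act_class[OF vac_L] Phi_scale)
  show "generated_submodule pscale (\<Phi> ` L) quot_act (lcarrier (g_quot c)) {\<Phi> vac} = \<Phi> ` L"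
    by (rule generated_eq_PhiL[where C = clq, OF quot_act_class])
      (auto simp: g_quot_def presented_lie_simps vac_L)
qed

lemma locally_nilpotent_PhiL:
  assumes "\<And>b. b \<in> L \<Longrightarrow> \<exists>n. (app (op t) ^^ n) b = 0"
  shows "locally_nilpotent_on (\<Phi> ` L) (quot_act (clq t))"
  unfolding locally_nilpotent_on_def
proof clarify
  fix b assume b: "b \<in> L"
  have "(app (op t) ^^ n) b \<in> L \<and> (quot_act (clq t) ^^ n) (\<Phi> b) = \<Phi> ((app (op t) ^^ n) b)" for n
    by (induction n) (simp_all add: b op_L quot_act_class)
  then show "\<exists>n. (quot_act (clq t) ^^ n) (\<Phi> b) = 0" using assms[OF b] Phi_zero by metis
qed

lemma irreducible: "irreducible_rep (g_quot c) pscale (\<Phi> ` L) quot_act"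
  unfolding irreducible_rep_def
proof (intro conjI allI impI lie_rep_quot)
  show "\<Phi> ` L \<noteq> {0}" using Phi_vac_nonzero vac_L by blast
  fix U assume U: "pd.subspace U \<and> U \<subseteq> \<Phi> ` L \<and> invariant_under quot_act (lcarrier (g_quot c)) U"
  let ?U = "{b \<in> L. \<Phi> b \<in> U}"
  have sub: "fv.subspace ?U" using subspace_Phi_vimage U subspace_L by blast
  have inv: "app (op t) b \<in> ?U" if b: "b \<in> ?U" for t b
  proof -
    have "quot_act (clq t) (\<Phi> b) \<in> U"
      using U b by (auto simp: invariant_under_def g_quot_def presented_lie_simps)
    with b show ?thesis using quot_act_class op_L by auto
  qed
  show "U = {0} \<or> U = \<Phi> ` L"
  proof (cases "U = {0}")
    case False
    then obtain u where u: "u \<in> U" "u \<noteq> 0" using pd.subspace_0 U by blast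
    then obtain b where b: "b \<in> L" "u = \<Phi> b" using U by blast
    then have "b \<noteq> 0" using u Phi_zero by metis
    then have "?U \<noteq> {0}" using b u by blast
    then have "vac \<in> ?U"
      using L_fin_supp inv[of _ "eT _"] by (intro vac_in_submodule[OF sub]) auto
    then have "L \<subseteq> ?U" by (rule L_minimal'[OF sub]) (use inv[of _ "fT _"] in auto)
    then show ?thesis using U by blast
  qed simp
qed

text \<open>The elements of \<open>g_quot c\<close> whose matrix coefficients lie in the span of those of a finite spanning
  set form a subspace, hence are everything.\<close>

lemma finite_dim:
  assumes int: "\<And>k. \<exists>n. \<Lambda> (coroot c k) = of_nat n" and fin: "lie_finite_dim (g_quot c)"
  shows "finite_dim_space pscale (\<Phi> ` L)"
proof -
  interpret r: module_hom "\<lambda>a T. sc a * T" fscale matrix_coeffs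
    by (rule module_hom_matrix_coeffs)
  obtain B0 where B0: "finite B0" "B0 \<subseteq> lcarrier (g_quot c)"
    "lie_subspace (g_quot c) hull B0 = lcarrier (g_quot c)"
    using fin by (auto simp: lie_finite_dim_def)
  define T0 where "T0 = (\<lambda>X. op (SOME t. clq t = X)) ` B0"
  have "finite T0" using B0 by (simp add: T0_def)
  moreover have "matrix_coeffs (op t) \<in> fv.span (matrix_coeffs ` T0)" for t
  proof -
    let ?S = "{X. \<exists>t. X = clq t \<and> matrix_coeffs (op t) \<in> fv.span (matrix_coeffs ` T0)}"
    have "lie_subspace (g_quot c) hull B0 \<subseteq> ?S"
    proof (rule hull_minimal)
      show "B0 \<subseteq> ?S"
      proof
        fix X assume X: "X \<in> B0"
        then obtain t where "clq t = X" using B0 by (auto simp: g_quot_def presented_lie_simps)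
        then have "clq (SOME t. clq t = X) = X" by (rule someI[of "\<lambda>t. clq t = X"])
        then have "X = clq (SOME t. clq t = X)" by simp
        moreover have "matrix_coeffs (op (SOME t. clq t = X)) \<in> fv.span (matrix_coeffs ` T0)"
          by (intro fv.span_base imageI) (use X in \<open>simp add: T0_def\<close>)
        ultimately show "X \<in> ?S" by (intro CollectI exI conjI)
      qed
      have zero: "matrix_coeffs (op Zero) \<in> fv.span (matrix_coeffs ` T0)"
        by (simp only: lie_eval.simps r.zero fv.span_zero)
      have add: "matrix_coeffs (op (Add s t)) \<in> fv.span (matrix_coeffs ` T0)"
        if "matrix_coeffs (op s) \<in> fv.span (matrix_coeffs ` T0)"
          "matrix_coeffs (op t) \<in> fv.span (matrix_coeffs ` T0)" for s t
        using that by (simp only: lie_eval.simps r.add fv.span_add)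
      have scale: "matrix_coeffs (op (Scale a s)) \<in> fv.span (matrix_coeffs ` T0)"
        if "matrix_coeffs (op s) \<in> fv.span (matrix_coeffs ` T0)" for s a
        using that by (simp only: lie_eval.simps r.scale fv.span_scale)
      show "lie_subspace (g_quot c) ?S"
        unfolding g_quot_def by (rule lie_subspace_classes) (fact zero add scale)+
    qed
    moreover have "clq t \<in> lcarrier (g_quot c)" by (simp add: g_quot_def presented_lie_simps)
    ultimately obtain t' where t': "clq t = clq t'"
      "matrix_coeffs (op t') \<in> fv.span (matrix_coeffs ` T0)" using B0(3) by blast
    have "matrix_coeffs (op t) = matrix_coeffs (op t')"
      using t'(1) op_full_cong[OF _ fword_L] by (simp add: matrix_coeffs_def lie_class_eq_iff)
    then show ?thesis using t'(2) by simp
  qed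
  ultimately have "\<exists>B. finite B \<and> B \<subseteq> L \<and> L = fv.span B" by (rule L_finite_dim[OF int])
  then obtain B where B: "finite B" "L = fv.span B" by (elim exE conjE)
  have "\<Phi> ` L = pd.span (\<Phi> ` B)"
    unfolding B(2) by (rule module_hom.span_image[OF module_hom_Phi, symmetric])
  then show ?thesis using B(1) unfolding finite_dim_space_def by blast
qed

end

lemma nonneg_real_integer_is_nat:
  assumes "z \<in> \<real>\<^sub>\<ge>\<^sub>0" "z \<in> \<int>"
  shows "\<exists>n. z = of_nat n"
proof -
  obtain i where i: "z = of_int i" using assms(2) by (auto elim: Ints_cases)
  obtain r where r: "z = of_real r" "0 \<le> r" using assms(1) by (auto elim: nonneg_Reals_cases)
  have "0 \<le> i" using i r by (metis of_real_of_int_eq of_real_eq_iff of_int_0_le_iff)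
  then show ?thesis using i by (intro exI[of _ "nat i"]) simp
qed

theorem theorem2p6:
  fixes c :: "'n::finite \<Rightarrow> 'n \<Rightarrow> int"
    and \<pi> :: "'i \<Rightarrow> 'n"
    and \<Lambda> :: "'n lie_elt \<Rightarrow> complex"
  assumes cartan: "generalized_cartan c"
    and surj: "surj \<pi>"
    and fibres: "\<And>k. countable (\<pi> -` {k}) \<and> infinite (\<pi> -` {k})"
    and dominant: "dominant_weight c \<Lambda>"
  shows "invariant_under (V_tilde_act c \<pi> \<Lambda>) (lcarrier (g_tilde c))
           (minus_submodule c \<pi> \<Lambda> (V_tilde_prim c \<pi> \<Lambda>)) \<and>
         (\<exists>\<sigma>. factors_through_quot c \<pi> \<Lambda> (minus_submodule c \<pi> \<Lambda> (V_tilde_prim c \<pi> \<Lambda>)) \<sigma>) \<and>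
         (\<exists>\<sigma>. factors_through_quot c \<pi> \<Lambda> (V_lam c \<pi> \<Lambda>) \<sigma> \<and>
            highest_weight_rep c pscale (V_lam c \<pi> \<Lambda>) \<sigma> \<Lambda> (one_lam \<pi>) \<and>
            (integral_weight c \<Lambda> \<longrightarrow>
               (\<forall>k. locally_nilpotent_on (V_lam c \<pi> \<Lambda>) (\<sigma> (e_quot c k)) \<and>
                    locally_nilpotent_on (V_lam c \<pi> \<Lambda>) (\<sigma> (f_quot c k)))) \<and>
            (lie_finite_dim (g_quot c) \<longrightarrow>
               irreducible_rep (g_quot c) pscale (V_lam c \<pi> \<Lambda>) \<sigma> \<and>
               (integral_weight c \<Lambda> \<longrightarrow> finite_dim_space pscale (V_lam c \<pi> \<Lambda>))))"
proof -
  interpret V_tilde_module c \<Lambda> \<pi>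
    by unfold_locales (use cartan fibres in auto)
  have lin: "linear_functional_on (g_tilde c) (cartan_h c) \<Lambda>"
    using dominant by (simp add: dominant_weight_def)
  have int: "\<exists>n. \<Lambda> (coroot c k) = of_nat n" if "integral_weight c \<Lambda>" for k
    by (rule nonneg_real_integer_is_nat)
      (use that dominant in \<open>auto simp: integral_weight_def dominant_weight_def\<close>)
  have nil_e: "locally_nilpotent_on (\<Phi> ` L) (quot_act (e_quot c k))" for k
    unfolding e_quot_class
  proof (rule locally_nilpotent_PhiL)
    fix b assume "b \<in> L"
    then have "b \<in> fin_supp" using L_fin_supp by blast
    then show "\<exists>n. (app (op (eT k)) ^^ n) b = 0"
      unfolding lie_eval.simps gens.simps by (rule strip_locally_nilpotent)
  qed
  have nil_f: "locally_nilpotent_on (\<Phi> ` L) (quot_act (f_quot c k))" if "integral_weight c \<Lambda>" for k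
    unfolding f_quot_class
    by (rule locally_nilpotent_PhiL) (use F_locally_nilpotent int[OF that, of k] in auto)
  show ?thesis
    unfolding prim_submodule_eq V_lam_eq one_lam_Phi
    using PhiL_invariant factors highest_weight[OF lin] nil_e nil_f irreducible finite_dim int
    by blast
qed

end
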